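(* Let $n,m\ge 1$ and let $1\to\mathbb{Z}\to\Gamma\to\mathbb{Z}^n\to 1$ be a central extension with non-trivial k-invariant $\omega\in H^2(\mathbb{Z}^n;\mathbb{Z})$. Write $\omega=c_1e_1^*\wedge e_{t+1}^*+\dots+c_te_t^*\wedge e_{2t}^*$ with respect to some basis $e_1,\dots,e_n$ of $\mathbb{Z}^n$, where $1\le t\le n/2$ and $c_1,\dots,c_t$ are positive integers with $c_i\mid c_{i+1}$ for $1\le i\le t-1$. For $k\ge 1$ put $\mu_k=\prod_{i=1}^t k/\gcd(k,c_i)$. Then there is a decomposition into (non-empty) connected components $$\mathrm{Hom}(\Gamma,U(m))=\coprod_{p(z)\in\mathbb{C}[z]^m_\Gamma}\mathrm{Hom}(\Gamma,U(m))_{p(z)},$$ and the number of components is the coefficient of $x^m$ in the generating function $\prod_{k\ge 1}\frac{1}{(1-x^{\mu_k})^{\Phi(k)}}$, where $\Phi$ is Euler's phi function.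
   Context: $U(m)$ is the group of $m\times m$ unitary matrices and $[a,b]=aba^{-1}b^{-1}$. Every class $\omega\in H^2(\mathbb{Z}^n;\mathbb{Z})$ (skew-symmetric integral bilinear form) can be written in the displayed form for some basis. In that basis, $\Gamma$ is the group with generators $a_1,\dots,a_n,x$ and relations: $x$ is central, $[a_i,a_{t+i}]=x^{c_i}$ for $1\le i\le t$, and all other pairs $a_i,a_{i'}$ commute; the subgroup $\mathbb{Z}$ of the extension is generated by $x$. $\mathrm{Hom}(\Gamma,U(m))$ is topologized as a subspace of $U(m)^{n+1}$ via $f\mapsto(f(x),f(a_1),\dots,f(a_n))$. For a polynomial $p(z)\in\mathbb{C}[z]$, $\mathrm{Hom}(\Gamma,U(m))_{p(z)}$ is the subspace of those $f$ such that $f(x)$ has characteristic polynomial $p(z)$. $\mathbb{C}[z]^m_\Gamma$ is the set of monic complex polynomials $p(z)$ of degree $m$ such that (1) all roots of $p(z)$ are roots of unity, and (2) if a root $\lambda$ of $p(z)$ is a primitive $k$-th root of unity, then the multiplicity of $\lambda$ in $p(z)$ is divisible by $\mu_k$. *)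

theory Defs
  imports "HOL-Analysis.Analysis" "HOL-Algebra.Elementary_Groups" "HOL-Number_Theory.Totient"
begin

subsection \<open>Central extensions of \<open>\<int>\<^sup>n\<close> by \<open>\<int>\<close> and their k-invariants\<close>

definition Zn_group :: "(int ^ 'n) monoid" where
  "Zn_group = \<lparr>carrier = UNIV, monoid.mult = (+), one = 0\<rparr>"

definition central_extension ::
    "('g, 'b) monoid_scheme \<Rightarrow> (int \<Rightarrow> 'g) \<Rightarrow> ('g \<Rightarrow> int ^ 'n) \<Rightarrow> bool" where
  "central_extension \<Gamma> \<iota> \<pi> \<longleftrightarrow>
     group \<Gamma> \<and> \<iota> \<in> mon integer_group \<Gamma> \<and> \<pi> \<in> epi \<Gamma> Zn_group \<and>
     kernel \<Gamma> Zn_group \<pi> = range \<iota> \<and>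
     (\<forall>k. \<forall>g \<in> carrier \<Gamma>. \<iota> k \<otimes>\<^bsub>\<Gamma>\<^esub> g = g \<otimes>\<^bsub>\<Gamma>\<^esub> \<iota> k)"

text \<open>\<open>H\<^sup>2(\<int>\<^sup>n; \<int>)\<close> is ordinary group cohomology with trivial coefficients, computed by
  inhomogeneous cochains.\<close>

definition two_cocycles :: "(int ^ 'n \<Rightarrow> int ^ 'n \<Rightarrow> int) set" where
  "two_cocycles = {f. \<forall>u v w. f u v + f (u + v) w = f v w + f u (v + w)}"

definition cohomologous ::
    "((int ^ 'n \<Rightarrow> int ^ 'n \<Rightarrow> int) \<times> (int ^ 'n \<Rightarrow> int ^ 'n \<Rightarrow> int)) set" where
  "cohomologous = {(f, g). f \<in> two_cocycles \<and> g \<in> two_cocycles \<and>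
     (\<exists>h. \<forall>u v. f u v - g u v = h u + h v - h (u + v))}"

definition H2 :: "(int ^ 'n \<Rightarrow> int ^ 'n \<Rightarrow> int) set set" where
  "H2 = two_cocycles // cohomologous"

definition H2_class :: "(int ^ 'n \<Rightarrow> int ^ 'n \<Rightarrow> int) \<Rightarrow> (int ^ 'n \<Rightarrow> int ^ 'n \<Rightarrow> int) set" where
  "H2_class f = cohomologous `` {f}"

text \<open>The factor sets of all set-theoretic sections of \<open>\<pi>\<close> make up exactly one cohomology
  class (lemma \<open>k_invariant_in_H2\<close> below), which is the k-invariant.\<close>

definition k_invariant ::
    "('g, 'b) monoid_scheme \<Rightarrow> (int \<Rightarrow> 'g) \<Rightarrow> ('g \<Rightarrow> int ^ 'n) \<Rightarrow> (int ^ 'n \<Rightarrow> int ^ 'n \<Rightarrow> int) set" where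
  "k_invariant \<Gamma> \<iota> \<pi> =
     {f. \<exists>s. (\<forall>u. s u \<in> carrier \<Gamma> \<and> \<pi> (s u) = u) \<and>
             (\<forall>u v. s u \<otimes>\<^bsub>\<Gamma>\<^esub> s v = \<iota> (f u v) \<otimes>\<^bsub>\<Gamma>\<^esub> s (u + v))}"

definition Zn_basis :: "(nat \<Rightarrow> int ^ 'n) \<Rightarrow> bool" where
  "Zn_basis e \<longleftrightarrow> inj_on e {1..CARD('n)} \<and>
     \<not> module.dependent (\<lambda>k v. k *s v) (e ` {1..CARD('n)}) \<and>
     module.span (\<lambda>k v. k *s v) (e ` {1..CARD('n)}) = UNIV"

text \<open>\<open>dual_basis e i\<close> is the coordinate functional \<open>e\<^sub>i\<^sup>*\<close>.\<close>

definition dual_basis :: "(nat \<Rightarrow> int ^ 'n) \<Rightarrow> nat \<Rightarrow> int ^ 'n \<Rightarrow> int" where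
  "dual_basis e i v = module.representation (\<lambda>k v. k *s v) (e ` {1..CARD('n)}) v (e i)"

text \<open>The product \<open>\<alpha> \<and> \<beta>\<close> of two classes in \<open>H\<^sup>1(\<int>\<^sup>n; \<int>) = Hom(\<int>\<^sup>n, \<int>)\<close> is their cup product,
  which is represented by the cocycle \<open>(u, v) \<mapsto> \<alpha> u * \<beta> v\<close>.  An extension with k-invariant
  \<open>H2_class f\<close> has commutator pairing \<open>f u v - f v u\<close>, so \<open>\<alpha> \<and> \<beta>\<close> corresponds to the skew form
  \<open>\<alpha> u * \<beta> v - \<alpha> v * \<beta> u\<close>, and lifts \<open>a\<^sub>i\<close>, \<open>a\<^sub>j\<close> of \<open>e\<^sub>i\<close>, \<open>e\<^sub>j\<close> in an extension with k-invariant
  \<open>c e\<^sub>i\<^sup>* \<and> e\<^sub>j\<^sup>*\<close> satisfy \<open>[a\<^sub>i, a\<^sub>j] = x\<^sup>c\<close> for \<open>x = \<iota> 1\<close>.\<close>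

definition cup :: "(int ^ 'n \<Rightarrow> int) \<Rightarrow> (int ^ 'n \<Rightarrow> int) \<Rightarrow> int ^ 'n \<Rightarrow> int ^ 'n \<Rightarrow> int" where
  "cup \<alpha> \<beta> u v = \<alpha> u * \<beta> v"

lemma k_invariant_in_H2:
  fixes \<Gamma> :: "('g, 'b) monoid_scheme" and \<pi> :: "'g \<Rightarrow> int ^ 'n"
  assumes "central_extension \<Gamma> \<iota> \<pi>"
  shows "k_invariant \<Gamma> \<iota> \<pi> \<in> H2"
proof -
  interpret group \<Gamma> using assms by (simp add: central_extension_def)
  have \<iota>: "\<iota> \<in> mon integer_group \<Gamma>" and \<pi>: "\<pi> \<in> epi \<Gamma> Zn_group"
    and exact: "kernel \<Gamma> Zn_group \<pi> = range \<iota>"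
    using assms by (simp_all add: central_extension_def)
  have cen: "g \<otimes>\<^bsub>\<Gamma>\<^esub> \<iota> k = \<iota> k \<otimes>\<^bsub>\<Gamma>\<^esub> g" if "g \<in> carrier \<Gamma>" for k g
    using assms that unfolding central_extension_def by metis
  have icl [simp]: "\<iota> k \<in> carrier \<Gamma>" for k
    using \<iota> by (auto simp: mon_def hom_def integer_group_def)
  have iadd: "\<iota> k \<otimes>\<^bsub>\<Gamma>\<^esub> \<iota> l = \<iota> (k + l)" for k l
    using \<iota> by (auto simp: mon_def hom_def integer_group_def)
  have iinj: "\<iota> k = \<iota> l \<longleftrightarrow> k = l" for k l
    using \<iota> by (auto simp: mon_def inj_on_def integer_group_def)
  have pmul: "\<pi> (g \<otimes>\<^bsub>\<Gamma>\<^esub> h) = \<pi> g + \<pi> h" if "g \<in> carrier \<Gamma>" "h \<in> carrier \<Gamma>" for g h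
    using \<pi> that by (auto simp: epi_def hom_def Zn_group_def)
  have ker: "\<exists>k. g = \<iota> k" if "g \<in> carrier \<Gamma>" "\<pi> g = 0" for g
    using exact that by (auto simp: kernel_def Zn_group_def)
  have pi\<iota>: "\<pi> (\<iota> k) = 0" for k
  proof -
    have "\<iota> k \<in> kernel \<Gamma> Zn_group \<pi>" using exact by auto
    then show ?thesis by (simp add: kernel_def Zn_group_def)
  qed
  have diff: "\<exists>k. g = \<iota> k \<otimes>\<^bsub>\<Gamma>\<^esub> h" if gh: "g \<in> carrier \<Gamma>" "h \<in> carrier \<Gamma>" "\<pi> g = \<pi> h" for g h
  proof -
    have "\<pi> (g \<otimes>\<^bsub>\<Gamma>\<^esub> inv\<^bsub>\<Gamma>\<^esub> h) + \<pi> h = \<pi> g"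
      using gh by (simp add: pmul [symmetric] m_assoc)
    then have "\<pi> (g \<otimes>\<^bsub>\<Gamma>\<^esub> inv\<^bsub>\<Gamma>\<^esub> h) = 0" using gh by simp
    then obtain k where "g \<otimes>\<^bsub>\<Gamma>\<^esub> inv\<^bsub>\<Gamma>\<^esub> h = \<iota> k" using ker gh by blast
    then have "g = \<iota> k \<otimes>\<^bsub>\<Gamma>\<^esub> h" using gh by (metis inv_solve_right' icl)
    then show ?thesis ..
  qed
  have surj: "\<exists>g \<in> carrier \<Gamma>. \<pi> g = u" for u
    using \<pi> unfolding epi_def Zn_group_def by (simp add: set_eq_iff image_iff) metis
  then obtain s where s [simp]: "s u \<in> carrier \<Gamma>" "\<pi> (s u) = u" for u by metis
  have "\<exists>k. s u \<otimes>\<^bsub>\<Gamma>\<^esub> s v = \<iota> k \<otimes>\<^bsub>\<Gamma>\<^esub> s (u + v)" for u v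
    by (rule diff) (auto simp: pmul)
  then obtain f where f: "s u \<otimes>\<^bsub>\<Gamma>\<^esub> s v = \<iota> (f u v) \<otimes>\<^bsub>\<Gamma>\<^esub> s (u + v)" for u v by metis
  have cocyc: "g \<in> two_cocycles"
    if r [simp]: "\<And>u. r u \<in> carrier \<Gamma>"
      and g: "\<And>u v. r u \<otimes>\<^bsub>\<Gamma>\<^esub> r v = \<iota> (g u v) \<otimes>\<^bsub>\<Gamma>\<^esub> r (u + v)"
    for r :: "int ^ 'n \<Rightarrow> 'g" and g
  proof -
    have "g u v + g (u + v) w = g v w + g u (v + w)" for u v w
    proof -
      have "(r u \<otimes>\<^bsub>\<Gamma>\<^esub> r v) \<otimes>\<^bsub>\<Gamma>\<^esub> r w = \<iota> (g u v + g (u + v) w) \<otimes>\<^bsub>\<Gamma>\<^esub> r (u + v + w)"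
        by (simp add: g m_assoc flip: iadd)
      moreover have "r u \<otimes>\<^bsub>\<Gamma>\<^esub> (r v \<otimes>\<^bsub>\<Gamma>\<^esub> r w) = \<iota> (g v w) \<otimes>\<^bsub>\<Gamma>\<^esub> (r u \<otimes>\<^bsub>\<Gamma>\<^esub> r (v + w))"
        by (simp add: g [of v w] cen flip: m_assoc)
      then have "r u \<otimes>\<^bsub>\<Gamma>\<^esub> (r v \<otimes>\<^bsub>\<Gamma>\<^esub> r w) = \<iota> (g v w + g u (v + w)) \<otimes>\<^bsub>\<Gamma>\<^esub> r (u + v + w)"
        by (simp add: g [of u "v + w"] add.assoc iadd flip: m_assoc)
      ultimately have "\<iota> (g u v + g (u + v) w) \<otimes>\<^bsub>\<Gamma>\<^esub> r (u + v + w) =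
          \<iota> (g v w + g u (v + w)) \<otimes>\<^bsub>\<Gamma>\<^esub> r (u + v + w)"
        by (simp add: m_assoc)
      then show ?thesis by (simp add: iinj)
    qed
    then show ?thesis by (simp add: two_cocycles_def)
  qed
  have prodh: "(\<iota> a \<otimes>\<^bsub>\<Gamma>\<^esub> g) \<otimes>\<^bsub>\<Gamma>\<^esub> (\<iota> b \<otimes>\<^bsub>\<Gamma>\<^esub> h) = \<iota> (a + b) \<otimes>\<^bsub>\<Gamma>\<^esub> (g \<otimes>\<^bsub>\<Gamma>\<^esub> h)"
    if [simp]: "g \<in> carrier \<Gamma>" "h \<in> carrier \<Gamma>" for a b g h
  proof -
    have "(\<iota> a \<otimes>\<^bsub>\<Gamma>\<^esub> g) \<otimes>\<^bsub>\<Gamma>\<^esub> (\<iota> b \<otimes>\<^bsub>\<Gamma>\<^esub> h) = \<iota> a \<otimes>\<^bsub>\<Gamma>\<^esub> (g \<otimes>\<^bsub>\<Gamma>\<^esub> \<iota> b) \<otimes>\<^bsub>\<Gamma>\<^esub> h"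
      by (simp add: m_assoc)
    also have "\<dots> = \<iota> (a + b) \<otimes>\<^bsub>\<Gamma>\<^esub> (g \<otimes>\<^bsub>\<Gamma>\<^esub> h)"
      by (simp only: cen [OF that(1)]) (simp add: m_assoc flip: iadd)
    finally show ?thesis .
  qed
  have "k_invariant \<Gamma> \<iota> \<pi> = cohomologous `` {f}"
  proof (intro Set.set_eqI iffI)
    fix g assume "g \<in> k_invariant \<Gamma> \<iota> \<pi>"
    then obtain r where r [simp]: "\<And>u. r u \<in> carrier \<Gamma>" "\<And>u. \<pi> (r u) = u"
      and g: "\<And>u v. r u \<otimes>\<^bsub>\<Gamma>\<^esub> r v = \<iota> (g u v) \<otimes>\<^bsub>\<Gamma>\<^esub> r (u + v)"
      by (auto simp: k_invariant_def)
    have "\<exists>k. s u = \<iota> k \<otimes>\<^bsub>\<Gamma>\<^esub> r u" for u by (rule diff) auto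
    then obtain h where h: "s u = \<iota> (h u) \<otimes>\<^bsub>\<Gamma>\<^esub> r u" for u by metis
    have "f u v - g u v = h u + h v - h (u + v)" for u v
    proof -
      have "s u \<otimes>\<^bsub>\<Gamma>\<^esub> s v = \<iota> (h u + h v + g u v) \<otimes>\<^bsub>\<Gamma>\<^esub> r (u + v)"
        unfolding h [of u] h [of v] by (simp only: prodh r g) (simp add: iadd flip: m_assoc)
      moreover have "s u \<otimes>\<^bsub>\<Gamma>\<^esub> s v = \<iota> (f u v + h (u + v)) \<otimes>\<^bsub>\<Gamma>\<^esub> r (u + v)"
        by (simp add: f h [of "u + v"] iadd flip: m_assoc)
      ultimately show ?thesis by (simp add: iinj)
    qed
    then show "g \<in> cohomologous `` {f}"
      using cocyc [OF s(1) f] cocyc [OF r(1) g] by (auto simp: cohomologous_def)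
  next
    fix g assume "g \<in> cohomologous `` {f}"
    then obtain h where h: "\<And>u v. f u v - g u v = h u + h v - h (u + v)"
      by (auto simp: cohomologous_def)
    define r where "r u = \<iota> (- h u) \<otimes>\<^bsub>\<Gamma>\<^esub> s u" for u
    have "r u \<otimes>\<^bsub>\<Gamma>\<^esub> r v = \<iota> (g u v) \<otimes>\<^bsub>\<Gamma>\<^esub> r (u + v)" for u v
    proof -
      have "r u \<otimes>\<^bsub>\<Gamma>\<^esub> r v = \<iota> (- h u + - h v + f u v) \<otimes>\<^bsub>\<Gamma>\<^esub> s (u + v)"
        unfolding r_def by (simp only: prodh s f) (simp add: iadd flip: m_assoc)
      also have "- h u + - h v + f u v = g u v + - h (u + v)" using h [of u v] by simp
      finally show ?thesis by (simp add: r_def iadd flip: m_assoc)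
    qed
    moreover have "\<forall>u. r u \<in> carrier \<Gamma> \<and> \<pi> (r u) = u" by (simp add: r_def pmul pi\<iota>)
    ultimately show "g \<in> k_invariant \<Gamma> \<iota> \<pi>" unfolding k_invariant_def by blast
  qed
  then show ?thesis using cocyc [OF s(1) f] by (auto simp: H2_def quotient_def)
qed


subsection \<open>The unitary group and spaces of representations\<close>

definition conj_transpose :: "complex ^ 'm ^ 'm \<Rightarrow> complex ^ 'm ^ 'm" where
  "conj_transpose A = (\<chi> i j. cnj (A $ j $ i))"

definition unitary_matrices :: "(complex ^ 'm ^ 'm) set" where
  "unitary_matrices = {A. A ** conj_transpose A = mat 1 \<and> conj_transpose A ** A = mat 1}"

definition unitary_group :: "(complex ^ 'm ^ 'm) monoid" where
  "unitary_group = \<lparr>carrier = unitary_matrices, monoid.mult = (\<lambda>A B. A ** B), one = mat 1\<rparr>"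

definition charpoly :: "complex ^ 'm ^ 'm \<Rightarrow> complex poly" where
  "charpoly A = det (\<chi> i j. (if i = j then [:0, 1:] else 0) - [:A $ i $ j:])"

text \<open>Homomorphisms are required to be extensional, so that two of them are equal iff they
  agree on the group.\<close>

definition Hom_U :: "('g, 'b) monoid_scheme \<Rightarrow> ('g \<Rightarrow> complex ^ 'm ^ 'm) set" where
  "Hom_U \<Gamma> = hom \<Gamma> unitary_group \<inter> extensional (carrier \<Gamma>)"

text \<open>The topology induced by \<open>f \<mapsto> (f x, f (a 1), \<dots>, f (a n)) \<in> U(m)\<^sup>n\<^sup>+\<^sup>1\<close>.\<close>

definition Hom_U_topology ::
    "('g, 'b) monoid_scheme \<Rightarrow> nat \<Rightarrow> 'g \<Rightarrow> (nat \<Rightarrow> 'g) \<Rightarrow> ('g \<Rightarrow> complex ^ 'm ^ 'm) topology" where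
  "Hom_U_topology \<Gamma> n x a =
     pullback_topology (Hom_U \<Gamma>) (\<lambda>f. \<lambda>i\<in>{0..n}. if i = 0 then f x else f (a i))
       (product_topology (\<lambda>_. top_of_set unitary_matrices) {0..n})"

definition Hom_U_charpoly ::
    "('g, 'b) monoid_scheme \<Rightarrow> 'g \<Rightarrow> complex poly \<Rightarrow> ('g \<Rightarrow> complex ^ 'm ^ 'm) set" where
  "Hom_U_charpoly \<Gamma> x p = {f \<in> Hom_U \<Gamma>. charpoly (f x) = p}"


subsection \<open>The admissible characteristic polynomials\<close>

definition mu :: "nat \<Rightarrow> (nat \<Rightarrow> nat) \<Rightarrow> nat \<Rightarrow> nat" where
  "mu t c k = (\<Prod>i = 1..t. k div gcd k (c i))"

definition primitive_root_of_unity :: "nat \<Rightarrow> complex \<Rightarrow> bool" where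
  "primitive_root_of_unity k z \<longleftrightarrow> k \<ge> 1 \<and> z ^ k = 1 \<and> (\<forall>j. 1 \<le> j \<and> j < k \<longrightarrow> z ^ j \<noteq> 1)"

definition admissible_polys :: "nat \<Rightarrow> (nat \<Rightarrow> nat) \<Rightarrow> nat \<Rightarrow> complex poly set" where
  "admissible_polys t c m =
     {p. lead_coeff p = 1 \<and> degree p = m \<and>
         (\<forall>z. poly p z = 0 \<longrightarrow> (\<exists>k\<ge>1. z ^ k = 1)) \<and>
         (\<forall>z k. poly p z = 0 \<and> primitive_root_of_unity k z \<longrightarrow> mu t c k dvd Polynomial.order z p)}"

text \<open>The \<open>k\<close>-th factor of the generating function, as a formal power series; the index is shifted
  because infinite products start at 0.\<close>

definition gen_factor :: "nat \<Rightarrow> (nat \<Rightarrow> nat) \<Rightarrow> nat \<Rightarrow> rat fps" where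
  "gen_factor t c j = (let k = Suc j in 1 / (1 - fps_X ^ mu t c k) ^ totient k)"

end

theory Submission
  imports Defs "HOL-Computational_Algebra.Fundamental_Theorem_Algebra"
begin

text \<open>Since the k-invariant is represented by \<open>f u v = \<Sum> c\<^sub>i u\<^sub>i v\<^sub>t\<^sub>+\<^sub>i\<close>, the group \<open>\<Gamma>\<close> is \<open>\<int> \<times> \<int>\<^sup>n\<close> with
  multiplication twisted by \<open>f\<close>, and a homomorphism to \<open>U(m)\<close> is a family \<open>G j u\<close> of unitary
  matrices with \<open>G j u ** G l v = G (j + l + f u v) (u + v)\<close>.  On an eigenspace of \<open>x\<close> with
  eigenvalue \<open>z\<close> of order \<open>k\<close>, the elements whose \<open>(t + i)\<close>-th coordinates are divisible by
  \<open>q\<^sub>i = k / gcd k c\<^sub>i\<close> act by commuting matrices.  A joint eigenvector of these generates an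
  invariant block of dimension \<open>\<mu>\<^sub>k = \<Prod> q\<^sub>i\<close>, on which \<open>a\<^sub>i\<close> and \<open>a\<^sub>t\<^sub>+\<^sub>i\<close> act as clock and shift matrices
  twisted by a character of \<open>\<int>\<^sup>n\<close>.  Splitting off orthogonal blocks shows that the
  characteristic polynomial \<open>p\<close> of \<open>x\<close> determines the representation up to the choice of an
  orthonormal basis and of one character per block.  Both can be varied continuously (a unitary
  matrix is joined to \<open>1\<close> by diagonalizing it), so each \<open>Hom(\<Gamma>, U(m))\<^sub>p\<close> is path connected;
  it is clopen because only finitely many \<open>p\<close> occur.

  For the count, dividing by \<open>(X - z)\<^bsup>\<mu>\<^esup>\<close> shows that admitting one more root \<open>z\<close> multiplies the
  generating function by \<open>1 / (1 - x\<^bsup>\<mu>\<^esup>)\<close>, and there are \<open>\<Phi>(k)\<close> roots of unity of order \<open>k\<close>.\<close>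

section \<open>Hermitian linear algebra\<close>

definition hinner :: "complex ^ 'm \<Rightarrow> complex ^ 'm \<Rightarrow> complex" where
  "hinner u v = (\<Sum>i\<in>UNIV. cnj (u $ i) * v $ i)"

text \<open>The rank-one operator \<open>u v\<^sup>*\<close>; for an orthonormal family the sum of
  the \<open>outer (w \<kappa>) (w \<kappa>)\<close> is the projection onto its span.\<close>

definition outer :: "complex ^ 'm \<Rightarrow> complex ^ 'm \<Rightarrow> complex ^ 'm ^ 'm" where
  "outer u v = (\<chi> i j. u $ i * cnj (v $ j))"

definition orthonormal_family :: "'k set \<Rightarrow> ('k \<Rightarrow> complex ^ 'm) \<Rightarrow> bool" where
  "orthonormal_family K w \<longleftrightarrow> finite K \<and>
     (\<forall>\<kappa>\<in>K. \<forall>\<kappa>'\<in>K. hinner (w \<kappa>) (w \<kappa>') = (if \<kappa> = \<kappa>' then 1 else 0))"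

text \<open>Completeness is expressed as a resolution of the identity, so that a matrix can be
  recovered from its action on the basis by multiplying it with this sum.\<close>

definition onb :: "'k set \<Rightarrow> ('k \<Rightarrow> complex ^ 'm) \<Rightarrow> bool" where
  "onb K w \<longleftrightarrow> orthonormal_family K w \<and> (\<Sum>\<kappa>\<in>K. outer (w \<kappa>) (w \<kappa>)) = mat 1"

lemma hinner_add_right: "hinner u (v + w) = hinner u v + hinner u w"
  by (simp add: hinner_def algebra_simps sum.distrib)

lemma hinner_scale_right: "hinner u (a *s v) = a * hinner u v"
  by (simp add: hinner_def sum_distrib_left mult_ac)

lemma hinner_scale_left: "hinner (a *s u) v = cnj a * hinner u v"
  by (simp add: hinner_def sum_distrib_left mult_ac)

lemma hinner_0_right [simp]: "hinner u 0 = 0"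
  by (simp add: hinner_def)

lemma hinner_commute: "hinner v u = cnj (hinner u v)"
  by (simp add: hinner_def mult.commute)

lemma hinner_self: "hinner u u = of_real (\<Sum>i\<in>UNIV. (cmod (u $ i))\<^sup>2)"
  by (simp add: hinner_def mult.commute[of "cnj _"] flip: complex_norm_square)

lemma hinner_self_eq_0: "hinner u u = 0 \<longleftrightarrow> u = 0"
  unfolding hinner_self of_real_eq_0_iff
  by (subst sum_nonneg_eq_0_iff) (auto simp: vec_eq_iff)

lemma hinner_conj_transpose: "hinner u (A *v v) = hinner (conj_transpose A *v u) v"
proof -
  have "hinner u (A *v v) = (\<Sum>i\<in>UNIV. \<Sum>j\<in>UNIV. cnj (u $ i) * A $ i $ j * v $ j)"
    by (simp add: hinner_def matrix_vector_mult_def sum_distrib_left mult_ac)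
  also have "\<dots> = (\<Sum>j\<in>UNIV. \<Sum>i\<in>UNIV. cnj (u $ i) * A $ i $ j * v $ j)"
    by (rule sum.swap)
  also have "\<dots> = hinner (conj_transpose A *v u) v"
    by (simp add: hinner_def matrix_vector_mult_def conj_transpose_def sum_distrib_left
        sum_distrib_right mult_ac)
  finally show ?thesis .
qed

lemma hinner_unitary:
  assumes "A \<in> unitary_matrices"
  shows "hinner (A *v u) (A *v v) = hinner u v"
  using assms by (simp add: hinner_conj_transpose matrix_vector_mul_assoc unitary_matrices_def)

lemma matrix_mul_sum_right: "(A :: 'a::comm_ring_1^'n^'m) ** (\<Sum>i\<in>I. B i) = (\<Sum>i\<in>I. A ** B i)"
  by (induction I rule: infinite_finite_induct) (auto simp: matrix_add_ldistrib)

lemma matrix_diff_ldistrib: "(A :: 'a::comm_ring_1^'n^'m) ** (B - C) = A ** B - A ** C"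
  by (simp add: vec_eq_iff matrix_matrix_mult_def algebra_simps sum_subtractf)

lemma matrix_diff_rdistrib: "(B - C) ** (A :: 'a::comm_ring_1^'n^'m) = B ** A - C ** A"
  by (simp add: vec_eq_iff matrix_matrix_mult_def algebra_simps sum_subtractf)

lemma mat_mul_outer: "A ** outer u v = outer (A *v u) v"
  by (simp add: vec_eq_iff matrix_matrix_mult_def matrix_vector_mult_def outer_def
      sum_distrib_right sum_distrib_left mult_ac)

lemma outer_mul_vec: "outer u v *v w = hinner v w *s u"
  by (simp add: vec_eq_iff matrix_vector_mult_def outer_def hinner_def
      sum_distrib_right sum_distrib_left mult_ac)

lemma outer_0_left [simp]: "outer 0 v = 0"
  by (simp add: outer_def vec_eq_iff)

lemma conj_transpose_outer: "conj_transpose (outer u v) = outer v u"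
  by (simp add: conj_transpose_def outer_def vec_eq_iff)

lemma conj_transpose_sum: "conj_transpose (\<Sum>i\<in>I. A i) = (\<Sum>i\<in>I. conj_transpose (A i))"
  by (simp add: conj_transpose_def vec_eq_iff)

lemma conj_transpose_diff: "conj_transpose (A - B) = conj_transpose A - conj_transpose B"
  by (simp add: conj_transpose_def vec_eq_iff)

lemma conj_transpose_mat_1 [simp]: "conj_transpose (mat 1) = mat 1"
  by (simp add: conj_transpose_def mat_def vec_eq_iff)

lemma trace_outer: "trace (outer u v) = hinner v u"
  by (simp add: trace_def outer_def hinner_def mult.commute)

lemma trace_sum: "trace (\<Sum>i\<in>I. A i) = (\<Sum>i\<in>I. trace (A i))"
  by (simp add: trace_def sum.swap[of _ UNIV])

lemma trace_conj_transpose_mul: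
  "trace (conj_transpose A ** A) = of_real (\<Sum>i\<in>UNIV. \<Sum>j\<in>UNIV. (cmod (A $ j $ i))\<^sup>2)"
  by (simp add: trace_def matrix_matrix_mult_def conj_transpose_def
      mult.commute[of "cnj _"] flip: complex_norm_square)

lemma trace_conj_transpose_mul_eq_0:
  "trace (conj_transpose A ** A) = 0 \<longleftrightarrow> A = 0"
proof
  assume "trace (conj_transpose A ** A) = 0"
  then have "(\<Sum>i\<in>UNIV. \<Sum>j\<in>UNIV. (cmod (A $ j $ i))\<^sup>2) = 0"
    unfolding trace_conj_transpose_mul of_real_eq_0_iff .
  then have "\<forall>i j. A $ j $ i = 0"
    by (subst (asm) sum_nonneg_eq_0_iff) (auto simp: sum_nonneg sum_nonneg_eq_0_iff)
  then show "A = 0" by (simp add: vec_eq_iff)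
qed (simp add: trace_def matrix_matrix_mult_def)

text \<open>The complementary projection \<open>Q = 1 - \<Sum> w w\<^sup>*\<close> of an orthonormal family satisfies
  \<open>Q = Q\<^sup>* Q\<close>, so its trace, the codimension, is \<open>\<Sum> \<bar>Q\<^sub>i\<^sub>j\<bar>\<^sup>2\<close>.\<close>

lemma orthonormal_family_complement:
  fixes w :: "'k \<Rightarrow> complex ^ 'm"
  assumes "orthonormal_family K w"
  defines "Q \<equiv> mat 1 - (\<Sum>\<kappa>\<in>K. outer (w \<kappa>) (w \<kappa>))"
  shows "conj_transpose Q ** Q = Q" "trace Q = of_nat CARD('m) - of_nat (card K)"
    "\<And>\<kappa>. \<kappa> \<in> K \<Longrightarrow> Q *v w \<kappa> = 0" "conj_transpose Q = Q"
proof -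
  have fin: "finite K" and
    o: "\<And>\<kappa> \<kappa>'. \<kappa> \<in> K \<Longrightarrow> \<kappa>' \<in> K \<Longrightarrow> hinner (w \<kappa>) (w \<kappa>') = (if \<kappa> = \<kappa>' then 1 else 0)"
    using assms by (auto simp: orthonormal_family_def)
  show tr: "trace Q = of_nat CARD('m) - of_nat (card K)"
    by (simp add: Q_def trace_sub trace_I trace_sum trace_outer o)
  show ct: "conj_transpose Q = Q"
    by (simp add: Q_def conj_transpose_diff conj_transpose_sum conj_transpose_outer)
  show 0: "Q *v w \<kappa> = 0" if "\<kappa> \<in> K" for \<kappa>
  proof -
    have "(\<Sum>\<kappa>\<in>K. outer (w \<kappa>) (w \<kappa>)) *v w \<kappa> = (\<Sum>\<kappa>'\<in>K. outer (w \<kappa>') (w \<kappa>') *v w \<kappa>)"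
      by (induction K rule: infinite_finite_induct) (auto simp: matrix_vector_mult_add_rdistrib)
    also have "\<dots> = (\<Sum>\<kappa>'\<in>K. if \<kappa>' = \<kappa> then w \<kappa> else 0)"
      by (rule sum.cong) (auto simp: outer_mul_vec o that)
    also have "\<dots> = w \<kappa>" using fin that by simp
    finally show ?thesis by (simp add: Q_def matrix_vector_mult_diff_rdistrib)
  qed
  have "Q ** Q = Q ** mat 1 - (\<Sum>\<kappa>\<in>K. Q ** outer (w \<kappa>) (w \<kappa>))"
    by (subst (2) Q_def) (simp only: matrix_diff_ldistrib matrix_mul_sum_right)
  also have "\<dots> = Q" by (simp add: mat_mul_outer 0)
  finally show "conj_transpose Q ** Q = Q" by (simp add: ct)
qed

text \<open>The codimension is the trace of \<open>Q\<^sup>* Q\<close>, a sum of squared moduli, and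
  therefore not negative.\<close>

lemma orthonormal_family_card_le:
  fixes w :: "'k \<Rightarrow> complex ^ 'm"
  assumes "orthonormal_family K w"
  shows "card K \<le> CARD('m)"
proof -
  define Q where "Q = mat 1 - (\<Sum>\<kappa>\<in>K. outer (w \<kappa>) (w \<kappa>))"
  have "of_real (real CARD('m) - real (card K)) = trace Q"
    using orthonormal_family_complement(2)[OF assms] by (simp add: Q_def)
  also have "\<dots> = trace (conj_transpose Q ** Q)"
    using orthonormal_family_complement(1)[OF assms] by (simp add: Q_def)
  finally have "real CARD('m) - real (card K) = (\<Sum>i\<in>UNIV. \<Sum>j\<in>UNIV. (cmod (Q $ j $ i))\<^sup>2)"
    unfolding trace_conj_transpose_mul of_real_eq_iff .
  also have "\<dots> \<ge> 0" by (intro sum_nonneg) auto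
  finally show ?thesis by simp
qed

text \<open>Both sides say that the complementary projection \<open>Q\<close> vanishes: its trace is
  the codimension, and \<open>Q\<^sup>* Q\<close> has trace 0 only for \<open>Q = 0\<close>.\<close>

lemma onb_iff_card:
  fixes w :: "'k \<Rightarrow> complex ^ 'm"
  shows "onb K w \<longleftrightarrow> orthonormal_family K w \<and> card K = CARD('m)"
proof (cases "orthonormal_family K w")
  case True
  define Q where "Q = mat 1 - (\<Sum>\<kappa>\<in>K. outer (w \<kappa>) (w \<kappa>))"
  have "onb K w \<longleftrightarrow> Q = 0" using True by (auto simp: onb_def Q_def)
  also have "\<dots> \<longleftrightarrow> trace Q = 0"
    using trace_conj_transpose_mul_eq_0[of Q] orthonormal_family_complement(1)[OF True]
    by (simp add: Q_def)
  also have "\<dots> \<longleftrightarrow> card K = CARD('m)"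
    using orthonormal_family_complement(2)[OF True] by (auto simp: Q_def)
  finally show ?thesis using True by simp
qed (simp add: onb_def)

lemma onb_D:
  assumes "onb K w"
  shows "finite K" "\<And>\<kappa> \<kappa>'. \<kappa> \<in> K \<Longrightarrow> \<kappa>' \<in> K \<Longrightarrow> hinner (w \<kappa>) (w \<kappa>') = (if \<kappa> = \<kappa>' then 1 else 0)"
    "(\<Sum>\<kappa>\<in>K. outer (w \<kappa>) (w \<kappa>)) = mat 1"
  using assms by (auto simp: onb_def orthonormal_family_def)

text \<open>Any nonzero column of the complementary projection \<open>Q\<close> serves:
  \<open>Q\<close> is self-adjoint and kills every \<open>w \<kappa>\<close>.\<close>

lemma orthonormal_family_extend:
  fixes w :: "'k \<Rightarrow> complex ^ 'm"
  assumes "orthonormal_family K w" "card K \<noteq> CARD('m)"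
  shows "\<exists>y. y \<noteq> 0 \<and> (\<forall>\<kappa>\<in>K. hinner (w \<kappa>) y = 0)"
proof -
  define Q where "Q = mat 1 - (\<Sum>\<kappa>\<in>K. outer (w \<kappa>) (w \<kappa>))"
  have "Q \<noteq> 0" using assms onb_iff_card[of K w] by (auto simp: onb_def Q_def)
  then obtain i j where "Q $ i $ j \<noteq> 0" by (auto simp: vec_eq_iff)
  then have "(Q *v axis j 1) $ i \<noteq> 0" by (simp add: matrix_vector_mult_def axis_def if_distrib cong: if_cong)
  then have "Q *v axis j 1 \<noteq> 0" by (metis zero_index)
  moreover have "hinner (w \<kappa>) (Q *v axis j 1) = 0" if "\<kappa> \<in> K" for \<kappa>
    using orthonormal_family_complement(3,4)[OF assms(1)] that
    by (metis Q_def hinner_conj_transpose hinner_commute hinner_0_right complex_cnj_zero)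
  ultimately show ?thesis by blast
qed

text \<open>A subfamily of disjoint blocks with orthonormal union has at most
  \<open>CARD('m)\<close> vectors, so one with the most vectors exists; were its union not a basis,
  \<open>extend\<close> would add a further block. Used with single eigenvectors and with
  irreducible blocks.\<close>

lemma orthonormal_blocks_exhaust:
  fixes \<B> :: "(complex ^ 'm) set set"
  assumes blocks: "\<And>b. b \<in> \<B> \<Longrightarrow> b \<noteq> {} \<and> orthonormal_family b id"
    and extend: "\<And>\<C> y. \<C> \<subseteq> \<B> \<Longrightarrow> y \<noteq> 0 \<Longrightarrow> \<forall>u\<in>\<Union>\<C>. hinner u y = 0 \<Longrightarrow>
      \<exists>b\<in>\<B>. \<forall>u\<in>\<Union>\<C>. \<forall>v\<in>b. hinner u v = 0"
  shows "\<exists>\<C>\<subseteq>\<B>. finite \<C> \<and> disjoint \<C> \<and> onb (\<Union>\<C>) id"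
proof -
  define good where "good \<C> \<longleftrightarrow> \<C> \<subseteq> \<B> \<and> disjoint \<C> \<and> orthonormal_family (\<Union>\<C>) id" for \<C>
  have "good {}" by (simp add: good_def orthonormal_family_def)
  moreover have bound: "card (\<Union>\<C>) < Suc CARD('m)" if "good \<C>" for \<C>
    using that orthonormal_family_card_le by (force simp: good_def less_Suc_eq_le)
  ultimately obtain \<C> where \<C>: "good \<C>" and max: "\<And>\<D>. good \<D> \<Longrightarrow> card (\<Union>\<D>) \<le> card (\<Union>\<C>)"
    using ex_has_greatest_nat[of good "{}" "\<lambda>\<C>. card (\<Union>\<C>)" "Suc CARD('m)"] by auto
  have sub: "\<C> \<subseteq> \<B>" and dis: "disjoint \<C>" and on: "orthonormal_family (\<Union>\<C>) id"
    using \<C> by (auto simp: good_def)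
  have fin: "finite (\<Union>\<C>)" using on by (simp add: orthonormal_family_def)
  have "card (\<Union>\<C>) = CARD('m)"
  proof (rule ccontr)
    assume "card (\<Union>\<C>) \<noteq> CARD('m)"
    then obtain y where "y \<noteq> 0" "\<forall>u\<in>\<Union>\<C>. hinner u y = 0"
      using orthonormal_family_extend[OF on] by auto
    then obtain b where b: "b \<in> \<B>" and perp: "\<forall>u\<in>\<Union>\<C>. \<forall>v\<in>b. hinner u v = 0"
      using extend[OF sub] by blast
    have bo: "b \<noteq> {}" "orthonormal_family b id" using blocks[OF b] by auto
    have "b \<inter> \<Union>\<C> = {}"
    proof (rule ccontr)
      assume "b \<inter> \<Union>\<C> \<noteq> {}"
      then obtain v where "v \<in> b" "v \<in> \<Union>\<C>" by blast
      then have "hinner v v = 0" "hinner v v = 1"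
        using perp bo(2) unfolding orthonormal_family_def id_def by (blast, metis)
      then show False by simp
    qed
    moreover have "orthonormal_family (\<Union>(insert b \<C>)) id"
    proof -
      have "hinner u v = (if u = v then 1 else 0)"
        if uv: "u \<in> b \<union> \<Union>\<C>" "v \<in> b \<union> \<Union>\<C>" for u v
      proof -
        consider "u \<in> b" "v \<in> b" | "u \<in> \<Union>\<C>" "v \<in> \<Union>\<C>" | "u \<in> b" "v \<in> \<Union>\<C>" | "u \<in> \<Union>\<C>" "v \<in> b"
          using uv by blast
        then show ?thesis
        proof cases
          case 1
          then show ?thesis using bo(2) by (simp add: orthonormal_family_def)
        next
          case 2
          then show ?thesis using on unfolding orthonormal_family_def id_def by blast
        next
          case 3
          then have "hinner v u = 0" using perp by blast
          moreover have "u \<noteq> v" using 3 \<open>b \<inter> \<Union>\<C> = {}\<close> by blast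
          ultimately show ?thesis by (simp add: hinner_commute[of u v])
        next
          case 4
          then have "hinner u v = 0" using perp by blast
          moreover have "u \<noteq> v" using 4 \<open>b \<inter> \<Union>\<C> = {}\<close> by blast
          ultimately show ?thesis by simp
        qed
      qed
      then show ?thesis using fin bo(2) by (auto simp: orthonormal_family_def)
    qed
    moreover have "disjoint (insert b \<C>)"
      using dis \<open>b \<inter> \<Union>\<C> = {}\<close> by (auto simp: pairwise_insert disjnt_def)
    ultimately have "good (insert b \<C>)" using sub b by (simp add: good_def)
    from max[OF this] have "card (b \<union> \<Union>\<C>) \<le> card (\<Union>\<C>)" by simp
    moreover have "card (b \<union> \<Union>\<C>) = card b + card (\<Union>\<C>)"
      using \<open>b \<inter> \<Union>\<C> = {}\<close> bo fin by (intro card_Un_disjoint) (auto simp: orthonormal_family_def)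
    moreover have "card b > 0" using bo by (auto simp: orthonormal_family_def card_gt_0_iff)
    ultimately show False by simp
  qed
  then have "onb (\<Union>\<C>) id" using on by (simp add: onb_iff_card)
  moreover have "finite \<C>" using fin by (rule finite_UnionD)
  ultimately show ?thesis using sub dis by blast
qed

subsection \<open>Eigenvectors in invariant subspaces\<close>

text \<open>This is \<open>p(A) w\<close>, evaluated by Horner's scheme directly on vectors.\<close>

definition poly_act :: "complex ^ 'm ^ 'm \<Rightarrow> complex poly \<Rightarrow> complex ^ 'm \<Rightarrow> complex ^ 'm" where
  "poly_act A p w = fold_coeffs (\<lambda>a v. a *s w + A *v v) p 0"

lemma poly_act_0 [simp]: "poly_act A 0 w = 0"
  by (simp add: poly_act_def)

lemma poly_act_pCons [simp]: "poly_act A (pCons a p) w = a *s w + A *v poly_act A p w"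
  by (cases "a = 0 \<and> p = 0") (auto simp: poly_act_def)

lemma poly_act_add: "poly_act A (p + q) w = poly_act A p w + poly_act A q w"
  by (induction p q rule: poly_induct2) (auto simp: matrix_vector_right_distrib vec.scale_left_distrib)

lemma poly_act_smult: "poly_act A (smult a p) w = a *s poly_act A p w"
  by (induction p) (auto simp: vec.scale_right_distrib vec.scale)

lemma poly_act_monom: "poly_act A (monom a i) w = a *s (((*v) A) ^^ i) w"
  by (induction i) (auto simp: monom_0 monom_Suc vec.scale)

lemma poly_act_sum: "poly_act A (\<Sum>i\<in>I. p i) w = (\<Sum>i\<in>I. poly_act A (p i) w)"
  by (induction I rule: infinite_finite_induct) (auto simp: poly_act_add)

lemma poly_act_linear_factor:
  "poly_act A ([:-z, 1:] * p) w = A *v poly_act A p w - z *s poly_act A p w"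
proof -
  have "[:-z, 1:] * p = pCons 0 p + smult (-z) p" by simp
  then show ?thesis by (simp only: poly_act_add poly_act_smult) simp
qed

lemma poly_act_mem:
  assumes "vec.subspace W" "w \<in> W" "\<And>v. v \<in> W \<Longrightarrow> A *v v \<in> W"
  shows "poly_act A p w \<in> W"
  by (induction p) (use assms in \<open>auto intro: vec.subspace_add vec.subspace_scale vec.subspace_0\<close>)

text \<open>The vectors \<open>w, A w, ..., A\<^sup>m w\<close> are one more than the dimension, and
  a linear relation between them is a polynomial.\<close>

lemma annihilating_poly_exists:
  fixes w :: "complex ^ 'm"
  shows "\<exists>p. p \<noteq> 0 \<and> poly_act A p w = 0"
proof -
  define f where "f i = (((*v) A) ^^ i) w" for i
  define N where "N = {..CARD('m)}"
  have [simp]: "finite N" by (simp add: N_def)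
  have "\<exists>c :: nat \<Rightarrow> complex. (\<exists>i\<in>N. c i \<noteq> 0) \<and> (\<Sum>i\<in>N. c i *s f i) = 0"
  \<comment> \<open>Linear dependence is a property of sets, so two equal powers have to be handled
    apart; their difference is then the relation.\<close>
  proof (cases "inj_on f N")
    case False
    then obtain i j where ij: "i \<in> N" "j \<in> N" "i \<noteq> j" "f i = f j" by (auto simp: inj_on_def)
    let ?c = "\<lambda>l. if l = i then 1 else if l = j then -1 else 0 :: complex"
    have "(\<Sum>l\<in>N. ?c l *s f l) = (\<Sum>l\<in>{i, j}. ?c l *s f l)"
      by (rule sum.mono_neutral_right) (use ij in auto)
    also have "\<dots> = 0" using ij by simp
    finally show ?thesis using ij by (intro exI[of _ ?c]) auto
  next
    case True
    have "card (f ` N) > CARD('m)" using True by (simp add: card_image N_def)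
    then have "vec.dependent (f ` N)"
      using vec.independent_bound_general[of "f ` N"] dim_subset_UNIV_cart_gen[of "f ` N"] by linarith
    then obtain u where u: "\<exists>v\<in>f ` N. u v \<noteq> 0" "(\<Sum>v\<in>f ` N. u v *s v) = 0"
      by (subst (asm) vec.dependent_finite) auto
    then have "(\<Sum>i\<in>N. u (f i) *s f i) = 0" by (simp add: sum.reindex[OF True])
    then show ?thesis using u(1) by (intro exI[of _ "u \<circ> f"]) auto
  qed
  then obtain c i where i: "i \<in> N" "c i \<noteq> 0" and c: "(\<Sum>i\<in>N. c i *s f i) = 0" by blast
  define p where "p = (\<Sum>i\<in>N. monom (c i) i)"
  have "coeff p i = c i" using i by (simp add: p_def coeff_sum)
  moreover have "poly_act A p w = 0" using c by (simp add: p_def poly_act_sum poly_act_monom f_def)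
  ultimately show ?thesis using i by (intro exI[of _ p]) auto
qed

text \<open>Split a factor \<open>X - z\<close> off an annihilating polynomial
  \<open>p = (X - z) q\<close> of \<open>w\<close>. Either \<open>q\<close> annihilates
  \<open>w\<close> too and has smaller degree, or \<open>q(A) w\<close> is an eigenvector; it stays
  in \<open>W\<close> by invariance.\<close>

lemma eigenvector_in_invariant_subspace:
  fixes A :: "complex ^ 'm ^ 'm"
  assumes W: "vec.subspace W" "w \<in> W" "w \<noteq> 0" "\<And>v. v \<in> W \<Longrightarrow> A *v v \<in> W"
  shows "\<exists>v z. v \<in> W \<and> v \<noteq> 0 \<and> A *v v = z *s v"
proof -
  obtain p where "p \<noteq> 0" "poly_act A p w = 0" using annihilating_poly_exists by blast
  then show ?thesis
  proof (induction "degree p" arbitrary: p rule: less_induct)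
    case less
    have "\<exists>z. poly p z = 0"
    proof (rule ccontr)
      assume *: "\<nexists>z. poly p z = 0"
      have "constant (poly p)" using fundamental_theorem_of_algebra[of p] * by blast
      then have "degree p = 0" using constant_degree by blast
      then obtain a where "p = [:a:]" by (rule degree_eq_zeroE)
      then show False using less.prems W(3) by auto
    qed
    then obtain z q where q: "p = [:-z, 1:] * q" by (auto simp: poly_eq_0_iff_dvd dvd_def)
    have q0: "q \<noteq> 0" using q less.prems by auto
    show ?case
    proof (cases "poly_act A q w = 0")
      case True
      have "degree p = Suc (degree q)" using q q0 by (simp add: degree_mult_eq del: mult_pCons_left)
      then show ?thesis using less.hyps[OF _ q0 True] by simp
    next
      case False
      then show ?thesis
        using less.prems(2) poly_act_mem[OF W(1,2,4)] unfolding q poly_act_linear_factor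
        by (metis eq_iff_diff_eq_0)
    qed
  qed
qed

text \<open>Induction on the dimension of \<open>W\<close>: if \<open>w\<close> is not an
  eigenvector of some \<open>A\<close>, then an eigenspace of \<open>A\<close> in \<open>W\<close>
  is nonzero and proper, and commutation makes it invariant under all of
  \<open>\<F>\<close>.\<close>

lemma joint_eigenvector:
  fixes \<F> :: "(complex ^ 'm ^ 'm) set"
  assumes "vec.subspace W" "w \<in> W" "w \<noteq> 0" "\<And>A v. A \<in> \<F> \<Longrightarrow> v \<in> W \<Longrightarrow> A *v v \<in> W"
    and "\<And>A B v. A \<in> \<F> \<Longrightarrow> B \<in> \<F> \<Longrightarrow> v \<in> W \<Longrightarrow> A *v (B *v v) = B *v (A *v v)"
  shows "\<exists>v. v \<in> W \<and> v \<noteq> 0 \<and> (\<forall>A\<in>\<F>. \<exists>z. A *v v = z *s v)"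
  using assms
proof (induction "vec.dim W" arbitrary: W w rule: less_induct)
  case less
  show ?case
  proof (cases "\<forall>A\<in>\<F>. \<exists>z. A *v w = z *s w")
    case True
    then show ?thesis using less.prems by blast
  next
    case False
    then obtain A where A: "A \<in> \<F>" "\<nexists>z. A *v w = z *s w" by blast
    obtain v z where v: "v \<in> W" "v \<noteq> 0" "A *v v = z *s v"
      using eigenvector_in_invariant_subspace[OF less.prems(1,2,3), of A] less.prems(4) A by blast
    define W' where "W' = {v \<in> W. A *v v = z *s v}"
    have sub: "vec.subspace W'"
      using less.prems(1) unfolding W'_def vec.subspace_def
      by (auto simp: matrix_vector_right_distrib vec.scale_right_distrib vec.scale mult.commute)
    have "W' \<subset> W" using A less.prems(2) by (auto simp: W'_def)
    then have "vec.dim W' < vec.dim W"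
      using vec.dim_psubset[of W' W] sub less.prems(1) by (metis vec.span_eq_iff)
    moreover have "B *v u \<in> W'" if "B \<in> \<F>" "u \<in> W'" for B u
    proof -
      have "A *v (B *v u) = B *v (A *v u)"
        using less.prems(5)[OF A(1) that(1), of u] that(2) by (auto simp: W'_def)
      then show ?thesis using that less.prems(4) by (simp add: W'_def vec.scale)
    qed
    ultimately obtain u where "u \<in> W'" "u \<noteq> 0" "\<forall>A\<in>\<F>. \<exists>z. A *v u = z *s u"
      using less.hyps[of W' v] sub v less.prems(5) by (auto simp: W'_def)
    then show ?thesis by (auto simp: W'_def)
  qed
qed

subsection \<open>Unitary matrices\<close>

lemma mat_eq_on_onb:
  fixes A B :: "complex ^ 'm ^ 'm"
  assumes "onb K w" "\<And>\<kappa>. \<kappa> \<in> K \<Longrightarrow> A *v w \<kappa> = B *v w \<kappa>"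
  shows "A = B"
proof -
  have "A = A ** (\<Sum>\<kappa>\<in>K. outer (w \<kappa>) (w \<kappa>))" by (simp add: onb_D[OF assms(1)])
  also have "\<dots> = B ** (\<Sum>\<kappa>\<in>K. outer (w \<kappa>) (w \<kappa>))"
    unfolding matrix_mul_sum_right mat_mul_outer by (rule sum.cong) (simp_all add: assms(2))
  also have "\<dots> = B" by (simp add: onb_D[OF assms(1)])
  finally show ?thesis .
qed

text \<open>Sends \<open>w \<kappa>\<close> to \<open>a \<kappa> *s w' \<kappa>\<close> when
  \<open>w\<close> is an orthonormal basis. The explicit sum makes continuity in all three data
  evident.\<close>

definition basis_map :: "'k set \<Rightarrow> ('k \<Rightarrow> complex ^ 'm) \<Rightarrow> ('k \<Rightarrow> complex) \<Rightarrow> ('k \<Rightarrow> complex ^ 'm) \<Rightarrow>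
    complex ^ 'm ^ 'm" where
  "basis_map K w a w' = (\<Sum>\<kappa>\<in>K. outer (a \<kappa> *s w' \<kappa>) (w \<kappa>))"

lemma basis_map_apply:
  assumes "onb K w" "\<kappa> \<in> K"
  shows "basis_map K w a w' *v w \<kappa> = a \<kappa> *s w' \<kappa>"
proof -
  have "basis_map K w a w' *v w \<kappa> = (\<Sum>\<kappa>'\<in>K. outer (a \<kappa>' *s w' \<kappa>') (w \<kappa>') *v w \<kappa>)"
    unfolding basis_map_def
    by (induction K rule: infinite_finite_induct) (auto simp: matrix_vector_mult_add_rdistrib)
  also have "\<dots> = (\<Sum>\<kappa>'\<in>K. if \<kappa>' = \<kappa> then a \<kappa> *s w' \<kappa> else 0)"
    by (rule sum.cong) (auto simp: outer_mul_vec onb_D(2)[OF assms(1)] assms(2))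
  also have "\<dots> = a \<kappa> *s w' \<kappa>" using onb_D(1)[OF assms(1)] assms(2) by simp
  finally show ?thesis .
qed

text \<open>In \<open>M M\<^sup>*\<close> the phases cancel and the resolution of the identity for
  \<open>w'\<close> remains; for square matrices a one-sided inverse is two-sided.\<close>

lemma basis_map_unitary:
  assumes w: "onb K w" and w': "onb K w'" and a: "\<And>\<kappa>. \<kappa> \<in> K \<Longrightarrow> cmod (a \<kappa>) = 1"
  shows "basis_map K w a w' \<in> unitary_matrices"
proof -
  let ?M = "basis_map K w a w'"
  have "?M ** conj_transpose ?M = (\<Sum>\<kappa>\<in>K. ?M ** outer (w \<kappa>) (a \<kappa> *s w' \<kappa>))"
    by (subst (2) basis_map_def) (simp add: conj_transpose_sum conj_transpose_outer matrix_mul_sum_right)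
  also have "\<dots> = (\<Sum>\<kappa>\<in>K. outer (a \<kappa> *s w' \<kappa>) (a \<kappa> *s w' \<kappa>))"
    by (simp add: mat_mul_outer basis_map_apply[OF w])
  also have "\<dots> = (\<Sum>\<kappa>\<in>K. outer (w' \<kappa>) (w' \<kappa>))"
  proof (rule sum.cong)
    fix \<kappa> assume "\<kappa> \<in> K"
    then have u: "a \<kappa> * cnj (a \<kappa>) = 1" using a by (simp flip: complex_norm_square)
    have "(a \<kappa> * x) * (cnj (a \<kappa>) * y) = (a \<kappa> * cnj (a \<kappa>)) * (x * y)" for x y
      by (simp only: mult_ac)
    then show "outer (a \<kappa> *s w' \<kappa>) (a \<kappa> *s w' \<kappa>) = outer (w' \<kappa>) (w' \<kappa>)"
      by (simp only: outer_def vector_smult_component complex_cnj_mult u mult_1)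
  qed simp
  also have "\<dots> = mat 1" by (rule onb_D(3)[OF w'])
  finally have "?M ** conj_transpose ?M = mat 1" .
  then show ?thesis by (simp add: unitary_matrices_def matrix_left_right_inverse)
qed

lemma unitary_onb:
  assumes "U \<in> unitary_matrices" "onb K w"
  shows "onb K (\<lambda>\<kappa>. U *v w \<kappa>)"
  using assms by (simp add: onb_iff_card orthonormal_family_def hinner_unitary)

lemma unitary_eigenvalue:
  assumes "A \<in> unitary_matrices" "A *v v = z *s v" "v \<noteq> 0"
  shows "cmod z = 1"
proof -
  have "hinner v v = hinner (A *v v) (A *v v)" using hinner_unitary[OF assms(1)] by simp
  also have "\<dots> = (z * cnj z) * hinner v v"
    by (simp add: assms(2) hinner_scale_left hinner_scale_right)
  finally have "z * cnj z = 1" using assms(3) hinner_self_eq_0 by auto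
  then have "of_real ((cmod z)\<^sup>2) = (of_real 1 :: complex)" by (simp flip: complex_norm_square)
  then have "(cmod z)\<^sup>2 = 1" by (simp only: of_real_eq_iff)
  then show ?thesis by (simp add: power2_eq_1_iff) (metis norm_ge_zero neg_0_le_iff_le not_one_le_zero)
qed

lemma unitary_eigenvectors_orthogonal:
  assumes A: "A \<in> unitary_matrices" and u: "A *v u = y *s u" and v: "A *v v = z *s v" and "y \<noteq> z"
  shows "hinner u v = 0"
proof (cases "u = 0 \<or> v = 0")
  case False
  have "cmod y = 1" using unitary_eigenvalue[OF A u] False by simp
  then have y: "cnj y * y = 1" by (metis complex_norm_square mult.commute of_real_1 power_one)
  have "hinner u v = hinner (A *v u) (A *v v)" using hinner_unitary[OF A] by simp
  also have "\<dots> = cnj y * z * hinner u v" by (simp add: u v hinner_scale_left hinner_scale_right)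
  finally have "(1 - cnj y * z) * hinner u v = 0" by (simp add: algebra_simps)
  moreover have "cnj y * z \<noteq> 1"
  proof
    assume "cnj y * z = 1"
    then have "y * (cnj y * z) = y" by simp
    moreover have "y * (cnj y * z) = z" using y by (metis mult.assoc mult.commute mult_1)
    ultimately show False using \<open>y \<noteq> z\<close> by simp
  qed
  ultimately show ?thesis by auto
qed (auto simp: hinner_def)

lemma normalize_vec:
  assumes "v \<noteq> 0"
  shows "\<exists>a. a \<noteq> 0 \<and> hinner (a *s v) (a *s v) = 1"
proof -
  define s where "s = (\<Sum>i\<in>UNIV. (cmod (v $ i))\<^sup>2)"
  have s: "hinner v v = of_real s" by (simp add: s_def hinner_self)
  have "s \<ge> 0" unfolding s_def by (intro sum_nonneg) auto
  moreover have "s \<noteq> 0" using s hinner_self_eq_0[of v] assms by auto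
  ultimately have "s > 0" by simp
  define a where "a = complex_of_real (1 / sqrt s)"
  have "hinner (a *s v) (a *s v) = (cnj a * a) * of_real s"
    by (simp add: hinner_scale_left hinner_scale_right s)
  also have "cnj a * a * of_real s = of_real (1 / sqrt s * (1 / sqrt s) * s)"
    by (simp only: a_def complex_cnj_complex_of_real of_real_mult)
  also have "\<dots> = 1" using \<open>s > 0\<close> by simp
  finally show ?thesis using \<open>s > 0\<close> by (intro exI[of _ a]) (auto simp: a_def)
qed

text \<open>For \<open>u = z *s (A *v v)\<close>, unitarity reduces \<open>hinner u (A *v y)\<close>
  to a multiple of \<open>hinner v y\<close>. Asking that \<open>S\<close> be reached by
  \<open>A\<close> up to scalars avoids inverting \<open>A\<close>.\<close>

lemma orthogonal_complement_invariant:
  assumes A: "A \<in> unitary_matrices" and S: "\<And>u. u \<in> S \<Longrightarrow> \<exists>v\<in>S. \<exists>z. u = z *s (A *v v)"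
    and y: "\<forall>u\<in>S. hinner u y = 0"
  shows "\<forall>u\<in>S. hinner u (A *v y) = 0"
proof
  fix u assume "u \<in> S"
  then obtain v z where v: "v \<in> S" "u = z *s (A *v v)" using S by blast
  have "hinner u (A *v y) = cnj z * hinner v y" by (simp add: v hinner_scale_left hinner_unitary[OF A])
  then show "hinner u (A *v y) = 0" using y v by simp
qed

lemma subspace_orthogonal_complement: "vec.subspace {y. \<forall>u\<in>S. hinner u y = 0}"
  by (auto simp: vec.subspace_def hinner_add_right hinner_scale_right)

text \<open>Instance of \<open>orthonormal_blocks_exhaust\<close> with single unit eigenvectors as
  blocks: the orthogonal complement of eigenvectors is invariant and, if nonzero, contains another
  one. The basis is a set indexed by itself, hence \<open>id\<close>.\<close>

lemma unitary_diagonalization: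
  fixes U :: "complex ^ 'm ^ 'm"
  assumes U: "U \<in> unitary_matrices"
  shows "\<exists>T :: (complex ^ 'm) set. \<exists>\<theta>. onb T id \<and> (\<forall>v\<in>T. U *v v = cis (\<theta> v) *s v)"
proof -
  define \<B> where "\<B> = {{v} | v. hinner v v = 1 \<and> (\<exists>\<theta>. U *v v = cis \<theta> *s v)}"
  have "\<exists>b\<in>\<B>. \<forall>u\<in>\<Union>\<C>. \<forall>v\<in>b. hinner u v = 0"
    if \<C>: "\<C> \<subseteq> \<B>" and y: "y \<noteq> 0" "\<forall>u\<in>\<Union>\<C>. hinner u y = 0" for \<C> y
  proof -
    define W where "W = {y. \<forall>u\<in>\<Union>\<C>. hinner u y = 0}"
    have "\<exists>v\<in>\<Union>\<C>. \<exists>z. u = z *s (U *v v)" if "u \<in> \<Union>\<C>" for u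
    proof -
      have "u \<in> \<Union>\<B>" using that \<C> by blast
      then obtain \<theta> where "U *v u = cis \<theta> *s u" by (auto simp: \<B>_def)
      then have "u = cis (-\<theta>) *s (U *v u)" by (simp add: cis_mult)
      then show ?thesis using that by blast
    qed
    from orthogonal_complement_invariant[OF U this]
    have "U *v y \<in> W" if "y \<in> W" for y using that unfolding W_def by blast
    moreover have "vec.subspace W" unfolding W_def by (rule subspace_orthogonal_complement)
    moreover have "y \<in> W" using y by (simp add: W_def)
    ultimately obtain v z where v: "v \<in> W" "v \<noteq> 0" "U *v v = z *s v"
      using eigenvector_in_invariant_subspace[of W y U] y(1) by blast
    obtain a where a: "hinner (a *s v) (a *s v) = 1" using normalize_vec[OF v(2)] by blast
    have "cmod z = 1" by (rule unitary_eigenvalue[OF U v(3,2)])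
    then have "cis (Arg z) = z" by (subst cis_Arg) (auto simp: sgn_eq)
    then have "U *v (a *s v) = cis (Arg z) *s (a *s v)" by (simp add: vec.scale v(3) mult.commute)
    then have "{a *s v} \<in> \<B>" using a by (auto simp: \<B>_def)
    moreover have "\<forall>u\<in>\<Union>\<C>. hinner u (a *s v) = 0" using v(1) by (simp add: W_def hinner_scale_right)
    ultimately show ?thesis by blast
  qed
  moreover have "b \<noteq> {} \<and> orthonormal_family b id" if "b \<in> \<B>" for b
    using that by (auto simp: \<B>_def orthonormal_family_def)
  ultimately obtain \<C> where \<C>: "\<C> \<subseteq> \<B>" "onb (\<Union>\<C>) id"
    using orthonormal_blocks_exhaust[of \<B>] by blast
  have "\<forall>v\<in>\<Union>\<C>. \<exists>\<theta>. U *v v = cis \<theta> *s v" using \<C>(1) by (auto simp: \<B>_def)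
  then show ?thesis using \<C>(2) by metis
qed

lemma continuous_on_matrixI:
  fixes f :: "'a::topological_space \<Rightarrow> complex ^ 'n ^ 'm"
  assumes "\<And>i j. continuous_on S (\<lambda>x. f x $ i $ j)"
  shows "continuous_on S f"
proof -
  have "continuous_on S (\<lambda>x. \<chi> i j. f x $ i $ j)"
    using assms by (intro continuous_on_vec_lambda)
  then show ?thesis by simp
qed

lemma basis_map_continuous:
  assumes "\<And>\<kappa>. \<kappa> \<in> K \<Longrightarrow> continuous_on S (\<lambda>x. w x \<kappa>)" "\<And>\<kappa>. \<kappa> \<in> K \<Longrightarrow> continuous_on S (\<lambda>x. a x \<kappa>)"
    "\<And>\<kappa>. \<kappa> \<in> K \<Longrightarrow> continuous_on S (\<lambda>x. w' x \<kappa>)"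
  shows "continuous_on S (\<lambda>x. basis_map K (w x) (a x) (w' x))"
  unfolding basis_map_def outer_def
  by (rule continuous_on_matrixI) (use assms in \<open>auto intro!: continuous_intros\<close>)

text \<open>In an eigenbasis of \<open>U\<close> with eigenvalues \<open>cis (\<theta> v)\<close>,
  multiply every angle by the parameter \<open>s\<close>.\<close>

lemma unitary_path:
  fixes U :: "complex ^ 'm ^ 'm"
  assumes "U \<in> unitary_matrices"
  shows "\<exists>P :: real \<Rightarrow> _. continuous_on UNIV P \<and> range P \<subseteq> unitary_matrices \<and> P 0 = mat 1 \<and> P 1 = U"
proof -
  obtain T :: "(complex ^ 'm) set" and \<theta> where T: "onb T id" "\<forall>v\<in>T. U *v v = cis (\<theta> v) *s v"
    using unitary_diagonalization[OF assms] by blast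
  define P where "P s = basis_map T id (\<lambda>v. cis (s * \<theta> v)) id" for s
  have ap: "P s *v v = cis (s * \<theta> v) *s v" if "v \<in> T" for s v
    using basis_map_apply[OF T(1) that] by (simp add: P_def)
  have "P 0 = mat 1" "P 1 = U"
    by (rule mat_eq_on_onb[OF T(1)]; use T(2) ap in simp)+
  moreover have "continuous_on UNIV P"
    unfolding P_def by (intro basis_map_continuous continuous_intros)
  moreover have "range P \<subseteq> unitary_matrices"
    unfolding P_def by (auto intro!: basis_map_unitary T(1))
  ultimately show ?thesis by blast
qed

subsection \<open>Characteristic polynomials\<close>

lemma poly_det: "poly (det M) z = det (\<chi> i j. poly (M $ i $ j) z)"
  by (simp add: det_def poly_sum poly_prod)

lemma poly_charpoly: "poly (charpoly A) z = det (mat z - A)"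
  unfolding charpoly_def poly_det
  by (rule arg_cong[where f = det]) (simp add: vec_eq_iff mat_def)

text \<open>Take the basis vectors as columns of \<open>P\<close>; then \<open>P\<close> is
  invertible and turns \<open>A\<close> into a diagonal matrix. The polynomials are compared through
  their values at every \<open>z\<close>, so only complex determinants occur.\<close>

lemma charpoly_onb:
  fixes A :: "complex ^ 'm ^ 'm"
  assumes w: "onb K w" and ev: "\<And>\<kappa>. \<kappa> \<in> K \<Longrightarrow> A *v w \<kappa> = d \<kappa> *s w \<kappa>"
  shows "charpoly A = (\<Prod>\<kappa>\<in>K. [:- d \<kappa>, 1:])"
proof -
  have fin: "finite K" and card: "card K = CARD('m)" using w by (auto simp: onb_iff_card orthonormal_family_def)
  then obtain b :: "'m \<Rightarrow> _" where b: "bij_betw b UNIV K"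
    using finite_same_card_bij[of "UNIV :: 'm set" K] by auto
  have bK: "b i \<in> K" for i using b by (auto simp: bij_betw_def)
  define P :: "complex ^ 'm ^ 'm" where "P = (\<chi> i j. w (b j) $ i)"
  have "conj_transpose P ** P = mat 1"
  proof -
    have "(conj_transpose P ** P) $ i $ j = hinner (w (b i)) (w (b j))" for i j
      by (simp add: P_def conj_transpose_def matrix_matrix_mult_def hinner_def)
    moreover have "b i = b j \<longleftrightarrow> i = j" for i j using b by (auto simp: bij_betw_def inj_on_def)
    ultimately show ?thesis using onb_D(2)[OF w bK bK] by (simp add: vec_eq_iff mat_def)
  qed
  then have detP: "det P \<noteq> 0" by (metis det_I det_mul mult_zero_right zero_neq_one)
  have "poly (charpoly A) z = poly (\<Prod>\<kappa>\<in>K. [:- d \<kappa>, 1:]) z" for z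
  proof -
    define D :: "complex ^ 'm ^ 'm" where "D = (\<chi> i j. if i = j then z - d (b i) else 0)"
    have "(mat z - A) ** P = P ** D"
    proof -
      have "(A ** P) $ i $ j = d (b j) * w (b j) $ i" for i j
      proof -
        have "(A ** P) $ i $ j = (A *v w (b j)) $ i"
          by (simp add: matrix_matrix_mult_def matrix_vector_mult_def P_def)
        then show ?thesis by (simp add: ev[OF bK])
      qed
      moreover have "(mat z ** P) $ i $ j = z * w (b j) $ i" for i j
        by (simp add: matrix_matrix_mult_def mat_def P_def if_distrib[of "\<lambda>x. x * _"] cong: if_cong)
      moreover have "(P ** D) $ i $ j = w (b j) $ i * (z - d (b j))" for i j
        by (simp add: matrix_matrix_mult_def D_def P_def if_distrib[of "\<lambda>x. _ * x"] cong: if_cong)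
      ultimately show ?thesis by (simp add: vec_eq_iff matrix_diff_rdistrib algebra_simps)
    qed
    then have "det (mat z - A) * det P = det P * det D" by (metis det_mul)
    then have "det (mat z - A) = det D" using detP by simp
    also have "\<dots> = (\<Prod>i\<in>UNIV. D $ i $ i)" by (rule det_diagonal) (simp add: D_def)
    also have "\<dots> = (\<Prod>i\<in>UNIV. z - d (b i))" by (simp add: D_def)
    also have "\<dots> = (\<Prod>\<kappa>\<in>K. z - d \<kappa>)" using b by (rule prod.reindex_bij_betw)
    finally show ?thesis by (simp add: poly_charpoly poly_prod)
  qed
  then show ?thesis by (intro poly_eq_poly_eq_iff[THEN iffD1]) (rule ext)
qed

section \<open>Roots of unity\<close>

definition is_root_of_unity :: "complex \<Rightarrow> bool" where
  "is_root_of_unity z \<longleftrightarrow> (\<exists>k\<ge>1. z ^ k = 1)"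

text \<open>The multiplicative order. When \<open>z\<close> is not a root of unity, no
  \<open>k\<close> qualifies for \<open>LEAST\<close> and the value is unspecified.\<close>

definition unit_order :: "complex \<Rightarrow> nat" where
  "unit_order z = (LEAST k. k \<ge> 1 \<and> z ^ k = 1)"

lemma unit_order_props:
  assumes "is_root_of_unity z"
  shows "unit_order z \<ge> 1" "z ^ unit_order z = 1"
  using LeastI_ex[of "\<lambda>k. k \<ge> 1 \<and> z ^ k = 1"] assms
  by (auto simp: is_root_of_unity_def unit_order_def)

lemma primitive_root_of_unity_iff:
  "primitive_root_of_unity k z \<longleftrightarrow> is_root_of_unity z \<and> k = unit_order z"
proof
  assume p: "primitive_root_of_unity k z"
  then have "(LEAST k. k \<ge> 1 \<and> z ^ k = 1) = k"
    by (intro Least_equality) (use p in \<open>auto simp: primitive_root_of_unity_def not_less[symmetric]\<close>)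
  then show "is_root_of_unity z \<and> k = unit_order z"
    using p by (auto simp: primitive_root_of_unity_def is_root_of_unity_def unit_order_def)
next
  assume "is_root_of_unity z \<and> k = unit_order z"
  then show "primitive_root_of_unity k z"
    using unit_order_props[of z] not_less_Least[of _ "\<lambda>k. k \<ge> 1 \<and> z ^ k = 1"]
    by (auto simp: primitive_root_of_unity_def unit_order_def)
qed

lemma root_of_unity_nonzero: "is_root_of_unity z \<Longrightarrow> z \<noteq> 0"
  by (auto simp: is_root_of_unity_def power_0_left)

lemma root_of_unity_norm:
  assumes "is_root_of_unity z"
  shows "cmod z = 1"
proof -
  obtain k where "k \<ge> 1" "z ^ k = 1" using assms by (auto simp: is_root_of_unity_def)
  then have "cmod z ^ k = 1" by (simp flip: norm_power)
  then show ?thesis using \<open>k \<ge> 1\<close> power_eq_imp_eq_base[of "cmod z" k 1] by simp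
qed

text \<open>Modulo the order the exponent becomes a remainder below the order, where only 0 gives 1
  by minimality.\<close>

lemma powi_eq_1_iff:
  assumes z: "is_root_of_unity z"
  shows "z powi j = 1 \<longleftrightarrow> int (unit_order z) dvd j"
proof -
  define k where "k = unit_order z"
  have k: "k \<ge> 1" "z ^ k = 1" using unit_order_props[OF z] by (simp_all add: k_def)
  have z0: "z \<noteq> 0" using root_of_unity_nonzero[OF z] .
  have "z powi (int k * (j div int k) + j mod int k) = (z powi int k) powi (j div int k) * z powi (j mod int k)"
    using z0 by (subst power_int_add) (auto simp: power_int_mult)
  then have "z powi j = z powi (j mod int k)" using k by simp
  also have "\<dots> = z ^ nat (j mod int k)" using k by (simp add: power_int_def)
  finally have eq: "z powi j = z ^ nat (j mod int k)" .
  have "nat (j mod int k) < k" using k by (simp add: nat_less_iff)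
  then have "z ^ nat (j mod int k) = 1 \<longleftrightarrow> nat (j mod int k) = 0"
    using not_less_Least[of "nat (j mod int k)" "\<lambda>k. k \<ge> 1 \<and> z ^ k = 1"]
    by (auto simp: k_def unit_order_def)
  also have "\<dots> \<longleftrightarrow> int k dvd j" using k
    by (metis dvd_eq_mod_eq_0 nat_0_iff nle_le of_nat_0_less_iff order_less_le_trans pos_mod_sign zero_less_one)
  finally show ?thesis using eq by (simp add: k_def)
qed

lemma powi_eq_iff:
  assumes z: "is_root_of_unity z"
  shows "z powi i = z powi j \<longleftrightarrow> int (unit_order z) dvd i - j"
  using powi_eq_1_iff[OF z, of "i - j"] root_of_unity_nonzero[OF z] by (simp add: power_int_diff)

section \<open>Heisenberg-type cocycles and their unitary representations\<close>

text \<open>The number \<open>q\<^sub>i\<close>: for a root of unity \<open>z\<close>, the order of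
  \<open>z ^ c i\<close>, as \<open>dvd_mult_iff_clock_order\<close> expresses.\<close>

definition clock_order :: "(nat \<Rightarrow> nat) \<Rightarrow> complex \<Rightarrow> nat \<Rightarrow> int" where
  "clock_order c z i = int (unit_order z div gcd (unit_order z) (c i))"

lemma clock_order_pos:
  assumes "is_root_of_unity z"
  shows "clock_order c z i > 0"
  using unit_order_props(1)[OF assms]
  by (simp add: clock_order_def div_greater_zero_iff dvd_imp_le)

text \<open>After division by \<open>gcd k (c i)\<close> the remaining factors of \<open>k\<close>
  and \<open>c i\<close> are coprime.\<close>

lemma dvd_mult_iff_clock_order:
  assumes z: "is_root_of_unity z"
  shows "int (unit_order z) dvd int (c i) * j \<longleftrightarrow> clock_order c z i dvd j"
proof -
  define k g where "k = unit_order z" and "g = gcd k (c i)"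
  have "k > 0" using unit_order_props(1)[OF z] by (simp add: k_def)
  then have "g > 0" by (simp add: g_def)
  obtain k' c' where kc: "k = g * k'" "c i = g * c'" using g_def by (meson dvdE gcd_dvd1 gcd_dvd2)
  have "coprime k' c'" using \<open>g > 0\<close> kc g_def by (metis gcd_mult_distrib_nat coprime_iff_gcd_eq_1 mult_cancel1 mult.right_neutral not_gr0)
  then have cop: "coprime (int k') (int c')" by simp
  have "int k dvd int (c i) * j \<longleftrightarrow> int k' dvd int c' * j"
    using \<open>g > 0\<close> by (simp add: kc mult.assoc)
  also have "\<dots> \<longleftrightarrow> int k' dvd j" using cop by (simp add: coprime_dvd_mult_right_iff)
  also have "int k' = clock_order c z i"
  proof -
    have "clock_order c z i = int (k div g)" by (simp add: clock_order_def k_def g_def)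
    then show ?thesis using \<open>g > 0\<close> by (simp add: kc(1))
  qed
  finally show ?thesis by (simp add: k_def)
qed

text \<open>Labels of the basis vectors of one block with central eigenvalue \<open>z\<close>.
  Extensional functions are used so that there are exactly \<open>mu t c (unit_order z)\<close> of
  them.\<close>

definition clock_index :: "nat \<Rightarrow> (nat \<Rightarrow> nat) \<Rightarrow> complex \<Rightarrow> (nat \<Rightarrow> int) set" where
  "clock_index t c z = (\<Pi>\<^sub>E i\<in>{1..t}. {0..<clock_order c z i})"

lemma finite_clock_index: "finite (clock_index t c z)"
  by (simp add: clock_index_def finite_PiE)

lemma card_clock_index: "card (clock_index t c z) = mu t c (unit_order z)"
  by (simp add: clock_index_def card_PiE mu_def clock_order_def)

lemma mu_pos:
  assumes "k \<ge> 1"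
  shows "mu t c k > 0"
  using assms by (auto simp: mu_def div_greater_zero_iff dvd_imp_le intro!: prod_pos)

lemma mu_unit_order_pos: "is_root_of_unity z \<Longrightarrow> mu t c (unit_order z) > 0"
  by (intro mu_pos unit_order_props(1))

text \<open>Collects the laws of a basis \<open>e\<close> of the lattice and its coordinate
  functionals \<open>d\<close>, which keeps module theory out of the representation theory;
  \<open>Zn_basis_heisenberg_data\<close> provides the instance.\<close>

locale heisenberg_data =
  fixes d :: "nat \<Rightarrow> int ^ 'n \<Rightarrow> int" and e :: "nat \<Rightarrow> int ^ 'n" and N t :: nat and c :: "nat \<Rightarrow> nat"
  assumes d_add: "d l (u + v) = d l u + d l v"
    and d_e: "l \<in> {1..N} \<Longrightarrow> l' \<in> {1..N} \<Longrightarrow> d l (e l') = (if l = l' then 1 else 0)"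
    and expand: "u = (\<Sum>l=1..N. d l u *s e l)"
    and t: "1 \<le> t" "2 * t \<le> N"
    and c_pos: "i \<in> {1..t} \<Longrightarrow> c i > 0"
begin

lemma d_0 [simp]: "d l 0 = 0"
  using d_add[of l 0 0] by simp

lemma d_minus [simp]: "d l (- u) = - d l u"
  using d_add[of l u "- u"] by simp

lemma d_diff: "d l (u - v) = d l u - d l v"
  using d_add[of l u "- v"] by simp

lemma d_sum: "d l (\<Sum>i\<in>I. f i) = (\<Sum>i\<in>I. d l (f i))"
  by (induction I rule: infinite_finite_induct) (auto simp: d_add)

lemma d_scale_nat: "d l (int k *s u) = int k * d l u"
  by (induction k) (auto simp: d_add algebra_simps vector_sadd_rdistrib)

lemma d_scale: "d l (k *s u) = k * d l u"
proof (cases k rule: int_cases2)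
  case (nonneg n)
  then show ?thesis by (simp add: d_scale_nat)
next
  case (nonpos n)
  then have "k *s u = - (int n *s u)" by (simp add: vec_eq_iff)
  then show ?thesis using nonpos by (simp add: d_scale_nat)
qed

text \<open>The bilinear representative of the class; the commutator pairing is
  \<open>cocycle u v - cocycle v u\<close>.\<close>

definition cocycle :: "int ^ 'n \<Rightarrow> int ^ 'n \<Rightarrow> int" where
  "cocycle u v = (\<Sum>i=1..t. int (c i) * (d i u * d (t + i) v))"

lemma cocycle_add_left: "cocycle (u + u') v = cocycle u v + cocycle u' v"
  by (simp add: cocycle_def d_add algebra_simps sum.distrib)

lemma cocycle_add_right: "cocycle u (v + v') = cocycle u v + cocycle u v'"
  by (simp add: cocycle_def d_add algebra_simps sum.distrib)

lemma cocycle_0 [simp]: "cocycle u 0 = 0" "cocycle 0 u = 0"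
  by (simp_all add: cocycle_def)

lemma cocycle_minus [simp]: "cocycle u (- v) = - cocycle u v" "cocycle (- u) v = - cocycle u v"
  by (simp_all add: cocycle_def sum_negf)

text \<open>\<open>G k u\<close> is the image of the element with normal form \<open>(k, u)\<close>,
  so \<open>G 1 0\<close> is the image of the central generator.\<close>

definition is_rep :: "(int \<Rightarrow> int ^ 'n \<Rightarrow> complex ^ 'm ^ 'm) \<Rightarrow> bool" where
  "is_rep G \<longleftrightarrow> (\<forall>k u. G k u \<in> unitary_matrices) \<and>
     (\<forall>k u l v. G k u ** G l v = G (k + l + cocycle u v) (u + v))"

lemma rep_unitary: "is_rep G \<Longrightarrow> G k u \<in> unitary_matrices"
  and rep_mult: "is_rep G \<Longrightarrow> G k u ** G l v = G (k + l + cocycle u v) (u + v)"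
  by (auto simp: is_rep_def)

lemma rep_apply: "is_rep G \<Longrightarrow> G k u *v (G l v *v w) = G (k + l + cocycle u v) (u + v) *v w"
  by (simp add: matrix_vector_mul_assoc rep_mult)

text \<open>An idempotent unitary matrix is the identity.\<close>

lemma rep_0:
  assumes "is_rep G"
  shows "G 0 0 = mat 1"
proof -
  have "conj_transpose (G 0 0) ** (G 0 0 ** G 0 0) = conj_transpose (G 0 0) ** G 0 0"
    using rep_mult[OF assms, of 0 0 0 0] by simp
  moreover have "conj_transpose (G 0 0) ** G 0 0 = mat 1"
    using rep_unitary[OF assms, of 0 0] by (simp add: unitary_matrices_def)
  ultimately show ?thesis by (simp add: matrix_mul_assoc)
qed

text \<open>Induction from 0 in both directions; \<open>cmod z = 1\<close> permits division by
  \<open>z\<close> on the way down.\<close>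

lemma rep_central_eigenvalue:
  assumes G: "is_rep G" and v: "G 1 0 *v v = z *s v" "v \<noteq> 0"
  shows "G k 0 *v v = z powi k *s v"
proof -
  have "cmod z = 1" by (rule unitary_eigenvalue[OF rep_unitary[OF G] v])
  then have z0: "z \<noteq> 0" by auto
  show ?thesis
  proof (induction k rule: int_induct[where k = 0])
    case base
    then show ?case by (simp add: rep_0[OF G])
  next
    case (step1 i)
    have "G (i + 1) 0 *v v = G i 0 *v (G 1 0 *v v)" by (simp add: rep_apply[OF G])
    then show ?case using z0 by (simp add: v vec.scale step1 power_int_add mult.commute)
  next
    case (step2 i)
    have "v = inverse z *s (G 1 0 *v v)" using z0 by (simp add: v)
    then have "G (i - 1) 0 *v v = inverse z *s (G (i - 1) 0 *v (G 1 0 *v v))"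
      by (metis vec.scale)
    also have "\<dots> = inverse z *s (G i 0 *v v)" by (simp add: rep_apply[OF G])
    finally show ?case using z0 by (simp add: step2 power_int_diff field_simps)
  qed
qed

section \<open>Clock and shift action twisted by a character\<close>

definition clock_shift :: "complex \<Rightarrow> int ^ 'n \<Rightarrow> (nat \<Rightarrow> int) \<Rightarrow> nat \<Rightarrow> int" where
  "clock_shift z u r = (\<lambda>i\<in>{1..t}. (r i + d (t + i) u) mod clock_order c z i)"

definition character :: "(nat \<Rightarrow> real) \<Rightarrow> int ^ 'n \<Rightarrow> complex" where
  "character \<theta> u = cis (\<Sum>l=1..N. \<theta> l * of_int (d l u))"

text \<open>The scalar picked up by the vector with label \<open>r\<close> while it moves to label
  \<open>clock_shift z u r\<close>. The sum in the exponent is the cocycle of \<open>u\<close> with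
  \<open>\<Sum> r\<^sub>i e\<^sub>t\<^sub>+\<^sub>i\<close>; this is the clock part, and
  \<open>character\<close> is the free twist.\<close>

definition phase :: "complex \<Rightarrow> (nat \<Rightarrow> real) \<Rightarrow> int \<Rightarrow> int ^ 'n \<Rightarrow> (nat \<Rightarrow> int) \<Rightarrow> complex" where
  "phase z \<theta> k u r = z powi (k + (\<Sum>i=1..t. int (c i) * (d i u * r i))) * character \<theta> u"

lemma character_add: "character \<theta> (u + v) = character \<theta> u * character \<theta> v"
  by (simp add: character_def d_add cis_mult algebra_simps sum.distrib)

lemma character_norm [simp]: "cmod (character \<theta> u) = 1"
  by (simp add: character_def)

lemma character_nonzero [simp]: "character \<theta> u \<noteq> 0"
  by (simp add: character_def)

lemma character_0 [simp]: "character \<theta> 0 = 1"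
  by (simp add: character_def)

lemma phase_norm: "is_root_of_unity z \<Longrightarrow> cmod (phase z \<theta> k u r) = 1"
  by (simp add: phase_def norm_mult norm_power_int root_of_unity_norm)

lemma clock_shift_in:
  assumes "is_root_of_unity z"
  shows "clock_shift z u r \<in> clock_index t c z"
  using clock_order_pos[OF assms] by (auto simp: clock_shift_def clock_index_def)

lemma clock_shift_add: "clock_shift z u (clock_shift z v r) = clock_shift z (u + v) r"
  by (auto simp: clock_shift_def d_add fun_eq_iff mod_simps algebra_simps)

lemma clock_shift_0: "r \<in> clock_index t c z \<Longrightarrow> clock_shift z 0 r = r"
  by (auto simp: clock_shift_def clock_index_def PiE_def extensional_def Pi_iff fun_eq_iff)

text \<open>Reducing a label modulo \<open>clock_order c z i\<close> changes the exponent by a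
  multiple of \<open>c i\<close> times that number, hence by a multiple of the order of
  \<open>z\<close>. What remains is additivity of \<open>d\<close>.\<close>

lemma phase_mult:
  assumes z: "is_root_of_unity z"
  shows "phase z \<theta> k u (clock_shift z v r) * phase z \<theta> l v r = phase z \<theta> (k + l + cocycle u v) (u + v) r"
proof -
  let ?s = "clock_shift z v r"
  have "int (unit_order z) dvd (\<Sum>i=1..t. int (c i) * (d i u * ((r i + d (t + i) v) - ?s i)))"
  proof (rule dvd_sum)
    fix i assume i: "i \<in> {1..t}"
    have "clock_order c z i dvd (r i + d (t + i) v) - ?s i"
      using i by (simp add: clock_shift_def)
    then show "int (unit_order z) dvd int (c i) * (d i u * ((r i + d (t + i) v) - ?s i))"
      by (simp add: dvd_mult_iff_clock_order[OF z])
  qed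
  also have "(\<Sum>i=1..t. int (c i) * (d i u * ((r i + d (t + i) v) - ?s i))) =
      (k + l + cocycle u v + (\<Sum>i=1..t. int (c i) * (d i (u + v) * r i))) -
      ((k + (\<Sum>i=1..t. int (c i) * (d i u * ?s i))) + (l + (\<Sum>i=1..t. int (c i) * (d i v * r i))))"
    by (simp add: cocycle_def d_add algebra_simps sum.distrib sum_subtractf)
  finally have "z powi (k + l + cocycle u v + (\<Sum>i=1..t. int (c i) * (d i (u + v) * r i))) =
      z powi ((k + (\<Sum>i=1..t. int (c i) * (d i u * ?s i))) + (l + (\<Sum>i=1..t. int (c i) * (d i v * r i))))"
    by (simp only: powi_eq_iff[OF z])
  then show ?thesis
    using root_of_unity_nonzero[OF z] by (simp add: phase_def character_add power_int_add)
qed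

subsection \<open>Irreducible blocks\<close>

definition is_block :: "(int \<Rightarrow> int ^ 'n \<Rightarrow> complex ^ 'm ^ 'm) \<Rightarrow> complex \<Rightarrow> (nat \<Rightarrow> real) \<Rightarrow>
    ((nat \<Rightarrow> int) \<Rightarrow> complex ^ 'm) \<Rightarrow> bool" where
  "is_block G z \<theta> v \<longleftrightarrow> is_root_of_unity z \<and> orthonormal_family (clock_index t c z) v \<and>
     (\<forall>k u. \<forall>r\<in>clock_index t c z. G k u *v v r = phase z \<theta> k u r *s v (clock_shift z u r))"

text \<open>If \<open>y\<close> is an \<open>a\<^sub>1\<close>-eigenvector on which \<open>x\<close> acts by \<open>z\<close>, then the vectors \<open>a\<^sub>t\<^sub>+\<^sub>1\<^sup>j y\<close> are
  \<open>a\<^sub>1\<close>-eigenvectors with eigenvalues in ratio \<open>z\<^bsup>c\<^sub>1 j\<^esup>\<close>; in finite dimension these cannot all differ.\<close>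

lemma central_eigenvalue_root_of_unity:
  fixes G :: "int \<Rightarrow> int ^ 'n \<Rightarrow> complex ^ 'm ^ 'm"
  assumes G: "is_rep G" and y: "G 1 0 *v y = z *s y" "hinner y y = 1" "G 0 (e 1) *v y = b *s y"
  shows "is_root_of_unity z"
proof (rule ccontr)
  assume not: "\<not> is_root_of_unity z"
  have y0: "y \<noteq> 0" using y(2) by auto
  have "cmod z = 1" by (rule unitary_eigenvalue[OF rep_unitary[OF G] y(1) y0])
  then have z0: "z \<noteq> 0" by auto
  have "cmod b = 1" by (rule unitary_eigenvalue[OF rep_unitary[OF G] y(3) y0])
  then have b0: "b \<noteq> 0" by auto
  define v where "v j = G 0 (int j *s e (t + 1)) *v y" for j :: nat
  have c1: "c 1 > 0" using c_pos t by auto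
  have de: "d i (e 1) = (if i = 1 then 1 else 0)" "d i (e (t + 1)) = (if i = t + 1 then 1 else 0)"
    if "i \<in> {1..2*t}" for i
    using that t by (auto simp: d_e)
  \<comment> \<open>The next two facts say that commuting \<open>e 1\<close> past \<open>j\<close>
    copies of \<open>e (t + 1)\<close> costs the central element with exponent
    \<open>c 1 * j\<close>.\<close>
  have coc1: "cocycle (e 1) (int j *s e (t + 1)) = int (c 1) * int j" for j
  proof -
    have "cocycle (e 1) (int j *s e (t + 1)) = (\<Sum>i=1..t. if i = 1 then int (c 1) * int j else 0)"
      unfolding cocycle_def by (rule sum.cong) (auto simp: d_scale de simp del: One_nat_def)
    then show ?thesis using t by simp
  qed
  have coc2: "cocycle (int j *s e (t + 1)) (e 1) = 0" for j
    unfolding cocycle_def by (rule sum.neutral) (auto simp: d_scale de simp del: One_nat_def)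
  have ev: "G 0 (e 1) *v v j = (z powi (int (c 1) * int j) * b) *s v j" for j
  proof -
    let ?w = "int j *s e (t + 1)"
    have "G 0 (e 1) *v v j = G 0 ?w *v (G 0 (e 1) *v (G (int (c 1) * int j) 0 *v y))"
      unfolding v_def rep_apply[OF G] coc1 by (simp add: add.commute coc2[simplified])
    also have "\<dots> = (z powi (int (c 1) * int j) * b) *s v j"
      by (simp add: rep_central_eigenvalue[OF G y(1) y0] vec.scale y(3)[simplified] v_def mult_ac)
    finally show ?thesis .
  qed
  \<comment> \<open>These are \<open>CARD('m) + 1\<close> vectors, one too many for an orthonormal
    family.\<close>
  have "orthonormal_family {..CARD('m)} v"
    unfolding orthonormal_family_def
  proof (intro conjI ballI)
    fix i j :: nat
    show "hinner (v i) (v j) = (if i = j then 1 else 0)"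
    proof (cases "i = j")
      case True
      then show ?thesis by (simp add: v_def hinner_unitary[OF rep_unitary[OF G]] y)
    next
      case False
      have ne: "z powi (int (c 1) * int i) \<noteq> z powi (int (c 1) * int j)" if "i < j" for i j
      proof
        assume "z powi (int (c 1) * int i) = z powi (int (c 1) * int j)"
        then have "z ^ (c 1 * i) = z ^ (c 1 * j)"
          by (simp only: power_int_of_nat flip: of_nat_mult)
        moreover have "z ^ (c 1 * j) = z ^ (c 1 * i) * z ^ (c 1 * (j - i))"
          using that by (simp add: diff_mult_distrib2 flip: power_add)
        ultimately have "z ^ (c 1 * (j - i)) = 1" using z0 by simp
        moreover have "c 1 * (j - i) \<ge> 1" using c1 that by (simp add: Suc_le_eq)
        ultimately show False using not by (auto simp: is_root_of_unity_def)
      qed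
      then have "z powi (int (c 1) * int i) \<noteq> z powi (int (c 1) * int j)"
        using False by (metis linorder_neqE_nat)
      then show ?thesis
        using False unitary_eigenvectors_orthogonal[OF rep_unitary[OF G] ev ev] b0 by simp
    qed
  qed simp
  from orthonormal_family_card_le[OF this] show False by simp
qed

section \<open>The sublattice acting by commuting matrices, and its characters\<close>

definition isotropic_lattice :: "complex \<Rightarrow> (int ^ 'n) set" where
  "isotropic_lattice z = {u. \<forall>i\<in>{1..t}. clock_order c z i dvd d (t + i) u}"

text \<open>\<open>c i\<close> times a multiple of \<open>clock_order c z i\<close> is divisible by
  the order of \<open>z\<close>. Consequently the lattice acts by commuting matrices wherever the
  central generator acts by \<open>z\<close>.\<close>

lemma powi_cocycle_isotropic:
  assumes "is_root_of_unity z" "h \<in> isotropic_lattice z"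
  shows "z powi (cocycle u h) = 1"
  unfolding powi_eq_1_iff[OF assms(1)] cocycle_def
  by (rule dvd_sum)
     (use assms(2) in \<open>auto simp: dvd_mult_iff_clock_order[OF assms(1)] isotropic_lattice_def\<close>)

text \<open>The lattice is generated by the multiples \<open>g l *s e l\<close>. Dividing the
  argument of \<open>\<psi> (g l *s e l)\<close> by \<open>g l\<close> chooses a root, and these
  angles define a character of the whole group \<open>\<int>\<^sup>n\<close>.\<close>

lemma character_extension:
  assumes z: "is_root_of_unity z"
    and norm: "\<And>u. u \<in> isotropic_lattice z \<Longrightarrow> cmod (\<psi> u) = 1"
    and add: "\<And>u v. u \<in> isotropic_lattice z \<Longrightarrow> v \<in> isotropic_lattice z \<Longrightarrow> \<psi> (u + v) = \<psi> u * \<psi> v"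
  shows "\<exists>\<theta>. \<forall>u\<in>isotropic_lattice z. \<psi> u = character \<theta> u"
proof -
  let ?L = "isotropic_lattice z"
  have L0: "0 \<in> ?L" and Ladd: "u \<in> ?L \<Longrightarrow> v \<in> ?L \<Longrightarrow> u + v \<in> ?L"
    and Lscale: "u \<in> ?L \<Longrightarrow> k *s u \<in> ?L" for u v k
    by (auto simp: isotropic_lattice_def d_add d_scale)
  have nz: "\<psi> u \<noteq> 0" if "u \<in> ?L" for u using norm[OF that] by auto
  have \<psi>0: "\<psi> 0 = 1" using add[OF L0 L0] nz[OF L0] by simp
  have scale: "\<psi> (k *s u) = \<psi> u powi k" if u: "u \<in> ?L" for u k
  proof (induction k rule: int_induct[where k = 0])
    case (step1 i)
    have "\<psi> (i *s u + u) = \<psi> (i *s u) * \<psi> u" by (intro add Lscale u)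
    also have "i *s u + u = (i + 1) *s u" by (simp add: vec_eq_iff algebra_simps)
    finally show ?case using nz[OF u] by (simp only: step1(2) power_int_add_1 simp_thms)
  next
    case (step2 i)
    have "\<psi> ((i - 1) *s u + u) = \<psi> ((i - 1) *s u) * \<psi> u" by (intro add Lscale u)
    also have "(i - 1) *s u + u = i *s u" by (simp add: vec_eq_iff algebra_simps)
    finally have "\<psi> ((i - 1) *s u) = \<psi> (i *s u) / \<psi> u"
      using nz[OF u] by (metis nonzero_mult_div_cancel_right)
    moreover have "\<psi> u powi (i - 1) = \<psi> u powi i / \<psi> u"
      using nz[OF u] by (simp add: power_int_diff)
    ultimately show ?case by (simp only: step2(2))
  qed (simp add: \<psi>0)
  \<comment> \<open>The multiples of \<open>e l\<close> in the lattice are generated by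
    \<open>g l *s e l\<close>; only the coordinates from \<open>t + 1\<close> to
    \<open>2 * t\<close> are restricted.\<close>
  define g where "g l = (if l \<in> {t+1..2*t} then clock_order c z (l - t) else 1)" for l
  have g_pos: "g l > 0" for l using clock_order_pos[OF z] by (simp add: g_def)
  have gL: "g l *s e l \<in> ?L" if "l \<in> {1..N}" for l
    using that t by (auto simp: isotropic_lattice_def d_scale g_def d_e)
  have g_dvd: "g l dvd d l u" if "u \<in> ?L" "l \<in> {1..N}" for l u
  proof (cases "l \<in> {t+1..2*t}")
    case True
    then have "l - t \<in> {1..t}" and l: "t + (l - t) = l" by auto
    then have "clock_order c z (l - t) dvd d (t + (l - t)) u"
      using that(1) unfolding isotropic_lattice_def by blast
    then show ?thesis using True by (simp only: g_def l if_True)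
  qed (auto simp: g_def)
  define \<theta> where "\<theta> l = Arg (\<psi> (g l *s e l)) / of_int (g l)" for l
  have \<theta>: "\<psi> (g l *s e l) = cis (of_int (g l) * \<theta> l)" if "l \<in> {1..N}" for l
    using g_pos[of l] norm[OF gL[OF that]] nz[OF gL[OF that]]
    by (simp add: \<theta>_def cis_Arg sgn_eq)
  have "\<psi> u = character \<theta> u" if u: "u \<in> ?L" for u
  proof -
    have eq: "d l u *s e l = (d l u div g l) *s (g l *s e l)" if "l \<in> {1..N}" for l
      using g_dvd[OF u that] by simp
    have inL: "d l u *s e l \<in> ?L" if "l \<in> {1..N}" for l
      unfolding eq[OF that] by (intro Lscale gL that)
    \<comment> \<open>Induction over sets of coordinates; membership in the lattice is carried along
      because \<open>\<psi>\<close> is known to be multiplicative only there.\<close>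
    have "(\<Sum>l\<in>F. d l u *s e l) \<in> ?L \<and> \<psi> (\<Sum>l\<in>F. d l u *s e l) = cis (\<Sum>l\<in>F. \<theta> l * of_int (d l u))"
      if "finite F" "F \<subseteq> {1..N}" for F
      using that
    proof (induction F rule: finite_induct)
      case (insert l F)
      have l: "l \<in> {1..N}" using insert by auto
      have "\<psi> (d l u *s e l) = cis (of_int (g l) * \<theta> l) powi (d l u div g l)"
        unfolding eq[OF l] scale[OF gL[OF l]] \<theta>[OF l] ..
      also have "\<dots> = cis (\<theta> l * of_int (g l * (d l u div g l)))"
        by (simp add: cis_power_int mult_ac)
      also have "g l * (d l u div g l) = d l u" using g_dvd[OF u l] by simp
      finally have "\<psi> (d l u *s e l) = cis (\<theta> l * of_int (d l u))" .
      then show ?case using insert inL[OF l] by (simp add: add Ladd cis_mult)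
    qed (simp add: L0 \<psi>0)
    from this[of "{1..N}"] show ?thesis by (simp only: character_def expand[symmetric]) simp
  qed
  then show ?thesis by blast
qed

text \<open>Choose in turn an eigenvector of the central generator, whose eigenvalue
  \<open>z\<close> is a root of unity, and a joint eigenvector \<open>w\<close> of the isotropic
  lattice on the \<open>z\<close>-eigenspace. Translates of \<open>w\<close>, one for each coset of
  the lattice, form the block.\<close>

lemma block_exists:
  fixes G :: "int \<Rightarrow> int ^ 'n \<Rightarrow> complex ^ 'm ^ 'm"
  assumes G: "is_rep G" and W: "vec.subspace W" "y \<in> W" "y \<noteq> 0"
    and inv: "\<And>k u w. w \<in> W \<Longrightarrow> G k u *v w \<in> W"
  shows "\<exists>z \<theta> v. is_block G z \<theta> v \<and> v ` clock_index t c z \<subseteq> W"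
proof -
  obtain y' z where y': "y' \<in> W" "y' \<noteq> 0" "G 1 0 *v y' = z *s y'"
    using eigenvector_in_invariant_subspace[OF W inv] by blast
  define W1 where "W1 = {w \<in> W. G 1 0 *v w = z *s w}"
  have W1: "vec.subspace W1" "y' \<in> W1"
    using W(1) y' unfolding W1_def vec.subspace_def
    by (auto simp: matrix_vector_right_distrib vec.scale_right_distrib vec.scale mult.commute)
  have inv1: "G k u *v w \<in> W1" if "w \<in> W1" for k u w
  proof -
    have "G 1 0 *v (G k u *v w) = G k u *v (G 1 0 *v w)" by (simp add: rep_apply[OF G] add.commute)
    then show ?thesis using that inv by (simp add: W1_def vec.scale)
  qed
  \<comment> \<open>Normalization is done in such a way that all eigenvector equations survive at
    once.\<close>
  have normalized: "\<exists>w'\<in>W1. hinner w' w' = 1 \<and> (\<forall>A b. A *v w = b *s w \<longrightarrow> A *v w' = b *s w')"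
    if w: "w \<in> W1" "w \<noteq> 0" for w
  proof -
    obtain a where a: "hinner (a *s w) (a *s w) = 1" using normalize_vec[OF w(2)] by blast
    show ?thesis
      using a w(1) W1(1) by (intro bexI[of _ "a *s w"]) (auto simp: vec.scale vec.subspace_scale mult.commute)
  qed
  \<comment> \<open>This eigenvector for \<open>e 1\<close> serves to show that \<open>z\<close> is
    a root of unity.\<close>
  obtain y1 b where y1: "y1 \<in> W1" "y1 \<noteq> 0" "G 0 (e 1) *v y1 = b *s y1"
    using eigenvector_in_invariant_subspace[OF W1 y'(2) inv1] by blast
  obtain y2 where y2: "y2 \<in> W1" "hinner y2 y2 = 1" "G 0 (e 1) *v y2 = b *s y2"
    using normalized[OF y1(1,2)] y1(3) by blast
  have z: "is_root_of_unity z"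
    using central_eigenvalue_root_of_unity[OF G _ y2(2,3)] y2(1) by (simp add: W1_def)
  have central: "G k 0 *v w = z powi k *s w" if "w \<in> W1" for k w
    using that rep_central_eigenvalue[OF G, of w] by (cases "w = 0") (auto simp: W1_def)
  let ?L = "isotropic_lattice z"
  have mult: "G 0 u *v (G 0 v *v w) = z powi (cocycle u v) *s (G 0 (u + v) *v w)" if "w \<in> W1" for u v w
  proof -
    have "G 0 u *v (G 0 v *v w) = G 0 (u + v) *v (G (cocycle u v) 0 *v w)"
      by (simp add: rep_apply[OF G])
    then show ?thesis using that by (simp add: central vec.scale)
  qed
  have "A *v (B *v w) = B *v (A *v w)" if "A \<in> G 0 ` ?L" "B \<in> G 0 ` ?L" "w \<in> W1" for A B w
    using that mult powi_cocycle_isotropic[OF z] by (auto simp: add.commute)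
  then obtain y3 where y3: "y3 \<in> W1" "y3 \<noteq> 0" "\<forall>A\<in>G 0 ` ?L. \<exists>b. A *v y3 = b *s y3"
    using joint_eigenvector[OF W1 y'(2), of "G 0 ` ?L"] inv1 by blast
  obtain w where w: "w \<in> W1" "hinner w w = 1" "\<forall>A b. A *v y3 = b *s y3 \<longrightarrow> A *v w = b *s w"
    using normalized[OF y3(1,2)] by blast
  have w0: "w \<noteq> 0" using w(2) by auto
  have "\<forall>u\<in>?L. \<exists>b. G 0 u *v w = b *s w" using y3(3) w(3) by blast
  then obtain \<psi> where \<psi>: "\<And>u. u \<in> ?L \<Longrightarrow> G 0 u *v w = \<psi> u *s w" by metis
  have "\<exists>\<theta>. \<forall>u\<in>?L. \<psi> u = character \<theta> u"
  proof (rule character_extension[OF z])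
    show "cmod (\<psi> u) = 1" if "u \<in> ?L" for u
      by (rule unitary_eigenvalue[OF rep_unitary[OF G] \<psi>[OF that] w0])
    show "\<psi> (u + v) = \<psi> u * \<psi> v" if uv: "u \<in> ?L" "v \<in> ?L" for u v
    proof -
      have "u + v \<in> ?L" using uv by (auto simp: isotropic_lattice_def d_add)
      then have "\<psi> (u + v) *s w = G 0 u *v (G 0 v *v w)"
        using mult[OF w(1), of u v] powi_cocycle_isotropic[OF z uv(2)] by (simp add: \<psi>)
      also have "\<dots> = (\<psi> u * \<psi> v) *s w" by (simp add: \<psi> uv vec.scale mult.commute)
      finally show ?thesis using w0 by simp
    qed
  qed
  then obtain \<theta> where \<theta>: "\<And>u. u \<in> ?L \<Longrightarrow> G 0 u *v w = character \<theta> u *s w" using \<psi> by auto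
  \<comment> \<open>Removing the factor \<open>character \<theta> u\<close> makes the translate
    depend on \<open>u\<close> only modulo the lattice.\<close>
  define y where "y u = character \<theta> (- u) *s (G 0 u *v w)" for u
  have yW1: "y u \<in> W1" for u
    unfolding y_def by (intro vec.subspace_scale[OF W1(1)] inv1 w(1))
  have G_y: "G k u *v y u' = (z powi (k + cocycle u u') * character \<theta> u) *s y (u + u')" for k u u'
  proof -
    have "G k u *v y u' = character \<theta> (- u') *s (G 0 (u + u') *v (G (k + cocycle u u') 0 *v w))"
      by (simp add: y_def vec.scale rep_apply[OF G])
    also have "\<dots> = (z powi (k + cocycle u u') * character \<theta> (- u')) *s (G 0 (u + u') *v w)"
      by (simp add: central[OF w(1)] vec.scale mult.commute)
    also have "character \<theta> (- u') = character \<theta> u * character \<theta> (- (u + u'))"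
      by (simp flip: character_add)
    finally show ?thesis by (simp add: y_def mult.assoc)
  qed
  have y_lattice: "y (u + h) = y u" if h: "h \<in> ?L" for u h
  proof -
    have "G 0 (u + h) *v w = G 0 u *v (G 0 h *v w)"
      using mult[OF w(1), of u h] powi_cocycle_isotropic[OF z h] by simp
    also have "\<dots> = character \<theta> h *s (G 0 u *v w)" by (simp add: \<theta>[OF h] vec.scale)
    finally have "y (u + h) = (character \<theta> (- (u + h)) * character \<theta> h) *s (G 0 u *v w)"
      by (simp add: y_def)
    also have "character \<theta> (- (u + h)) * character \<theta> h = character \<theta> (- u)"
      by (simp flip: character_add)
    finally show ?thesis by (simp add: y_def)
  qed
  \<comment> \<open>\<open>\<rho> r\<close> represents the coset with label
    \<open>r\<close>.\<close>
  define \<rho> where "\<rho> r = (\<Sum>i=1..t. r i *s e (t + i))" for r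
  have d\<rho>: "d (t + i) (\<rho> r) = r i" if "i \<in> {1..t}" for i r
  proof -
    have "d (t + i) (\<rho> r) = (\<Sum>j=1..t. if j = i then r i else 0)"
      unfolding \<rho>_def d_sum by (rule sum.cong) (use t that in \<open>auto simp: d_scale d_e\<close>)
    then show ?thesis using that by simp
  qed
  define v where "v r = y (\<rho> r)" for r
  have v_shift: "G k u *v v r = phase z \<theta> k u r *s v (clock_shift z u r)" for k u r
  proof -
    \<comment> \<open>\<open>u + \<rho> r\<close> and the representative of its coset differ by an
      element of the lattice, which \<open>y\<close> does not see.\<close>
    define h where "h = u + \<rho> r - \<rho> (clock_shift z u r)"
    have "h \<in> ?L"
      unfolding isotropic_lattice_def
    proof (intro CollectI ballI)
      fix i assume i: "i \<in> {1..t}"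
      have "clock_shift z u r i = (r i + d (t + i) u) mod clock_order c z i"
        using i by (simp add: clock_shift_def)
      then have "d (t + i) h = (r i + d (t + i) u) - (r i + d (t + i) u) mod clock_order c z i"
        by (simp only: h_def d_diff d_add d\<rho>[OF i])
      then show "clock_order c z i dvd d (t + i) h" by simp
    qed
    from y_lattice[OF this, of "\<rho> (clock_shift z u r)"]
    have "y (u + \<rho> r) = v (clock_shift z u r)"
      by (simp only: h_def v_def add.commute[of "\<rho> (clock_shift z u r)"] diff_add_cancel)
    moreover have "cocycle u (\<rho> r) = (\<Sum>i=1..t. int (c i) * (d i u * r i))"
      by (simp add: cocycle_def d\<rho>)
    ultimately show ?thesis unfolding v_def phase_def G_y by simp
  qed
  have norm_y: "hinner (y u) (y u) = 1" for u
  proof -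
    have "hinner (y u) (y u) = cnj (character \<theta> (- u)) * character \<theta> (- u)"
      by (simp add: y_def hinner_scale_left hinner_scale_right hinner_unitary[OF rep_unitary[OF G]] w)
    also have "\<dots> = 1" by (simp add: mult.commute[of "cnj _"] flip: complex_norm_square)
    finally show ?thesis .
  qed
  have "hinner (v r) (v r') = (if r = r' then 1 else 0)"
    if r: "r \<in> clock_index t c z" "r' \<in> clock_index t c z" for r r'
  proof (cases "r = r'")
    case True
    then show ?thesis by (simp add: v_def norm_y)
  next
    case False
    \<comment> \<open>Labels differing at \<open>i\<close> are separated by the eigenvalues of
      \<open>G 0 (e i)\<close>, which scales \<open>v s\<close> by a constant times
      \<open>z powi (int (c i) * s i)\<close>.\<close>
    then obtain i where i: "i \<in> {1..t}" "r i \<noteq> r' i"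
      using r unfolding clock_index_def by (metis PiE_ext)
    have de: "d j (e i) = (if j = i then 1 else 0)" if "j \<in> {1..2*t}" for j
      using t that i by (auto simp: d_e)
    have "e i \<in> ?L" using i by (auto simp: isotropic_lattice_def de)
    moreover have "cocycle (e i) (\<rho> s) = int (c i) * s i" for s
    proof -
      have "cocycle (e i) (\<rho> s) = (\<Sum>j=1..t. if j = i then int (c i) * s i else 0)"
        unfolding cocycle_def by (rule sum.cong) (auto simp: de d\<rho>)
      then show ?thesis using i by simp
    qed
    ultimately have ev: "G 0 (e i) *v v s = (z powi (int (c i) * s i) * character \<theta> (e i)) *s v s" for s
      using G_y[of 0 "e i" "\<rho> s"] y_lattice[of "e i" "\<rho> s"] by (simp add: v_def add.commute)
    have "z powi (int (c i) * r i) \<noteq> z powi (int (c i) * r' i)"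
    proof
      assume "z powi (int (c i) * r i) = z powi (int (c i) * r' i)"
      then have "clock_order c z i dvd r i - r' i"
        by (simp add: powi_eq_iff[OF z] dvd_mult_iff_clock_order[OF z] flip: right_diff_distrib)
      moreover have "r i \<in> {0..<clock_order c z i}" "r' i \<in> {0..<clock_order c z i}"
        using r i by (auto simp: clock_index_def PiE_iff)
      ultimately show False
        using i(2) by (metis atLeastLessThan_iff mod_eq_dvd_iff mod_pos_pos_trivial)
    qed
    then show ?thesis using False unitary_eigenvectors_orthogonal[OF rep_unitary[OF G] ev ev] by simp
  qed
  then have "is_block G z \<theta> v"
    using z v_shift finite_clock_index by (simp add: is_block_def orthonormal_family_def)
  moreover have "v ` clock_index t c z \<subseteq> W" using yW1 by (auto simp: v_def W1_def)
  ultimately show ?thesis by blast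
qed

end

section \<open>Multiplicities of roots and change of index sets\<close>

lemma order_prod_linear:
  fixes f :: "'k \<Rightarrow> complex"
  assumes "finite K"
  shows "Polynomial.order z (\<Prod>\<kappa>\<in>K. [:- f \<kappa>, 1:]) = card {\<kappa>\<in>K. f \<kappa> = z}"
  using assms
proof (induction K rule: finite_induct)
  case (insert \<kappa> K)
  have 1: "Polynomial.order z [:- a, 1:] = (if a = z then 1 else 0)" for a
  proof (cases "a = z")
    case True
    then show ?thesis using order_power_n_n[of z 1] by simp
  next
    case False
    then show ?thesis by (simp add: order_0I)
  qed
  have nz: "(\<Prod>\<kappa>\<in>K. [:- f \<kappa>, 1:]) \<noteq> 0" using insert by simp
  have "{\<kappa>' \<in> insert \<kappa> K. f \<kappa>' = z} = (if f \<kappa> = z then {\<kappa>} else {}) \<union> {\<kappa>\<in>K. f \<kappa> = z}" by auto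
  then have "card {\<kappa>' \<in> insert \<kappa> K. f \<kappa>' = z} = (if f \<kappa> = z then 1 else 0) + card {\<kappa>\<in>K. f \<kappa> = z}"
    using insert by auto
  moreover have "Polynomial.order z ([:- f \<kappa>, 1:] * (\<Prod>\<kappa>\<in>K. [:- f \<kappa>, 1:])) =
      (if f \<kappa> = z then 1 else 0) + Polynomial.order z (\<Prod>\<kappa>\<in>K. [:- f \<kappa>, 1:])"
    using nz by (subst order_mult) (auto simp: 1 simp del: mult_pCons_left)
  ultimately show ?case using insert by simp
qed simp

lemma onb_reindex:
  assumes "onb D w" "bij_betw \<phi> K D"
  shows "onb K (w \<circ> \<phi>)"
proof -
  have "finite K" using assms by (auto simp: onb_D(1) bij_betw_finite)
  moreover have "card K = card D" using assms(2) by (rule bij_betw_same_card)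
  moreover have "\<phi> \<kappa> \<in> D" if "\<kappa> \<in> K" for \<kappa> using assms(2) that by (auto simp: bij_betw_def)
  moreover have "\<phi> \<kappa> = \<phi> \<kappa>' \<longleftrightarrow> \<kappa> = \<kappa>'" if "\<kappa> \<in> K" "\<kappa>' \<in> K" for \<kappa> \<kappa>'
    using assms(2) that by (auto simp: bij_betw_def inj_on_def)
  ultimately show ?thesis
    using assms(1) by (simp add: onb_iff_card orthonormal_family_def)
qed

lemma onb_axis: "onb UNIV (\<lambda>i. axis i 1 :: complex ^ 'm)"
proof -
  have "hinner (axis i 1) (axis j 1 :: complex ^ 'm) = (if i = j then 1 else 0)" for i j
  proof -
    have "hinner (axis i 1) (axis j 1 :: complex ^ 'm) =
        (\<Sum>l\<in>UNIV. if l = i then (if l = j then 1 else 0) else 0)"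
      unfolding hinner_def by (rule sum.cong) (auto simp: axis_def)
    then show ?thesis by simp
  qed
  then show ?thesis by (simp add: onb_iff_card orthonormal_family_def)
qed

lemma degree_eq_sum_order:
  fixes p :: "complex poly"
  assumes "p \<noteq> 0"
  shows "degree p = (\<Sum>z | poly p z = 0. Polynomial.order z p)"
proof -
  have "degree p = degree (\<Prod>z | poly p z = 0. [:-z, 1:] ^ Polynomial.order z p)"
    by (subst complex_poly_decompose[symmetric]) (use assms in simp)
  also have "\<dots> = (\<Sum>z | poly p z = 0. degree ([:-z, 1:] ^ Polynomial.order z p))"
    by (rule degree_prod_sum_eq) simp
  finally show ?thesis by (simp add: degree_linear_power)
qed

lemma admissible_polysD:
  assumes "p \<in> admissible_polys t c m"
  shows "p \<noteq> 0" "degree p = m" "lead_coeff p = 1"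
    "\<And>z. poly p z = 0 \<Longrightarrow> is_root_of_unity z"
    "\<And>z. poly p z = 0 \<Longrightarrow> mu t c (unit_order z) dvd Polynomial.order z p"
proof -
  show l: "lead_coeff p = 1" and d: "degree p = m" using assms by (auto simp: admissible_polys_def)
  show "p \<noteq> 0" using l by auto
  show "is_root_of_unity z" if "poly p z = 0" for z
    using assms that by (auto simp: admissible_polys_def is_root_of_unity_def)
  then show "mu t c (unit_order z) dvd Polynomial.order z p" if "poly p z = 0" for z
    using assms that primitive_root_of_unity_iff[of "unit_order z" z]
    by (auto simp: admissible_polys_def)
qed

context heisenberg_data
begin

subsection \<open>Canonical form and connecting paths\<close>

text \<open>A basis is labelled by a root \<open>z\<close> of \<open>p\<close>, the number of a
  block with this central eigenvalue, and the label inside the block. The index set depends on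
  \<open>p\<close> alone, which makes different representations comparable.\<close>

definition std_index :: "complex poly \<Rightarrow> (complex \<times> nat \<times> (nat \<Rightarrow> int)) set" where
  "std_index p = (SIGMA z:{z. poly p z = 0}.
     {..<Polynomial.order z p div mu t c (unit_order z)} \<times> clock_index t c z)"

definition model :: "complex poly \<Rightarrow> (complex \<times> nat \<times> (nat \<Rightarrow> int) \<Rightarrow> complex ^ 'm) \<Rightarrow>
    (complex \<Rightarrow> nat \<Rightarrow> nat \<Rightarrow> real) \<Rightarrow> int \<Rightarrow> int ^ 'n \<Rightarrow> complex ^ 'm ^ 'm" where
  "model p w \<theta> k u = basis_map (std_index p) w (\<lambda>(z, l, r). phase z (\<theta> z l) k u r)
     (\<lambda>(z, l, r). w (z, l, clock_shift z u r))"

text \<open>Within a block, the vector with label \<open>r\<close> is up to a phase the image of the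
  one with label \<open>clock_shift z (- h) r\<close>, so
  \<open>orthogonal_complement_invariant\<close> applies.\<close>

lemma block_spans_invariant:
  assumes G: "is_rep G" and "\<C> \<subseteq> {v ` clock_index t c z | z \<theta> v. is_block G z \<theta> v}"
    and y: "\<forall>u\<in>\<Union>\<C>. hinner u y = 0"
  shows "\<forall>u\<in>\<Union>\<C>. hinner u (G k h *v y) = 0"
proof (rule orthogonal_complement_invariant[OF rep_unitary[OF G] _ y])
  fix u assume "u \<in> \<Union>\<C>"
  then obtain z \<theta> v r where b: "is_block G z \<theta> v" "v ` clock_index t c z \<in> \<C>"
    and r: "r \<in> clock_index t c z" "u = v r"
    using assms(2) by blast
  have z: "is_root_of_unity z" using b(1) by (simp add: is_block_def)
  define r' where "r' = clock_shift z (- h) r"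
  have r': "r' \<in> clock_index t c z" "clock_shift z h r' = r"
    by (simp_all add: r'_def clock_shift_in[OF z] clock_shift_add clock_shift_0 r(1))
  have "G k h *v v r' = phase z \<theta> k h r' *s v r"
    using b(1) r' by (simp add: is_block_def)
  moreover have "phase z \<theta> k h r' \<noteq> 0" using phase_norm[OF z, of \<theta> k h r'] by auto
  ultimately have "u = inverse (phase z \<theta> k h r') *s (G k h *v v r')" by (simp add: r(2))
  then show "\<exists>v\<in>\<Union>\<C>. \<exists>z. u = z *s (G k h *v v)" using b(2) r'(1) by blast
qed

text \<open>The complement of the blocks chosen so far is invariant, so by
  \<open>block_exists\<close> it contains a further block until the space is used up.\<close>

lemma block_decomposition:
  fixes G :: "int \<Rightarrow> int ^ 'n \<Rightarrow> complex ^ 'm ^ 'm"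
  assumes G: "is_rep G"
  shows "\<exists>(\<C> :: (complex ^ 'm) set set) z \<theta> v. finite \<C> \<and> (\<forall>b\<in>\<C>. is_block G (z b) (\<theta> b) (v b)) \<and>
    onb (SIGMA b:\<C>. clock_index t c (z b)) (\<lambda>(b, r). v b r)"
proof -
  \<comment> \<open>Blocks are first treated as bare sets of vectors to suit the exhaustion lemma;
    their data are chosen again afterwards.\<close>
  define \<B> where "\<B> = {v ` clock_index t c z | z \<theta> v. is_block G z \<theta> v}"
  have "\<exists>\<C>\<subseteq>\<B>. finite \<C> \<and> disjoint \<C> \<and> onb (\<Union>\<C>) id"
  proof (rule orthonormal_blocks_exhaust)
    fix b assume "b \<in> \<B>"
    then obtain z \<theta> v where b: "is_block G z \<theta> v" "b = v ` clock_index t c z"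
      by (auto simp: \<B>_def)
    then have on: "orthonormal_family (clock_index t c z) v" and z: "is_root_of_unity z"
      by (auto simp: is_block_def)
    have "hinner (v r) (v r') = (if v r = v r' then 1 else 0)"
      if "r \<in> clock_index t c z" "r' \<in> clock_index t c z" for r r'
      using on that unfolding orthonormal_family_def by (metis zero_neq_one)
    then have "orthonormal_family b id" using b(2) finite_clock_index by (auto simp: orthonormal_family_def)
    moreover have "b \<noteq> {}" using b(2) clock_shift_in[OF z] by auto
    ultimately show "b \<noteq> {} \<and> orthonormal_family b id" by simp
  next
    fix \<C> and y :: "complex ^ 'm" assume \<C>: "\<C> \<subseteq> \<B>" and y: "y \<noteq> 0" "\<forall>u\<in>\<Union>\<C>. hinner u y = 0"
    define W where "W = {y. \<forall>u\<in>\<Union>\<C>. hinner u y = 0}"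
    have "G k u *v w \<in> W" if "w \<in> W" for k u w
      using block_spans_invariant[OF G \<C>[unfolded \<B>_def], of w] that unfolding W_def by blast
    moreover have "vec.subspace W" unfolding W_def by (rule subspace_orthogonal_complement)
    moreover have "y \<in> W" using y by (simp add: W_def)
    ultimately obtain z \<theta> v where "is_block G z \<theta> v" "v ` clock_index t c z \<subseteq> W"
      using block_exists[OF G] y(1) by blast
    then show "\<exists>b\<in>\<B>. \<forall>u\<in>\<Union>\<C>. \<forall>v\<in>b. hinner u v = 0"
      by (intro bexI[of _ "v ` clock_index t c z"]) (auto simp: \<B>_def W_def)
  qed
  then obtain \<C> where \<C>: "\<C> \<subseteq> \<B>" "finite \<C>" "disjoint \<C>" "onb (\<Union>\<C>) id" by blast
  have "\<forall>b\<in>\<C>. \<exists>z \<theta> v. is_block G z \<theta> v \<and> b = v ` clock_index t c z"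
    using \<C>(1) unfolding \<B>_def by blast
  then obtain z \<theta> v where blk: "\<And>b. b \<in> \<C> \<Longrightarrow> is_block G (z b) (\<theta> b) (v b)"
    and im: "\<And>b. b \<in> \<C> \<Longrightarrow> b = v b ` clock_index t c (z b)"
    by metis
  have "bij_betw (\<lambda>(b, r). v b r) (SIGMA b:\<C>. clock_index t c (z b)) (\<Union>\<C>)"
    unfolding bij_betw_def
  proof
    show "inj_on (\<lambda>(b, r). v b r) (SIGMA b:\<C>. clock_index t c (z b))"
    proof (rule inj_onI, clarify)
      fix b r b' r' assume *: "b \<in> \<C>" "r \<in> clock_index t c (z b)" "b' \<in> \<C>" "r' \<in> clock_index t c (z b')"
        "v b r = v b' r'"
      have "v b r \<in> b" "v b' r' \<in> b'"
        using *(2,4) im[OF *(1)] im[OF *(3)] by (metis imageI)+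
      then have "b = b'" using \<C>(3) * by (metis disjnt_iff pairwiseD)
      moreover have "orthonormal_family (clock_index t c (z b)) (v b)" using blk * by (simp add: is_block_def)
      ultimately show "b = b' \<and> r = r'"
        using * unfolding orthonormal_family_def by (metis zero_neq_one)
    qed
    show "(\<lambda>(b, r). v b r) ` (SIGMA b:\<C>. clock_index t c (z b)) = \<Union>\<C>"
    proof -
      have "(\<lambda>(b, r). v b r) ` (SIGMA b:\<C>. clock_index t c (z b)) = (\<Union>b\<in>\<C>. v b ` clock_index t c (z b))"
        by force
      also have "\<dots> = (\<Union>b\<in>\<C>. b)" by (rule SUP_cong) (use im in auto)
      finally show ?thesis by simp
    qed
  qed
  from onb_reindex[OF \<C>(4) this] blk \<C>(2) show ?thesis
    by (intro exI[of _ \<C>] exI[of _ z] exI[of _ \<theta>] exI[of _ v]) (auto simp: comp_def)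
qed

text \<open>On each block the central generator is a scalar, so a root \<open>y\<close> has
  multiplicity \<open>mu t c (unit_order y)\<close> times the number of blocks with
  \<open>z b = y\<close>. Numbering those blocks transports the basis to
  \<open>std_index p\<close>.\<close>

lemma canonical_form:
  fixes G :: "int \<Rightarrow> int ^ 'n \<Rightarrow> complex ^ 'm ^ 'm"
  assumes G: "is_rep G" and p: "p = charpoly (G 1 0)"
  shows "p \<in> admissible_polys t c CARD('m)"
    and "\<exists>w \<theta>. onb (std_index p) w \<and> (\<forall>k u. \<forall>(z, l, r)\<in>std_index p.
      G k u *v w (z, l, r) = phase z (\<theta> z l) k u r *s w (z, l, clock_shift z u r))"
proof -
  obtain \<C> :: "(complex ^ 'm) set set" and z \<theta> v where fin: "finite \<C>"
    and blk: "\<And>b. b \<in> \<C> \<Longrightarrow> is_block G (z b) (\<theta> b) (v b)"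
    and onb: "onb (SIGMA b:\<C>. clock_index t c (z b)) (\<lambda>(b, r). v b r)"
    using block_decomposition[OF G] by blast
  let ?D = "SIGMA b:\<C>. clock_index t c (z b)"
  have z: "is_root_of_unity (z b)" if "b \<in> \<C>" for b using blk[OF that] by (simp add: is_block_def)
  have act: "G k u *v v b r = phase (z b) (\<theta> b) k u r *s v b (clock_shift (z b) u r)"
    if "b \<in> \<C>" "r \<in> clock_index t c (z b)" for b r k u
    using blk[OF that(1)] that(2) by (simp add: is_block_def)
  have "p = (\<Prod>\<kappa>\<in>?D. [:- z (fst \<kappa>), 1:])"
    unfolding p by (rule charpoly_onb[OF onb]) (auto simp: act clock_shift_0 phase_def)
  then have p_eq: "p = (\<Prod>\<kappa>\<in>?D. [:- z (fst \<kappa>), 1:])" .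
  have finD: "finite ?D" using onb by (rule onb_D(1))
  have cardD: "card ?D = CARD('m)" using onb by (simp add: onb_iff_card)
  have order_p: "Polynomial.order y p = card {b\<in>\<C>. z b = y} * mu t c (unit_order y)" for y
  proof -
    have "Polynomial.order y p = card {\<kappa>\<in>?D. z (fst \<kappa>) = y}"
      unfolding p_eq by (rule order_prod_linear[OF finD])
    also have "{\<kappa>\<in>?D. z (fst \<kappa>) = y} = {b\<in>\<C>. z b = y} \<times> clock_index t c y" by auto
    finally show ?thesis by (simp add: card_cartesian_product card_clock_index)
  qed
  have p0: "p \<noteq> 0" unfolding p_eq using finD by simp
  have roots: "poly p y = 0 \<longleftrightarrow> (\<exists>b\<in>\<C>. z b = y)" for y
  proof -
    have "poly p y = 0 \<longleftrightarrow> (\<exists>\<kappa>\<in>?D. z (fst \<kappa>) = y)"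
      unfolding p_eq poly_prod using finD by (auto simp: prod_zero_iff)
    also have "\<dots> \<longleftrightarrow> (\<exists>b\<in>\<C>. z b = y)" using clock_shift_in[OF z] by fastforce
    finally show ?thesis .
  qed
  show "p \<in> admissible_polys t c CARD('m)"
    unfolding admissible_polys_def
  proof (intro CollectI conjI allI impI)
    show "lead_coeff p = 1" unfolding p_eq by (simp add: lead_coeff_prod)
    show "degree p = CARD('m)"
      unfolding p_eq by (subst degree_prod_sum_eq) (auto simp: cardD)
    show "\<exists>k\<ge>1. y ^ k = 1" if "poly p y = 0" for y
      using that z roots by (auto simp: is_root_of_unity_def)
    show "mu t c k dvd Polynomial.order y p" if "poly p y = 0 \<and> primitive_root_of_unity k y" for y k
      using that by (simp add: primitive_root_of_unity_iff order_p)
  qed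
  have "\<exists>h. bij_betw h {..<Polynomial.order y p div mu t c (unit_order y)} {b\<in>\<C>. z b = y}"
    if "poly p y = 0" for y
  proof -
    have "mu t c (unit_order y) > 0" using that roots z mu_unit_order_pos by auto
    then have "Polynomial.order y p div mu t c (unit_order y) = card {b\<in>\<C>. z b = y}"
      by (simp add: order_p)
    moreover have "finite {b\<in>\<C>. z b = y}" using fin by simp
    ultimately show ?thesis using ex_bij_betw_nat_finite by (metis lessThan_atLeast0)
  qed
  then obtain h where h: "\<And>y. poly p y = 0 \<Longrightarrow>
      bij_betw (h y) {..<Polynomial.order y p div mu t c (unit_order y)} {b\<in>\<C>. z b = y}"
    by metis
  define \<phi> where "\<phi> = (\<lambda>(y, l, r). (h y l, r :: nat \<Rightarrow> int))"
  have h_in: "h y l \<in> \<C>" "z (h y l) = y" if "(y, l, r) \<in> std_index p" for y l r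
    using that h[of y] by (auto simp: std_index_def bij_betw_def)
  have "bij_betw \<phi> (std_index p) ?D"
    unfolding bij_betw_def
  proof
    show "inj_on \<phi> (std_index p)"
    proof (rule inj_onI)
      fix \<kappa> \<kappa>' assume \<kappa>: "\<kappa> \<in> std_index p" "\<kappa>' \<in> std_index p" "\<phi> \<kappa> = \<phi> \<kappa>'"
      obtain y l r y' l' r' where eq: "\<kappa> = (y, l, r)" "\<kappa>' = (y', l', r')"
        by (cases \<kappa>, cases \<kappa>')
      note * = \<kappa>[unfolded eq]
      then have e: "h y l = h y' l'" "r = r'" by (auto simp: \<phi>_def)
      then have "y = y'" using h_in * by metis
      moreover have "l = l'" using h[of y] * e \<open>y = y'\<close> by (auto simp: std_index_def bij_betw_def inj_on_def)
      ultimately show "\<kappa> = \<kappa>'" using e by (simp add: eq)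
    qed
    show "\<phi> ` std_index p = ?D"
    proof
      show "\<phi> ` std_index p \<subseteq> ?D"
      proof (rule image_subsetI)
        fix \<kappa> assume \<kappa>: "\<kappa> \<in> std_index p"
        obtain y l r where i: "\<kappa> = (y, l, r)" by (cases \<kappa>)
        have "r \<in> clock_index t c y" using \<kappa> by (simp add: i std_index_def)
        then show "\<phi> \<kappa> \<in> ?D" using h_in[OF \<kappa>[unfolded i]] by (simp add: i \<phi>_def)
      qed
      show "?D \<subseteq> \<phi> ` std_index p"
      proof clarify
        fix b r assume b: "b \<in> \<C>" "r \<in> clock_index t c (z b)"
        have "poly p (z b) = 0" using b roots by auto
        then have "h (z b) ` {..<Polynomial.order (z b) p div mu t c (unit_order (z b))} = {b'\<in>\<C>. z b' = z b}"
          using h unfolding bij_betw_def by blast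
        moreover have "b \<in> {b'\<in>\<C>. z b' = z b}" using b by simp
        ultimately obtain l where "l < Polynomial.order (z b) p div mu t c (unit_order (z b))" "h (z b) l = b"
          by (metis (no_types, lifting) imageE lessThan_iff)
        then have "(z b, l, r) \<in> std_index p" "\<phi> (z b, l, r) = (b, r)"
          using b \<open>poly p (z b) = 0\<close> by (auto simp: std_index_def \<phi>_def)
        then show "(b, r) \<in> \<phi> ` std_index p" by (metis image_eqI)
      qed
    qed
  qed
  from onb_reindex[OF onb this] have "onb (std_index p) ((\<lambda>(b, r). v b r) \<circ> \<phi>)" .
  moreover have "G k u *v ((\<lambda>(b, r). v b r) \<circ> \<phi>) (y, l, r) =
      phase y (\<theta> (h y l)) k u r *s ((\<lambda>(b, r). v b r) \<circ> \<phi>) (y, l, clock_shift y u r)"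
    if "(y, l, r) \<in> std_index p" for k u y l r
    using act[OF h_in(1)[OF that], of r k u] h_in[OF that] that by (simp add: \<phi>_def std_index_def)
  ultimately show "\<exists>w \<theta>. onb (std_index p) w \<and> (\<forall>k u. \<forall>(z, l, r)\<in>std_index p.
      G k u *v w (z, l, r) = phase z (\<theta> z l) k u r *s w (z, l, clock_shift z u r))"
    by (intro exI[of _ "(\<lambda>(b, r). v b r) \<circ> \<phi>"] exI[of _ "\<lambda>y l. \<theta> (h y l)"]) auto
qed

context
  fixes p m assumes p: "p \<in> admissible_polys t c m"
begin

lemma std_index_root: "(z, l, r) \<in> std_index p \<Longrightarrow> is_root_of_unity z"
  using admissible_polysD(4)[OF p] by (auto simp: std_index_def)

lemma std_index_shift:
  "(z, l, r) \<in> std_index p \<Longrightarrow> (z, l, clock_shift z u r) \<in> std_index p"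
  using clock_shift_in[OF admissible_polysD(4)[OF p]] by (auto simp: std_index_def)

text \<open>The root \<open>z\<close> contributes its full multiplicity, since
  \<open>mu t c (unit_order z)\<close> divides it; the multiplicities add up to the degree.\<close>

lemma card_std_index: "finite (std_index p)" "card (std_index p) = m"
proof -
  have fin: "finite {z. poly p z = 0}" using admissible_polysD(1)[OF p] by (rule poly_roots_finite)
  then show "finite (std_index p)" by (auto simp: std_index_def finite_clock_index)
  have "card (std_index p) = (\<Sum>z | poly p z = 0. Polynomial.order z p)"
    unfolding std_index_def using fin admissible_polysD(5)[OF p]
    by (subst card_SigmaI) (auto simp: finite_clock_index card_cartesian_product card_clock_index)
  then show "card (std_index p) = m"
    using degree_eq_sum_order admissible_polysD(1,2)[OF p] by simp
qed

lemma bij_std_shift: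
  "bij_betw (\<lambda>(z, l, r). (z, l, clock_shift z u r)) (std_index p) (std_index p)"
  by (rule bij_betwI[where g = "\<lambda>(z, l, r). (z, l, clock_shift z (- u) r)"])
     (auto simp: std_index_def clock_shift_in admissible_polysD(4)[OF p] clock_shift_add clock_shift_0)

lemma model_apply:
  assumes "onb (std_index p) w" "(z, l, r) \<in> std_index p"
  shows "model p w \<theta> k u *v w (z, l, r) = phase z (\<theta> z l) k u r *s w (z, l, clock_shift z u r)"
  using basis_map_apply[OF assms] by (simp add: model_def)

text \<open>Serves both to prove multiplicativity of \<open>model\<close> and to identify the ends
  of a path.\<close>

lemma model_unique:
  assumes "onb (std_index p) w"
    and "\<And>z l r. (z, l, r) \<in> std_index p \<Longrightarrow>
      A *v w (z, l, r) = phase z (\<theta> z l) k u r *s w (z, l, clock_shift z u r)"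
  shows "A = model p w \<theta> k u"
  by (rule mat_eq_on_onb[OF assms(1)]) (auto simp: assms model_apply)

text \<open>Unitarity holds because a shift permutes the index set and phases have modulus 1;
  multiplicativity is \<open>phase_mult\<close> with \<open>clock_shift_add\<close>.\<close>

lemma model_rep:
  assumes w: "onb (std_index p) w"
  shows "is_rep (model p w \<theta>)"
  unfolding is_rep_def
proof (intro conjI allI)
  fix k u l v
  have "onb (std_index p) (\<lambda>(z, l, r). w (z, l, clock_shift z u r))"
    using onb_reindex[OF w bij_std_shift[of u]] by (simp add: comp_def case_prod_beta')
  then show "model p w \<theta> k u \<in> unitary_matrices"
    unfolding model_def by (intro basis_map_unitary w) (auto simp: phase_norm std_index_root)
  show "model p w \<theta> k u ** model p w \<theta> l v = model p w \<theta> (k + l + cocycle u v) (u + v)"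
  proof (rule model_unique[OF w])
    fix z j r assume i: "(z, j, r) \<in> std_index p"
    show "(model p w \<theta> k u ** model p w \<theta> l v) *v w (z, j, r) =
        phase z (\<theta> z j) (k + l + cocycle u v) (u + v) r *s w (z, j, clock_shift z (u + v) r)"
      using i by (simp add: model_apply[OF w] std_index_shift vec.scale clock_shift_add mult.commute
          flip: matrix_vector_mul_assoc phase_mult[OF std_index_root[OF i]])
  qed
qed

lemma charpoly_model:
  assumes w: "onb (std_index p) w"
  shows "charpoly (model p w \<theta> 1 0) = p"
proof -
  have fin: "finite {z. poly p z = 0}" using admissible_polysD(1)[OF p] by (rule poly_roots_finite)
  have "charpoly (model p w \<theta> 1 0) = (\<Prod>\<kappa>\<in>std_index p. [:- fst \<kappa>, 1:])"
  proof (rule charpoly_onb[OF w])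
    fix \<kappa> assume "\<kappa> \<in> std_index p"
    moreover obtain z l r where \<kappa>: "\<kappa> = (z, l, r)" by (cases \<kappa>)
    ultimately have i: "(z, l, r) \<in> std_index p" "r \<in> clock_index t c z" by (auto simp: std_index_def)
    show "model p w \<theta> 1 0 *v w \<kappa> = fst \<kappa> *s w \<kappa>"
      unfolding \<kappa> model_apply[OF w i(1)] by (simp add: phase_def clock_shift_0[OF i(2)])
  qed
  also have "\<dots> = (\<Prod>z | poly p z = 0. [:- z, 1:] ^
      card ({..<Polynomial.order z p div mu t c (unit_order z)} \<times> clock_index t c z))"
    unfolding std_index_def using fin
    by (subst prod.Sigma[symmetric, where g = "\<lambda>z _. [:- z, 1:]", unfolded case_prod_beta'])
       (auto simp: finite_clock_index prod_constant case_prod_beta')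
  also have "\<dots> = (\<Prod>z | poly p z = 0. [:- z, 1:] ^ Polynomial.order z p)"
    by (rule prod.cong) (use admissible_polysD(5)[OF p] in
      \<open>auto simp: card_cartesian_product card_clock_index\<close>)
  also have "\<dots> = p" using complex_poly_decompose[of p] admissible_polysD(3)[OF p] by simp
  finally show ?thesis .
qed

end

text \<open>The index set has \<open>CARD('m)\<close> elements, so the standard basis can be
  labelled by it; any characters will do.\<close>

lemma rep_exists:
  assumes p: "p \<in> admissible_polys t c CARD('m)"
  shows "\<exists>G :: int \<Rightarrow> int ^ 'n \<Rightarrow> complex ^ 'm ^ 'm. is_rep G \<and> charpoly (G 1 0) = p"
proof -
  obtain \<phi> where "bij_betw \<phi> (std_index p) (UNIV :: 'm set)"
    using finite_same_card_bij[of "std_index p" "UNIV :: 'm set"] card_std_index[OF p] by auto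
  from onb_reindex[OF onb_axis this] obtain w :: "_ \<Rightarrow> complex ^ 'm" where "onb (std_index p) w" by blast
  then show ?thesis using model_rep[OF p] charpoly_model[OF p] by blast
qed

text \<open>Bring both into canonical form. The unitary \<open>U\<close> carrying one basis to the
  other is joined to the identity by \<open>Q\<close>, while the angles of the characters are
  interpolated linearly; each intermediate \<open>model\<close> has the same characteristic
  polynomial \<open>p\<close>.\<close>

lemma rep_path:
  fixes G G' :: "int \<Rightarrow> int ^ 'n \<Rightarrow> complex ^ 'm ^ 'm"
  assumes G: "is_rep G" "charpoly (G 1 0) = p" and G': "is_rep G'" "charpoly (G' 1 0) = p"
  shows "\<exists>P :: real \<Rightarrow> _. P 0 = G \<and> P 1 = G' \<and> (\<forall>s. is_rep (P s) \<and> charpoly (P s 1 0) = p) \<and>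
    (\<forall>k u. continuous_on UNIV (\<lambda>s. P s k u))"
proof -
  have p: "p \<in> admissible_polys t c CARD('m)" using canonical_form(1)[OF G(1) G(2)[symmetric]] .
  obtain w \<theta> where w: "onb (std_index p) w" and Gw: "\<And>k u z l r. (z, l, r) \<in> std_index p \<Longrightarrow>
      G k u *v w (z, l, r) = phase z (\<theta> z l) k u r *s w (z, l, clock_shift z u r)"
    using canonical_form(2)[OF G(1) G(2)[symmetric]] by blast
  obtain w' \<theta>' where w': "onb (std_index p) w'" and Gw': "\<And>k u z l r. (z, l, r) \<in> std_index p \<Longrightarrow>
      G' k u *v w' (z, l, r) = phase z (\<theta>' z l) k u r *s w' (z, l, clock_shift z u r)"
    using canonical_form(2)[OF G'(1) G'(2)[symmetric]] by blast
  define U where "U = basis_map (std_index p) w (\<lambda>_. 1) w'"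
  have Uw: "U *v w \<kappa> = w' \<kappa>" if "\<kappa> \<in> std_index p" for \<kappa>
    using basis_map_apply[OF w that] by (simp add: U_def)
  have "U \<in> unitary_matrices" unfolding U_def by (intro basis_map_unitary w w') simp
  then obtain Q :: "real \<Rightarrow> _" where Q: "continuous_on UNIV Q" "range Q \<subseteq> unitary_matrices"
    "Q 0 = mat 1" "Q 1 = U"
    using unitary_path by blast
  define P where "P s = model p (\<lambda>\<kappa>. Q s *v w \<kappa>) (\<lambda>z l i. (1 - s) * \<theta> z l i + s * \<theta>' z l i)" for s
  have onbQ: "onb (std_index p) (\<lambda>\<kappa>. Q s *v w \<kappa>)" for s
    using Q(2) by (intro unitary_onb w) auto
  have "P 0 k u = G k u" for k u
  proof -
    have "P 0 k u = model p (\<lambda>\<kappa>. Q 0 *v w \<kappa>) \<theta> k u" by (simp add: P_def)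
    moreover have "G k u = model p (\<lambda>\<kappa>. Q 0 *v w \<kappa>) \<theta> k u"
      by (rule model_unique[OF p onbQ]) (simp add: Q(3) Gw)
    ultimately show ?thesis by simp
  qed
  moreover have "P 1 k u = G' k u" for k u
  proof -
    have "P 1 k u = model p (\<lambda>\<kappa>. Q 1 *v w \<kappa>) \<theta>' k u" by (simp add: P_def)
    moreover have "G' k u = model p (\<lambda>\<kappa>. Q 1 *v w \<kappa>) \<theta>' k u"
      by (rule model_unique[OF p onbQ]) (simp add: Q(4) Uw Gw' std_index_shift[OF p])
    ultimately show ?thesis by simp
  qed
  moreover have "is_rep (P s)" "charpoly (P s 1 0) = p" for s
    unfolding P_def by (intro model_rep[OF p] charpoly_model[OF p] onbQ)+
  moreover have "continuous_on UNIV (\<lambda>s. P s k u)" for k u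
  proof -
    have Qc: "continuous_on UNIV (\<lambda>s. Q s *v w \<kappa>)" for \<kappa>
      unfolding matrix_vector_mult_def by (intro continuous_intros continuous_on_vec_lambda Q(1))
    show ?thesis
      unfolding P_def model_def
      by (rule basis_map_continuous)
         (auto simp: case_prod_beta' phase_def character_def intro!: Qc continuous_intros)
  qed
  ultimately show ?thesis by (intro exI[of _ P]) (auto simp: fun_eq_iff)
qed

end

section \<open>Counting admissible polynomials\<close>

lemma pow_eq_1_iff_unit_order_dvd:
  assumes "n > 0"
  shows "z ^ n = 1 \<longleftrightarrow> is_root_of_unity z \<and> unit_order z dvd n"
proof (cases "is_root_of_unity z")
  case True
  then show ?thesis using powi_eq_1_iff[OF True, of "int n"] by simp
next
  case False
  then show ?thesis using assms unfolding is_root_of_unity_def by (metis Suc_leI One_nat_def)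
qed

text \<open>Sorting the \<open>n\<close> solutions of \<open>z ^ n = 1\<close> by order gives a sum
  over the divisors of \<open>n\<close>; strong induction compares it with
  \<open>totient_divisor_sum\<close>.\<close>

lemma card_unit_order_eq:
  assumes "n > 0"
  shows "card {z. is_root_of_unity z \<and> unit_order z = n} = totient n"
  using assms
proof (induction n rule: less_induct)
  case (less n)
  define R where "R d = {z. is_root_of_unity z \<and> unit_order z = d}" for d
  have fin: "finite (R d)" if "d > 0" for d
  proof (rule finite_subset)
    show "R d \<subseteq> {z. z ^ d = 1}" using that by (auto simp: R_def pow_eq_1_iff_unit_order_dvd)
    show "finite {z :: complex. z ^ d = 1}" using that by (intro finite_roots_unity) auto
  qed
  have fd: "finite {d. d dvd n}" using less.prems by simp
  have pos: "d > 0" if "d dvd n" for d using that less.prems by (auto intro: dvd_pos_nat)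
  have "{z. z ^ n = 1} = (\<Union>d\<in>{d. d dvd n}. R d)"
    using less.prems by (auto simp: R_def pow_eq_1_iff_unit_order_dvd)
  then have "n = card (\<Union>d\<in>{d. d dvd n}. R d)" using card_roots_unity_eq[OF less.prems] by simp
  also have "\<dots> = (\<Sum>d | d dvd n. card (R d))"
    using fd fin pos by (subst card_UN_disjoint) (auto simp: R_def)
  also have "\<dots> = card (R n) + (\<Sum>d\<in>{d. d dvd n} - {n}. card (R d))"
    using fd by (subst sum.remove[of _ n]) auto
  also have "(\<Sum>d\<in>{d. d dvd n} - {n}. card (R d)) = (\<Sum>d\<in>{d. d dvd n} - {n}. totient d)"
  proof (rule sum.cong)
    fix d assume "d \<in> {d. d dvd n} - {n}"
    then have d: "d dvd n" "d \<noteq> n" by auto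
    then have "d < n" "d > 0" using dvd_imp_le[OF d(1) less.prems] pos[OF d(1)] by simp_all
    then show "card (R d) = totient d" using less.IH by (simp add: R_def)
  qed simp
  finally have "n = card (R n) + (\<Sum>d\<in>{d. d dvd n} - {n}. totient d)" .
  moreover have "n = totient n + (\<Sum>d\<in>{d. d dvd n} - {n}. totient d)"
    using fd by (subst (1) totient_divisor_sum[symmetric], subst sum.remove[of _ n]) auto
  ultimately show ?case by (simp add: R_def)
qed

text \<open>The root set \<open>S\<close> is a parameter to allow induction on it. The divisibility
  condition ranges over all \<open>z\<close>: off the roots the multiplicity is 0, so it holds there
  whatever \<open>unit_order z\<close> is.\<close>

definition polys_on :: "nat \<Rightarrow> (nat \<Rightarrow> nat) \<Rightarrow> complex set \<Rightarrow> nat \<Rightarrow> complex poly set" where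
  "polys_on t c S n = {p. lead_coeff p = 1 \<and> degree p = n \<and> (\<forall>z. poly p z = 0 \<longrightarrow> z \<in> S) \<and>
     (\<forall>z. mu t c (unit_order z) dvd Polynomial.order z p)}"

lemma admissible_polys_eq: "admissible_polys t c n = polys_on t c {z. is_root_of_unity z} n"
proof
  show "admissible_polys t c n \<subseteq> polys_on t c {z. is_root_of_unity z} n"
  proof
    fix p assume "p \<in> admissible_polys t c n"
    note * = admissible_polysD[OF this]
    have "mu t c (unit_order z) dvd Polynomial.order z p" for z
      using *(5)[of z] *(1) by (cases "poly p z = 0") (auto simp: order_0I)
    then show "p \<in> polys_on t c {z. is_root_of_unity z} n" using * by (simp add: polys_on_def)
  qed
  show "polys_on t c {z. is_root_of_unity z} n \<subseteq> admissible_polys t c n"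
    unfolding polys_on_def admissible_polys_def primitive_root_of_unity_iff
    by (auto simp: is_root_of_unity_def)
qed

lemma polys_on_empty: "polys_on t c {} n = (if n = 0 then {1} else {})"
proof -
  have "p = 1" if "p \<in> polys_on t c {} n" for p
  proof -
    have "constant (poly p)" using that fundamental_theorem_of_algebra[of p] by (auto simp: polys_on_def)
    then have "degree p = 0" by (simp add: constant_degree)
    then obtain a where "p = [:a:]" by (rule degree_eq_zeroE)
    then show ?thesis using that by (simp add: polys_on_def one_pCons)
  qed
  moreover have "1 \<in> polys_on t c {} n \<longleftrightarrow> n = 0" by (auto simp: polys_on_def)
  ultimately show ?thesis by auto
qed

lemma order_linear_power_mult:
  fixes p :: "complex poly"
  assumes "p \<noteq> 0"
  shows "Polynomial.order y ([:-z, 1:] ^ k * p) = (if y = z then k else 0) + Polynomial.order y p"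
proof -
  have o: "Polynomial.order y ([:-z, 1:] ^ k) = (if y = z then k else 0)"
    by (auto simp: order_power_n_n intro!: order_0I)
  have nz: "[:-z, 1:] ^ k * p \<noteq> 0" using assms by simp
  show ?thesis by (simp only: order_mult[OF nz] o)
qed

text \<open>Either \<open>z\<close> is not a root, or its multiplicity is a positive multiple of
  \<open>k\<close> and one factor \<open>(X - z) ^ k\<close> splits off; the quotient may still
  vanish at \<open>z\<close>, so its root set stays \<open>insert z S\<close>.\<close>

lemma polys_on_insert:
  assumes z: "is_root_of_unity z" and k_def: "k = mu t c (unit_order z)"
  shows "polys_on t c (insert z S) n = polys_on t c S n \<union>
    (if k \<le> n then (\<lambda>p. [:-z, 1:] ^ k * p) ` polys_on t c (insert z S) (n - k) else {})"
    (is "?L = ?R")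
proof
  have k: "k > 0" unfolding k_def by (rule mu_unit_order_pos[OF z])
  show "?L \<subseteq> ?R"
  proof
    fix p assume p: "p \<in> ?L"
    then have p0: "p \<noteq> 0" by (auto simp: polys_on_def)
    show "p \<in> ?R"
    proof (cases "poly p z = 0")
      case False
      then have "p \<in> polys_on t c S n" using p by (auto simp: polys_on_def)
      then show ?thesis by blast
    next
      case True
      then have "Polynomial.order z p > 0" using p0 by (simp add: order_root)
      moreover have "k dvd Polynomial.order z p" using p by (simp add: polys_on_def k_def)
      ultimately have "k \<le> Polynomial.order z p" by (simp add: dvd_imp_le)
      then obtain q where q: "p = [:-z, 1:] ^ k * q" by (meson dvdE le_imp_power_dvd dvd_trans order_1)
      have q0: "q \<noteq> 0" using p0 q by auto
      have "degree p = k + degree q"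
        unfolding q using q0 by (simp add: degree_mult_eq degree_linear_power)
      then have deg: "k \<le> n" "degree q = n - k" using p by (auto simp: polys_on_def)
      have "mu t c (unit_order y) dvd Polynomial.order y q" for y
      proof -
        have "mu t c (unit_order y) dvd Polynomial.order y p" using p by (simp add: polys_on_def)
        then have "mu t c (unit_order y) dvd (if y = z then k else 0) + Polynomial.order y q"
          by (simp only: q order_linear_power_mult[OF q0])
        then show ?thesis by (cases "y = z") (auto simp: k_def dvd_add_right_iff)
      qed
      moreover have "lead_coeff q = 1"
        using p by (simp add: polys_on_def q lead_coeff_mult lead_coeff_power)
      moreover have "y \<in> insert z S" if "poly q y = 0" for y
        using p that by (auto simp: polys_on_def q)
      ultimately have "q \<in> polys_on t c (insert z S) (n - k)" using deg by (simp add: polys_on_def)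
      then show ?thesis using q deg by auto
    qed
  qed
  have "[:-z, 1:] ^ k * p \<in> ?L" if p: "p \<in> polys_on t c (insert z S) (n - k)" and "k \<le> n" for p
  proof -
    have p0: "p \<noteq> 0" using p by (auto simp: polys_on_def)
    have "degree ([:-z, 1:] ^ k * p) = n"
      using p p0 \<open>k \<le> n\<close> by (simp add: degree_mult_eq degree_linear_power polys_on_def)
    moreover have "lead_coeff p = 1" using p unfolding polys_on_def by blast
    then have "lead_coeff ([:-z, 1:] ^ k * p) = 1"
      by (simp only: lead_coeff_mult lead_coeff_power) simp
    moreover have "mu t c (unit_order y) dvd Polynomial.order y ([:-z, 1:] ^ k * p)" for y
      unfolding order_linear_power_mult[OF p0] using p by (auto simp: polys_on_def k_def)
    moreover have "y \<in> insert z S" if "poly ([:-z, 1:] ^ k * p) y = 0" for y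
      using p that by (auto simp: polys_on_def poly_power)
    ultimately show ?thesis by (simp add: polys_on_def)
  qed
  then show "?R \<subseteq> ?L" by (auto simp: polys_on_def split: if_splits)
qed

text \<open>Nested induction on \<open>S\<close> and on the degree, which drops by a positive amount
  in the recursion.\<close>

lemma finite_polys_on:
  assumes "finite S" "\<And>z. z \<in> S \<Longrightarrow> is_root_of_unity z"
  shows "finite (polys_on t c S n)"
  using assms
proof (induction S arbitrary: n rule: finite_induct)
  case (insert z S)
  show ?case
  proof (induction n rule: less_induct)
    case (less n)
    have "mu t c (unit_order z) > 0" using insert.prems by (intro mu_unit_order_pos) auto
    then show ?case
      using less insert by (subst polys_on_insert[OF _ refl]) auto
  qed
qed (simp add: polys_on_empty)

section \<open>Generating functions\<close>

definition polys_fps :: "nat \<Rightarrow> (nat \<Rightarrow> nat) \<Rightarrow> complex set \<Rightarrow> rat fps" where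
  "polys_fps t c S = Abs_fps (\<lambda>n. of_nat (card (polys_on t c S n)))"

text \<open>The recursion \<open>polys_on_insert\<close> read on coefficients: its union is disjoint
  because polynomials on \<open>S\<close> do not vanish at \<open>z\<close>, and multiplication by
  \<open>(X - z) ^ k\<close> is injective.\<close>

lemma polys_fps_insert:
  assumes S: "finite S" "z \<notin> S" "\<And>y. y \<in> insert z S \<Longrightarrow> is_root_of_unity y"
  shows "(1 - fps_X ^ mu t c (unit_order z)) * polys_fps t c (insert z S) = polys_fps t c S"
proof -
  define k where "k = mu t c (unit_order z)"
  have z: "is_root_of_unity z" using S by auto
  have k: "k > 0" unfolding k_def by (rule mu_unit_order_pos[OF z])
  have *: "of_nat (card (polys_on t c (insert z S) n)) - (if n < k then 0 else of_nat (card (polys_on t c (insert z S) (n - k))))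
      = (of_nat (card (polys_on t c S n)) :: rat)" for n
  proof (cases "n < k")
    case True
    then show ?thesis by (subst polys_on_insert[OF z k_def]) simp
  next
    case False
    let ?I = "(\<lambda>p. [:-z, 1:] ^ k * p) ` polys_on t c (insert z S) (n - k)"
    have eq: "polys_on t c (insert z S) n = polys_on t c S n \<union> ?I"
      using False by (subst polys_on_insert[OF z k_def]) simp
    have "polys_on t c S n \<inter> ?I = {}"
      using k S(2) by (auto simp: polys_on_def poly_power)
    moreover have "card ?I = card (polys_on t c (insert z S) (n - k))"
      by (rule card_image) (simp add: inj_on_def)
    moreover have "finite (polys_on t c S n)" "finite ?I"
      using S by (auto intro!: finite_polys_on)
    ultimately have "card (polys_on t c (insert z S) n) =
        card (polys_on t c S n) + card (polys_on t c (insert z S) (n - k))"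
      unfolding eq by (simp add: card_Un_disjoint)
    then show ?thesis using False by simp
  qed
  show ?thesis
  proof (rule fps_ext)
    show "fps_nth ((1 - fps_X ^ mu t c (unit_order z)) * polys_fps t c (insert z S)) n =
        fps_nth (polys_fps t c S) n" for n
      using *[of n] by (cases "n < k") (simp_all add: polys_fps_def left_diff_distrib fps_X_power_mult_nth flip: k_def)
  qed
qed

lemma polys_fps_prod:
  assumes "finite S" "\<And>y. y \<in> S \<Longrightarrow> is_root_of_unity y"
  shows "(\<Prod>z\<in>S. 1 - fps_X ^ mu t c (unit_order z)) * polys_fps t c S = 1"
  using assms
proof (induction S rule: finite_induct)
  case empty
  then show ?case by (simp add: polys_fps_def polys_on_empty fps_eq_iff)
next
  case (insert z S)
  have "(\<Prod>z\<in>insert z S. 1 - fps_X ^ mu t c (unit_order z)) * polys_fps t c (insert z S) =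
      (\<Prod>z\<in>S. 1 - fps_X ^ mu t c (unit_order z)) *
      ((1 - fps_X ^ mu t c (unit_order z)) * polys_fps t c (insert z S))"
    using insert by (simp add: mult_ac)
  also have "(1 - fps_X ^ mu t c (unit_order z)) * polys_fps t c (insert z S) = polys_fps t c S"
    by (rule polys_fps_insert) (use insert in auto)
  also have "(\<Prod>z\<in>S. 1 - fps_X ^ mu t c (unit_order z)) * polys_fps t c S = 1"
    by (rule insert.IH) (use insert in auto)
  finally show ?case .
qed

text \<open>Cutting off by order leaves finitely many roots, matching the partial products over
  \<open>j < K\<close>.\<close>

definition roots_upto :: "nat \<Rightarrow> complex set" where
  "roots_upto K = {z. is_root_of_unity z \<and> unit_order z \<le> K}"

lemma finite_roots_upto: "finite (roots_upto K)"
proof (rule finite_subset)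
  show "roots_upto K \<subseteq> (\<Union>k\<in>{1..K}. {z. z ^ k = 1})"
  proof
    fix z assume "z \<in> roots_upto K"
    then have "unit_order z \<in> {1..K}" "z ^ unit_order z = 1"
      using unit_order_props[of z] by (auto simp: roots_upto_def)
    then show "z \<in> (\<Union>k\<in>{1..K}. {z. z ^ k = 1})" by blast
  qed
qed (auto intro!: finite_roots_unity)

text \<open>Both sides are inverse to the same product: there are \<open>totient k\<close> roots of
  unity of order \<open>k\<close>, so grouping the factors by order produces these powers. The order
  \<open>k\<close> corresponds to the index \<open>j = k - 1\<close>.\<close>

lemma prod_gen_factor_eq: "(\<Prod>j<K. gen_factor t c j) = polys_fps t c (roots_upto K)"
proof -
  define f where "f k = (1 - fps_X ^ mu t c k :: rat fps)" for k
  have "(\<Prod>z\<in>roots_upto K. f (unit_order z)) = (\<Prod>k\<in>{1..K}. \<Prod>z | z \<in> roots_upto K \<and> unit_order z = k. f (unit_order z))"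
  proof (rule prod.group[symmetric])
    show "unit_order ` roots_upto K \<subseteq> {1..K}" using unit_order_props by (auto simp: roots_upto_def)
  qed (simp_all add: finite_roots_upto)
  also have "\<dots> = (\<Prod>k\<in>{1..K}. f k ^ totient k)"
  proof (rule prod.cong)
    fix k assume k: "k \<in> {1..K}"
    then have "{z. z \<in> roots_upto K \<and> unit_order z = k} = {z. is_root_of_unity z \<and> unit_order z = k}"
      by (auto simp: roots_upto_def)
    then show "(\<Prod>z | z \<in> roots_upto K \<and> unit_order z = k. f (unit_order z)) = f k ^ totient k"
      using card_unit_order_eq[of k] k by simp
  qed simp
  also have "\<dots> = (\<Prod>j<K. f (Suc j) ^ totient (Suc j))"
    by (rule prod.reindex_bij_witness[of _ Suc "\<lambda>k. k - 1"]) auto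
  finally have eq: "(\<Prod>z\<in>roots_upto K. f (unit_order z)) = (\<Prod>j<K. f (Suc j) ^ totient (Suc j))" .
  have "gen_factor t c j * f (Suc j) ^ totient (Suc j) = 1" for j
  proof -
    have "fps_nth (f (Suc j) ^ totient (Suc j)) 0 \<noteq> 0"
      using mu_pos[of "Suc j" t c] by (simp add: f_def fps_power_zeroth power_0_left)
    then show ?thesis
      by (simp add: gen_factor_def Let_def f_def fps_divide_unit inverse_mult_eq_1)
  qed
  then have 1: "(\<Prod>j<K. gen_factor t c j) * (\<Prod>j<K. f (Suc j) ^ totient (Suc j)) = 1"
    by (simp flip: prod.distrib)
  have 2: "(\<Prod>j<K. f (Suc j) ^ totient (Suc j)) * polys_fps t c (roots_upto K) = 1"
    using polys_fps_prod[OF finite_roots_upto, of K t c] eq by (simp add: f_def roots_upto_def)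
  have "(\<Prod>j<K. gen_factor t c j) = (\<Prod>j<K. gen_factor t c j) *
      ((\<Prod>j<K. f (Suc j) ^ totient (Suc j)) * polys_fps t c (roots_upto K))"
    by (simp only: 2 mult_1_right)
  also have "\<dots> = polys_fps t c (roots_upto K)"
    by (simp only: 1 mult_1 flip: mult.assoc)
  finally show ?thesis .
qed

text \<open>\<open>k\<close> is \<open>gcd k (c 1)\<close> times the first factor of
  \<open>mu t c k\<close>. Thus for \<open>c 1 > 0\<close> a bound on \<open>mu t c k\<close> bounds
  \<open>k\<close>.\<close>

lemma le_mult_mu:
  assumes "1 \<le> t" "k \<ge> 1"
  shows "k \<le> c 1 * mu t c k \<or> c 1 = 0"
proof (cases "c 1 = 0")
  case False
  let ?q = "\<lambda>i. k div gcd k (c i)"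
  have "?q 1 dvd mu t c k" unfolding mu_def using assms(1) by (intro dvd_prodI) auto
  then have "?q 1 \<le> mu t c k" using mu_pos[OF assms(2), of t c] by (rule dvd_imp_le)
  have "k = gcd k (c 1) * ?q 1" by simp
  also have "\<dots> \<le> c 1 * mu t c k"
    using False \<open>?q 1 \<le> mu t c k\<close> by (intro mult_le_mono) (auto intro: dvd_imp_le)
  finally show ?thesis by simp
qed simp

text \<open>A root of order \<open>k\<close> has multiplicity at least \<open>mu t c k\<close>,
  which is therefore at most the degree \<open>n\<close>; by \<open>le_mult_mu\<close> this bounds
  \<open>k\<close> by \<open>c 1 * n\<close>.\<close>

lemma admissible_polys_eq_roots_upto:
  assumes "1 \<le> t" "c 1 > 0" "K \<ge> c 1 * n"
  shows "admissible_polys t c n = polys_on t c (roots_upto K) n"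
proof
  show "admissible_polys t c n \<subseteq> polys_on t c (roots_upto K) n"
  proof
    fix p assume p: "p \<in> admissible_polys t c n"
    note * = admissible_polysD[OF p]
    have "z \<in> roots_upto K" if "poly p z = 0" for z
    proof -
      have z: "is_root_of_unity z" using *(4) that .
      have "Polynomial.order z p > 0" using that *(1) by (simp add: order_root)
      then have "mu t c (unit_order z) \<le> Polynomial.order z p" using *(5)[OF that] by (simp add: dvd_imp_le)
      also have "\<dots> \<le> n" using order_degree[OF *(1)] *(2) by simp
      finally have "c 1 * mu t c (unit_order z) \<le> c 1 * n" by (rule mult_le_mono2)
      moreover have "unit_order z \<le> c 1 * mu t c (unit_order z)"
        using le_mult_mu[OF assms(1) unit_order_props(1)[OF z], of c] assms(2) by auto
      ultimately have "unit_order z \<le> K" using assms(3) by linarith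
      then show ?thesis using z by (simp add: roots_upto_def)
    qed
    then show "p \<in> polys_on t c (roots_upto K) n" using p by (auto simp: admissible_polys_eq polys_on_def)
  qed
qed (auto simp: admissible_polys_eq polys_on_def roots_upto_def)

lemma finite_admissible_polys:
  assumes "1 \<le> t" "c 1 > 0"
  shows "finite (admissible_polys t c n)"
  unfolding admissible_polys_eq_roots_upto[where c = c and n = n and K = "c 1 * n", OF assms order_refl]
  by (intro finite_polys_on finite_roots_upto) (simp add: roots_upto_def)

text \<open>The coefficient of index \<open>n\<close> no longer changes in the partial products once
  \<open>K\<close> reaches \<open>c 1 * n\<close>.\<close>

lemma gen_factor_has_prod:
  assumes "1 \<le> t" "c 1 > 0"
  shows "gen_factor t c has_prod Abs_fps (\<lambda>n. of_nat (card (admissible_polys t c n)))"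
proof -
  let ?L = "Abs_fps (\<lambda>n. of_nat (card (admissible_polys t c n))) :: rat fps"
  have "(\<lambda>K. \<Prod>j\<le>K. gen_factor t c j) \<longlonglongrightarrow> ?L"
  proof (rule tendsto_fpsI)
    fix n
    have "eventually (\<lambda>K. K \<ge> c 1 * n) sequentially" by (rule eventually_ge_at_top)
    then show "eventually (\<lambda>K. fps_nth (\<Prod>j\<le>K. gen_factor t c j) n = fps_nth ?L n) sequentially"
    proof eventually_elim
      case (elim K)
      \<comment> \<open>Convergence is stated with products up to and including \<open>K\<close>,
        hence the shift to \<open>Suc K\<close>.\<close>
      then have "c 1 * n \<le> Suc K" by simp
      moreover have "(\<Prod>j\<le>K. gen_factor t c j) = polys_fps t c (roots_upto (Suc K))"
        by (simp only: prod_gen_factor_eq lessThan_Suc_atMost[symmetric])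
      ultimately show ?case
        using admissible_polys_eq_roots_upto[where c = c, OF assms] by (simp add: polys_fps_def)
    qed
  qed
  \<comment> \<open>\<open>has_prod\<close> demands a nonzero limit; the constant coefficient counts
    only the polynomial 1.\<close>
  moreover have "fps_nth ?L 0 = 1"
  proof -
    have "roots_upto 0 = {}" using unit_order_props(1) by (force simp: roots_upto_def)
    then have "admissible_polys t c 0 = {1}"
      using admissible_polys_eq_roots_upto[where c = c and n = 0 and K = 0, OF assms]
      by (simp add: polys_on_empty)
    then show ?thesis by simp
  qed
  then have "?L \<noteq> 0" by (metis fps_zero_nth zero_neq_one)
  ultimately show ?thesis by (simp add: has_prod_def raw_has_prod_def)
qed

section \<open>Topology of the representation space\<close>

text \<open>A connected component meeting a clopen set lies in it, and a connected set lies in the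
  component of each of its points.\<close>

lemma connected_components_of_clopen_partition:
  assumes cover: "topspace X = (\<Union>i\<in>I. A i)" and disj: "disjoint_family_on A I"
    and ne: "\<And>i. i \<in> I \<Longrightarrow> A i \<noteq> {}" and conn: "\<And>i. i \<in> I \<Longrightarrow> connectedin X (A i)"
    and clopen: "\<And>i. i \<in> I \<Longrightarrow> openin X (A i)" "\<And>i. i \<in> I \<Longrightarrow> closedin X (A i)"
  shows "connected_components_of X = A ` I"
proof -
  have comp: "connected_component_of_set X x = A i" if "i \<in> I" "x \<in> A i" for i x
  proof
    show "A i \<subseteq> connected_component_of_set X x"
      using conn that by (intro connected_component_of_maximal)
    have "x \<in> connected_component_of_set X x"
      using that cover by (auto simp: connected_component_of_refl)
    then show "connected_component_of_set X x \<subseteq> A i"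
      using connectedin_clopen_cases[OF connectedin_connected_component_of clopen(2,1)] that
      by (metis disjnt_iff)
  qed
  show ?thesis
  proof
    show "connected_components_of X \<subseteq> A ` I"
      unfolding connected_components_of_def using comp cover by auto
    show "A ` I \<subseteq> connected_components_of X"
    proof
      fix C assume "C \<in> A ` I"
      then obtain i x where "i \<in> I" "C = A i" "x \<in> A i" using ne by blast
      then show "C \<in> connected_components_of X"
        unfolding connected_components_of_def using comp[of i x] cover by blast
    qed
  qed
qed

lemma continuous_on_det_mat_diff: "continuous_on UNIV (\<lambda>A :: complex ^ 'm ^ 'm. det (mat z - A))"
  unfolding det_def by (intro continuous_intros)

lemma hom_U_unitary: "f \<in> Hom_U \<Gamma> \<Longrightarrow> g \<in> carrier \<Gamma> \<Longrightarrow> f g \<in> unitary_matrices"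
  by (auto simp: Hom_U_def hom_def unitary_group_def)

lemma hom_U_mult:
  "f \<in> Hom_U \<Gamma> \<Longrightarrow> g \<in> carrier \<Gamma> \<Longrightarrow> h \<in> carrier \<Gamma> \<Longrightarrow> f (g \<otimes>\<^bsub>\<Gamma>\<^esub> h) = f g ** f h"
  by (auto simp: Hom_U_def hom_def unitary_group_def)

lemma topspace_Hom_U_topology:
  assumes "x \<in> carrier \<Gamma>" "\<And>i. i \<in> {1..n} \<Longrightarrow> a i \<in> carrier \<Gamma>"
  shows "topspace (Hom_U_topology \<Gamma> n x a) = Hom_U \<Gamma>"
  using assms by (fastforce simp: Hom_U_topology_def topspace_pullback_topology intro: hom_U_unitary)

lemma continuous_map_Hom_U_eval:
  "continuous_map (Hom_U_topology \<Gamma> n x a :: ('g \<Rightarrow> complex ^ 'm ^ 'm) topology) euclidean (\<lambda>f. f x)"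
  (is "continuous_map ?X _ _")
proof -
  have "continuous_map ?X (top_of_set unitary_matrices)
      ((\<lambda>h. h 0) \<circ> (\<lambda>f. \<lambda>i\<in>{0..n}. if i = 0 then f x else f (a i)))"
    unfolding Hom_U_topology_def
    by (intro continuous_map_pullback continuous_map_product_projection) simp
  then show ?thesis by (simp add: comp_def continuous_map_in_subtopology)
qed

text \<open>Equality of characteristic polynomials is tested at all points \<open>z\<close>, each
  test being a closed condition since \<open>det (mat z - f x)\<close> is continuous in
  \<open>f\<close>.\<close>

lemma closedin_Hom_U_charpoly:
  assumes "x \<in> carrier \<Gamma>" "\<And>i. i \<in> {1..n} \<Longrightarrow> a i \<in> carrier \<Gamma>"
  shows "closedin (Hom_U_topology \<Gamma> n x a :: ('g \<Rightarrow> complex ^ 'm ^ 'm) topology) (Hom_U_charpoly \<Gamma> x p)"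
proof -
  let ?X = "Hom_U_topology \<Gamma> n x a :: ('g \<Rightarrow> complex ^ 'm ^ 'm) topology"
  have "Hom_U_charpoly \<Gamma> x p = (\<Inter>z. {f \<in> topspace ?X. det (mat z - f x) \<in> {poly p z}})"
    using topspace_Hom_U_topology[of x \<Gamma> n a, OF assms]
    by (auto simp: Hom_U_charpoly_def poly_charpoly fun_eq_iff simp flip: poly_eq_poly_eq_iff)
  moreover have "closedin ?X {f \<in> topspace ?X. det (mat z - f x) \<in> {poly p z}}" for z
  proof (rule closedin_continuous_map_preimage)
    have "continuous_map ?X euclidean ((\<lambda>A. det (mat z - A)) \<circ> (\<lambda>f. f x))"
      using continuous_on_det_mat_diff by (intro continuous_map_compose[OF continuous_map_Hom_U_eval]) simp
    then show "continuous_map ?X euclidean (\<lambda>f. det (mat z - f x))" by (simp add: comp_def)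
  qed simp
  ultimately show ?thesis by (auto intro!: closedin_INT)
qed

lemma pathin_Hom_U_topology:
  assumes "x \<in> carrier \<Gamma>" "\<And>i. i \<in> {1..n} \<Longrightarrow> a i \<in> carrier \<Gamma>"
    and F: "\<And>s. F s \<in> Hom_U \<Gamma>" and cont: "\<And>g. g \<in> carrier \<Gamma> \<Longrightarrow> continuous_on UNIV (\<lambda>s. F s g)"
  shows "pathin (Hom_U_topology \<Gamma> n x a) F"
  unfolding pathin_def Hom_U_topology_def
proof (rule continuous_map_pullback')
  have "continuous_map (top_of_set {0..1}) (top_of_set unitary_matrices)
      (\<lambda>s. if i = 0 then F s x else F s (a i))" if "i \<in> {0..n}" for i
    using that assms(1,2) hom_U_unitary[OF F] continuous_on_subset[OF cont subset_UNIV]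
    by (cases "i = 0") (auto simp: continuous_map_in_subtopology)
  then show "continuous_map (top_of_set {0..1}) (product_topology (\<lambda>_. top_of_set unitary_matrices) {0..n})
      ((\<lambda>f. \<lambda>i\<in>{0..n}. if i = 0 then f x else f (a i)) \<circ> F)"
    unfolding continuous_map_componentwise by (auto simp: comp_def)
qed (use F in auto)

section \<open>Normal form in the central extension\<close>

lemma Zn_basis_heisenberg_data:
  fixes e :: "nat \<Rightarrow> int ^ 'n"
  assumes basis: "Zn_basis e" and t: "1 \<le> t" "2 * t \<le> CARD('n)"
    and c_pos: "\<And>i. i \<in> {1..t} \<Longrightarrow> c i > 0"
  shows "heisenberg_data (dual_basis e) e CARD('n) t c"
proof -
  let ?N = "{1..CARD('n)}"
  interpret M: module "\<lambda>(k :: int) (v :: int ^ 'n). k *s v"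
    by unfold_locales (simp_all add: vec_eq_iff algebra_simps)
  have inj: "inj_on e ?N" and ind: "M.independent (e ` ?N)" and span: "M.span (e ` ?N) = UNIV"
    using basis by (auto simp: Zn_basis_def)
  show ?thesis
  proof
    show "dual_basis e l (u + v) = dual_basis e l u + dual_basis e l v" for l u v
      using M.representation_add[OF ind, of v u] unfolding dual_basis_def span by (simp add: add.commute)
    show "dual_basis e l (e l') = (if l = l' then 1 else 0)" if "l \<in> ?N" "l' \<in> ?N" for l l'
    proof -
      have "M.representation (e ` ?N) (e l') = (\<lambda>v. if v = e l' then 1 else 0)"
        using that by (intro M.representation_basis[OF ind]) auto
      then have "dual_basis e l (e l') = (if e l = e l' then 1 else 0)"
        by (simp only: dual_basis_def)
      then show ?thesis using inj_on_eq_iff[OF inj that] by (simp only:)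
    qed
    show "u = (\<Sum>l = 1..CARD('n). dual_basis e l u *s e l)" for u
    proof -
      have "u = (\<Sum>b\<in>e ` ?N. M.representation (e ` ?N) u b *s b)"
        using M.sum_representation_eq[OF ind, of u "e ` ?N"] unfolding span by simp
      then show ?thesis unfolding dual_basis_def by (subst (asm) sum.reindex[OF inj]) simp
    qed
  qed (use t c_pos in auto)
qed

text \<open>Take a section \<open>s\<close> with factor set exactly \<open>f\<close> and let
  \<open>nf k u\<close> be the product of \<open>\<iota> k\<close> and \<open>s u\<close>. The
  condition \<open>f 0 0 = 0\<close> forces \<open>s 0\<close> to be the unit, which places
  \<open>\<iota> 1\<close> at \<open>(1, 0)\<close>.\<close>

lemma central_extension_normal_form:
  fixes \<Gamma> :: "('g, 'b) monoid_scheme" and \<pi> :: "'g \<Rightarrow> int ^ 'n"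
  assumes ext: "central_extension \<Gamma> \<iota> \<pi>" and f: "f \<in> k_invariant \<Gamma> \<iota> \<pi>" "f 0 0 = 0"
  shows "\<exists>nf. bij_betw (\<lambda>(k, u). nf k u) UNIV (carrier \<Gamma>) \<and>
    (\<forall>k u l v. nf k u \<otimes>\<^bsub>\<Gamma>\<^esub> nf l v = nf (k + l + f u v) (u + v)) \<and> \<iota> 1 = nf 1 0"
proof -
  interpret group \<Gamma> using ext by (simp add: central_extension_def)
  have \<iota>: "\<iota> \<in> mon integer_group \<Gamma>" and \<pi>: "\<pi> \<in> epi \<Gamma> Zn_group"
    and exact: "kernel \<Gamma> Zn_group \<pi> = range \<iota>"
    using ext by (simp_all add: central_extension_def)
  have cen: "\<iota> k \<otimes>\<^bsub>\<Gamma>\<^esub> g = g \<otimes>\<^bsub>\<Gamma>\<^esub> \<iota> k" if "g \<in> carrier \<Gamma>" for k g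
    using ext that by (simp add: central_extension_def)
  have icl [simp]: "\<iota> k \<in> carrier \<Gamma>" for k
    using \<iota> by (auto simp: mon_def hom_def integer_group_def)
  have iadd: "\<iota> k \<otimes>\<^bsub>\<Gamma>\<^esub> \<iota> l = \<iota> (k + l)" for k l
    using \<iota> by (auto simp: mon_def hom_def integer_group_def)
  have iinj: "\<iota> k = \<iota> l \<longleftrightarrow> k = l" for k l
    using \<iota> by (auto simp: mon_def inj_on_def integer_group_def)
  have pmul: "\<pi> (g \<otimes>\<^bsub>\<Gamma>\<^esub> h) = \<pi> g + \<pi> h" if "g \<in> carrier \<Gamma>" "h \<in> carrier \<Gamma>" for g h
    using \<pi> that by (auto simp: epi_def hom_def Zn_group_def)
  have ker: "\<exists>k. g = \<iota> k" if "g \<in> carrier \<Gamma>" "\<pi> g = 0" for g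
    using exact that by (auto simp: kernel_def Zn_group_def)
  have p\<iota>: "\<pi> (\<iota> k) = 0" for k
  proof -
    have "\<iota> k \<in> kernel \<Gamma> Zn_group \<pi>" using exact by auto
    then show ?thesis by (simp add: kernel_def Zn_group_def)
  qed
  obtain s where s [simp]: "\<And>u. s u \<in> carrier \<Gamma>" "\<And>u. \<pi> (s u) = u"
    and sf: "\<And>u v. s u \<otimes>\<^bsub>\<Gamma>\<^esub> s v = \<iota> (f u v) \<otimes>\<^bsub>\<Gamma>\<^esub> s (u + v)"
    using f(1) by (auto simp: k_invariant_def)
  define nf where "nf k u = \<iota> k \<otimes>\<^bsub>\<Gamma>\<^esub> s u" for k u
  have \<iota>0: "\<iota> 0 = \<one>\<^bsub>\<Gamma>\<^esub>" using iadd[of 0 0] by (simp add: l_cancel_one)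
  have s0: "s 0 = \<one>\<^bsub>\<Gamma>\<^esub>" using sf[of 0 0] f(2) by (simp add: \<iota>0 l_cancel_one)
  have mult: "nf k u \<otimes>\<^bsub>\<Gamma>\<^esub> nf l v = nf (k + l + f u v) (u + v)" for k u l v
  proof -
    have "nf k u \<otimes>\<^bsub>\<Gamma>\<^esub> nf l v = \<iota> k \<otimes>\<^bsub>\<Gamma>\<^esub> (s u \<otimes>\<^bsub>\<Gamma>\<^esub> \<iota> l) \<otimes>\<^bsub>\<Gamma>\<^esub> s v" by (simp add: nf_def m_assoc)
    also have "\<dots> = (\<iota> k \<otimes>\<^bsub>\<Gamma>\<^esub> \<iota> l) \<otimes>\<^bsub>\<Gamma>\<^esub> (s u \<otimes>\<^bsub>\<Gamma>\<^esub> s v)"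
      by (simp only: cen[OF s(1), symmetric]) (simp add: m_assoc)
    also have "\<dots> = nf (k + l + f u v) (u + v)"
      by (simp add: sf nf_def iadd flip: m_assoc)
    finally show ?thesis .
  qed
  have "bij_betw (\<lambda>(k, u). nf k u) UNIV (carrier \<Gamma>)"
    unfolding bij_betw_def
  proof
    show "inj (\<lambda>(k, u). nf k u)"
    proof (rule injI, clarify)
      fix k u l v assume eq: "nf k u = nf l v"
      then have "\<pi> (nf k u) = \<pi> (nf l v)" by simp
      then have "u = v" by (simp add: nf_def pmul p\<iota>)
      then show "k = l \<and> u = v" using eq by (simp add: nf_def iinj)
    qed
    show "range (\<lambda>(k, u). nf k u) = carrier \<Gamma>"
    proof
      show "range (\<lambda>(k, u). nf k u) \<subseteq> carrier \<Gamma>" by (auto simp: nf_def)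
      show "carrier \<Gamma> \<subseteq> range (\<lambda>(k, u). nf k u)"
      proof
        fix g assume g [simp]: "g \<in> carrier \<Gamma>"
        have "\<pi> (g \<otimes>\<^bsub>\<Gamma>\<^esub> inv\<^bsub>\<Gamma>\<^esub> s (\<pi> g)) + \<pi> (s (\<pi> g)) = \<pi> g"
          by (simp add: m_assoc flip: pmul del: s(2))
        then have "\<pi> (g \<otimes>\<^bsub>\<Gamma>\<^esub> inv\<^bsub>\<Gamma>\<^esub> s (\<pi> g)) = 0" by simp
        from ker[OF _ this] obtain k where "g \<otimes>\<^bsub>\<Gamma>\<^esub> inv\<^bsub>\<Gamma>\<^esub> s (\<pi> g) = \<iota> k" by auto
        then have "g = nf k (\<pi> g)" unfolding nf_def by (metis g s(1) icl inv_solve_right')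
        then show "g \<in> range (\<lambda>(k, u). nf k u)" by (metis case_prod_conv rangeI)
      qed
    qed
  qed
  moreover have "\<iota> 1 = nf 1 0" by (simp add: nf_def s0)
  ultimately show ?thesis using mult by blast
qed

section \<open>Homomorphisms as families of unitary matrices\<close>

lemma (in heisenberg_data) cocycle_in_two_cocycles: "cocycle \<in> two_cocycles"
  by (simp add: two_cocycles_def cocycle_add_left cocycle_add_right)

lemma (in heisenberg_data) cocycle_in_H2_class: "cocycle \<in> H2_class cocycle"
  using cocycle_in_two_cocycles by (auto simp: H2_class_def cohomologous_def intro!: exI[of _ "\<lambda>_. 0"])

lemma (in heisenberg_data) rep_of_hom:
  assumes bij: "bij_betw (\<lambda>(k, u). nf k u) UNIV (carrier \<Gamma>)"
    and mult: "\<And>k u l v. nf k u \<otimes>\<^bsub>\<Gamma>\<^esub> nf l v = nf (k + l + cocycle u v) (u + v)"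
    and f: "f \<in> Hom_U \<Gamma>"
  shows "is_rep (\<lambda>k u. f (nf k u))"
proof -
  have "nf k u \<in> carrier \<Gamma>" for k u using bij by (auto simp: bij_betw_def)
  then show ?thesis using hom_U_unitary[OF f] hom_U_mult[OF f] by (simp add: is_rep_def flip: mult)
qed

text \<open>Normal forms are unique, so \<open>(k, u)\<close> can be read off from a group element;
  restriction to the carrier gives extensionality.\<close>

lemma (in heisenberg_data) hom_of_rep:
  assumes bij: "bij_betw (\<lambda>(k, u). nf k u) UNIV (carrier \<Gamma>)"
    and mult: "\<And>k u l v. nf k u \<otimes>\<^bsub>\<Gamma>\<^esub> nf l v = nf (k + l + cocycle u v) (u + v)"
    and G: "is_rep G"
  shows "\<exists>f\<in>Hom_U \<Gamma>. \<forall>k u. f (nf k u) = G k u"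
proof -
  define f where "f = (\<lambda>g\<in>carrier \<Gamma>. case inv_into UNIV (\<lambda>(k, u). nf k u) g of (k, u) \<Rightarrow> G k u)"
  have NC: "nf k u \<in> carrier \<Gamma>" for k u using bij by (auto simp: bij_betw_def)
  have fN: "f (nf k u) = G k u" for k u
  proof -
    have "inv_into UNIV (\<lambda>(k, u). nf k u) (nf k u) = (k, u)"
      using inv_f_f[of "\<lambda>(k, u). nf k u" "(k, u)"] bij by (simp add: bij_betw_def)
    then show ?thesis using NC by (simp add: f_def)
  qed
  have ex: "\<exists>k u. g = nf k u" if "g \<in> carrier \<Gamma>" for g
  proof -
    have "g \<in> range (\<lambda>(k, u). nf k u)" using bij that by (simp add: bij_betw_def)
    then show ?thesis by auto
  qed
  have "f \<in> hom \<Gamma> unitary_group"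
  proof (rule homI)
    fix g h assume "g \<in> carrier \<Gamma>" "h \<in> carrier \<Gamma>"
    then obtain k u l v where gh: "g = nf k u" "h = nf l v" using ex by metis
    show "f g \<in> carrier unitary_group"
      by (simp add: gh fN unitary_group_def rep_unitary[OF G])
    show "f (g \<otimes>\<^bsub>\<Gamma>\<^esub> h) = f g \<otimes>\<^bsub>unitary_group\<^esub> f h"
      by (simp add: gh mult fN unitary_group_def rep_mult[OF G])
  qed
  then have "f \<in> Hom_U \<Gamma>" by (simp add: Hom_U_def f_def)
  then show ?thesis using fN by blast
qed

text \<open>\<open>rep_path\<close> is carried over through the normal form. Since every group
  element has one, all evaluations are continuous along the path, whichever elements
  \<open>a i\<close> define the topology.\<close>

lemma (in heisenberg_data) path_connectedin_Hom_U_charpoly: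
  fixes \<Gamma> :: "('g, 'b) monoid_scheme"
  assumes bij: "bij_betw (\<lambda>(k, u). nf k u) UNIV (carrier \<Gamma>)"
    and mult: "\<And>k u l v. nf k u \<otimes>\<^bsub>\<Gamma>\<^esub> nf l v = nf (k + l + cocycle u v) (u + v)"
    and a: "\<And>i. i \<in> {1..n} \<Longrightarrow> a i \<in> carrier \<Gamma>"
  shows "path_connectedin (Hom_U_topology \<Gamma> n (nf 1 0) a)
    (Hom_U_charpoly \<Gamma> (nf 1 0) p :: ('g \<Rightarrow> complex ^ 'm ^ 'm) set)"
proof -
  let ?x = "nf 1 0"
  let ?X = "Hom_U_topology \<Gamma> n ?x a :: ('g \<Rightarrow> complex ^ 'm ^ 'm) topology"
  have NC: "nf k u \<in> carrier \<Gamma>" for k u using bij by (auto simp: bij_betw_def)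
  have ex: "\<exists>k u. g = nf k u" if "g \<in> carrier \<Gamma>" for g
  proof -
    have "g \<in> range (\<lambda>(k, u). nf k u)" using bij that by (simp add: bij_betw_def)
    then show ?thesis by auto
  qed
  show ?thesis
    unfolding path_connectedin
  proof (intro conjI ballI)
    show "Hom_U_charpoly \<Gamma> ?x p \<subseteq> topspace ?X"
      using topspace_Hom_U_topology[of ?x \<Gamma> n a, OF NC a] by (auto simp: Hom_U_charpoly_def)
    fix f f' :: "'g \<Rightarrow> complex ^ 'm ^ 'm"
    assume "f \<in> Hom_U_charpoly \<Gamma> ?x p" "f' \<in> Hom_U_charpoly \<Gamma> ?x p"
    then have f: "f \<in> Hom_U \<Gamma>" "charpoly (f ?x) = p" and f': "f' \<in> Hom_U \<Gamma>" "charpoly (f' ?x) = p"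
      by (auto simp: Hom_U_charpoly_def)
    obtain P :: "real \<Rightarrow> _" where P: "P 0 = (\<lambda>k u. f (nf k u))" "P 1 = (\<lambda>k u. f' (nf k u))"
      "\<And>s. is_rep (P s)" "\<And>s. charpoly (P s 1 0) = p" "\<And>k u. continuous_on UNIV (\<lambda>s. P s k u)"
      using rep_path[OF rep_of_hom[OF bij mult f(1)] f(2) rep_of_hom[OF bij mult f'(1)] f'(2)] by blast
    have "\<forall>s. \<exists>h\<in>Hom_U \<Gamma>. \<forall>k u. h (nf k u) = P s k u"
      using hom_of_rep[OF bij mult P(3)] by blast
    then obtain F where F: "\<And>s. F s \<in> Hom_U \<Gamma>" "\<And>s k u. F s (nf k u) = P s k u" by metis
    \<comment> \<open>Identifies the ends of the path: an extensional homomorphism is fixed by its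
      values on normal forms.\<close>
    have eqI: "h = h'" if "h \<in> Hom_U \<Gamma>" "h' \<in> Hom_U \<Gamma>" "\<And>k u. h (nf k u) = h' (nf k u)"
      for h h' :: "'g \<Rightarrow> complex ^ 'm ^ 'm"
    proof (rule extensionalityI)
      show "h \<in> extensional (carrier \<Gamma>)" "h' \<in> extensional (carrier \<Gamma>)"
        using that by (auto simp: Hom_U_def)
      show "h g = h' g" if "g \<in> carrier \<Gamma>" for g using ex[OF that] \<open>\<And>k u. h (nf k u) = h' (nf k u)\<close> by auto
    qed
    have "pathin ?X F"
    proof (rule pathin_Hom_U_topology[OF NC a F(1)])
      fix g assume "g \<in> carrier \<Gamma>"
      then obtain k u where "g = nf k u" using ex by blast
      then show "continuous_on UNIV (\<lambda>s. F s g)" using P(5) by (simp add: F(2))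
    qed
    moreover have "F 0 = f" "F 1 = f'"
      using F P(1,2) f f' by (auto intro!: eqI)
    moreover have "F s \<in> Hom_U_charpoly \<Gamma> ?x p" for s
      using F P(4) by (simp add: Hom_U_charpoly_def)
    ultimately show "\<exists>g. pathin ?X g \<and> g \<in> {0..1} \<rightarrow> Hom_U_charpoly \<Gamma> ?x p \<and> g 0 = f \<and> g 1 = f'"
      by blast
  qed
qed

section \<open>Decomposition into components and their number\<close>

theorem theoremA:
  fixes \<Gamma> :: "('g, 'b) monoid_scheme"
    and \<iota> :: "int \<Rightarrow> 'g"
    and \<pi> :: "'g \<Rightarrow> int ^ 'n"
    and \<omega> :: "(int ^ 'n \<Rightarrow> int ^ 'n \<Rightarrow> int) set"
    and e :: "nat \<Rightarrow> int ^ 'n"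
    and t :: nat and c :: "nat \<Rightarrow> nat"
    and x :: 'g and a :: "nat \<Rightarrow> 'g"
    and X :: "('g \<Rightarrow> complex ^ 'm ^ 'm) topology"
  assumes ext: "central_extension \<Gamma> \<iota> \<pi>"
    and k_inv: "\<omega> = k_invariant \<Gamma> \<iota> \<pi>"
    and nontrivial: "\<omega> \<noteq> H2_class (\<lambda>u v. 0)"
    and basis: "Zn_basis e"
    and t: "1 \<le> t" "2 * t \<le> CARD('n)"
    and c_pos: "\<And>i. 1 \<le> i \<Longrightarrow> i \<le> t \<Longrightarrow> c i > 0"
    and c_dvd: "\<And>i. 1 \<le> i \<Longrightarrow> i \<le> t - 1 \<Longrightarrow> c i dvd c (i + 1)"
    and \<omega>: "\<omega> = H2_class (\<lambda>u v. \<Sum>i = 1..t. int (c i) * cup (dual_basis e i) (dual_basis e (t + i)) u v)"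
    and x: "x = \<iota> 1"
    and lifts: "\<And>i. 1 \<le> i \<Longrightarrow> i \<le> CARD('n) \<Longrightarrow> a i \<in> carrier \<Gamma> \<and> \<pi> (a i) = e i"
    and X: "X = Hom_U_topology \<Gamma> CARD('n) x a"
  shows "topspace X = Hom_U \<Gamma> \<and>
    Hom_U \<Gamma> = (\<Union>p \<in> admissible_polys t c CARD('m).
      Hom_U_charpoly \<Gamma> x p :: ('g \<Rightarrow> complex ^ 'm ^ 'm) set) \<and>
    disjoint_family_on (Hom_U_charpoly \<Gamma> x :: _ \<Rightarrow> ('g \<Rightarrow> complex ^ 'm ^ 'm) set)
      (admissible_polys t c CARD('m)) \<and>
    (\<forall>p \<in> admissible_polys t c CARD('m).
      Hom_U_charpoly \<Gamma> x p \<noteq> ({} :: ('g \<Rightarrow> complex ^ 'm ^ 'm) set) \<and>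
      openin X (Hom_U_charpoly \<Gamma> x p)) \<and>
    connected_components_of X = Hom_U_charpoly \<Gamma> x ` admissible_polys t c CARD('m) \<and>
    finite (connected_components_of X) \<and>
    convergent_prod (gen_factor t c) \<and>
    of_nat (card (connected_components_of X)) = fps_nth (prodinf (gen_factor t c)) CARD('m)"
proof -
  interpret heisenberg_data "dual_basis e" e "CARD('n)" t c
    using Zn_basis_heisenberg_data[OF basis t] c_pos by simp
  \<comment> \<open>The given representative is literally \<open>cocycle\<close>; as the k-invariant
    is the set of all factor sets, some section has exactly this one.\<close>
  have "(\<lambda>u v. \<Sum>i = 1..t. int (c i) * cup (dual_basis e i) (dual_basis e (t + i)) u v) = cocycle"
    by (simp add: fun_eq_iff cocycle_def cup_def)
  then have "cocycle \<in> k_invariant \<Gamma> \<iota> \<pi>" using cocycle_in_H2_class k_inv \<omega> by simp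
  then obtain nf where bij: "bij_betw (\<lambda>(k, u). nf k u) UNIV (carrier \<Gamma>)"
    and mult: "\<And>k u l v. nf k u \<otimes>\<^bsub>\<Gamma>\<^esub> nf l v = nf (k + l + cocycle u v) (u + v)" and N1: "\<iota> 1 = nf 1 0"
    using central_extension_normal_form[OF ext, of cocycle] by auto
  have xN: "x = nf 1 0" using x N1 by simp
  have xC: "x \<in> carrier \<Gamma>" using bij by (auto simp: xN bij_betw_def)
  have aC: "a i \<in> carrier \<Gamma>" if "i \<in> {1..CARD('n)}" for i using lifts that by simp
  let ?A = "admissible_polys t c CARD('m)"
  let ?H = "Hom_U_charpoly \<Gamma> x :: _ \<Rightarrow> ('g \<Rightarrow> complex ^ 'm ^ 'm) set"
  have top: "topspace X = Hom_U \<Gamma>" unfolding X by (rule topspace_Hom_U_topology[OF xC aC])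
  have fin: "finite ?A" using finite_admissible_polys c_pos t by simp
  have cover: "Hom_U \<Gamma> = (\<Union>p\<in>?A. ?H p)"
  proof -
    have "charpoly (f x) \<in> ?A" if "f \<in> Hom_U \<Gamma>" for f :: "'g \<Rightarrow> complex ^ 'm ^ 'm"
      using canonical_form(1)[OF rep_of_hom[OF bij mult that] refl] by (simp add: xN)
    then show ?thesis by (auto simp: Hom_U_charpoly_def)
  qed
  have disj: "disjoint_family_on ?H ?A"
    by (auto simp: disjoint_family_on_def Hom_U_charpoly_def)
  have ne: "?H p \<noteq> {}" if p: "p \<in> ?A" for p
  proof -
    obtain G :: "int \<Rightarrow> int ^ 'n \<Rightarrow> complex ^ 'm ^ 'm" where G: "is_rep G" "charpoly (G 1 0) = p"
      using rep_exists[OF p] by blast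
    obtain f where "f \<in> Hom_U \<Gamma>" "f x = G 1 0" using hom_of_rep[OF bij mult G(1)] by (auto simp: xN)
    then have "f \<in> ?H p" using G(2) by (simp add: Hom_U_charpoly_def)
    then show ?thesis by blast
  qed
  have closed: "closedin X (?H p)" for p unfolding X by (rule closedin_Hom_U_charpoly[OF xC aC])
  have "open": "openin X (?H p)" if "p \<in> ?A" for p
  proof -
    \<comment> \<open>Openness comes from finiteness of the index set: the complement is a finite
      union of closed pieces.\<close>
    have "?H p = topspace X - (\<Union>q\<in>?A - {p}. ?H q)"
      unfolding top cover using that by (auto simp: Hom_U_charpoly_def)
    moreover have "closedin X (\<Union>q\<in>?A - {p}. ?H q)" using fin closed by (intro closedin_Union) auto
    ultimately show ?thesis by auto
  qed
  have conn: "connectedin X (?H p)" for p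
    unfolding X xN
    by (intro path_connectedin_imp_connectedin path_connectedin_Hom_U_charpoly bij mult aC)
  have comps: "connected_components_of X = ?H ` ?A"
    by (rule connected_components_of_clopen_partition)
       (use top cover disj ne conn closed "open" in auto)
  \<comment> \<open>Disjoint nonempty pieces are distinct, so counting components amounts to
    counting polynomials.\<close>
  have "inj_on ?H ?A"
    using disj ne by (intro inj_onI) (metis Int_absorb disjoint_family_on_def)
  then have "card (connected_components_of X) = card ?A" by (simp add: comps card_image)
  moreover have prod: "gen_factor t c has_prod Abs_fps (\<lambda>n. of_nat (card (admissible_polys t c n)))"
    using t c_pos by (intro gen_factor_has_prod) auto
  ultimately have "of_nat (card (connected_components_of X)) = fps_nth (prodinf (gen_factor t c)) CARD('m)"
    by (simp flip: has_prod_unique)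
  moreover have "convergent_prod (gen_factor t c)"
    using prod unfolding has_prod_def convergent_prod_def by blast
  ultimately show ?thesis using top cover disj ne "open" comps fin by auto
qed

end
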